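(* Let $N>1$. If $\mu$ is a Siegel measure on $\mathcal{M}_N$, there exist $c\ge0$ and a singular Siegel measure $\mu^s$ such that $\mu=S^c_*\mu^s$. In particular, if $\nu\prec m$ for $\mu$-a.e. $\nu$, then $\mu$ is a point mass at $cm$ for some $c\ge0$.
   Context: $\mathcal{M}_N$ is the set of Borel measures $\nu$ on $\mathbf{R}^N$ with $\sup_{R>0}\nu(B(0,R))/R^N<\infty$, where $B(0,R)$ is the open ball of radius $R$ about $0$, endowed with the $C_c(\mathbf{R}^N)$ weak-$*$ topology and its Borel $\sigma$-algebra. $G_N=\mathrm{SL}(N,\mathbf{R})$ acts on $\mathcal{M}_N$ by $(g\nu)(E)=\nu(g^{-1}E)$. A Siegel measure is a Borel probability measure on $\mathcal{M}_N$ which is invariant and ergodic for this action. $m$ is Lebesgue measure on $\mathbf{R}^N$. For $c\ge0$, $S^c:\mathcal{M}_N\to\mathcal{M}_N$ is $S^c\nu=\nu+cm$, and $S^c_*$ is the induced pushforward on Borel probability measures on $\mathcal{M}_N$. A Siegel measure $\mu$ is singular if $\nu\perp m$ (mutually singular) for $\mu$-a.e. $\nu$; the point mass at the zero measure $\nu\equiv0$ is considered to be a singular Siegel measure. $\nu\prec m$ means $\nu$ is absolutely continuous with respect to $m$. *)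

theory Defs
  imports "HOL-Probability.Probability"
begin

definition density_bounded_measures :: "(real ^ 'n) measure set" where
  "density_bounded_measures =
     {\<nu>. sets \<nu> = sets borel \<and>
          (SUP R\<in>{0::real<..}. emeasure \<nu> (ball 0 R) / ennreal (R ^ CARD('n))) < \<infinity>}"

definition Cc :: "('a::topological_space \<Rightarrow> real) set" where
  "Cc = {f. continuous_on UNIV f \<and> compact (closure {x. f x \<noteq> 0})}"

text \<open>The weak-* topology: the coarsest topology on the set of density bounded measures that
  makes all the maps \<open>\<nu> \<mapsto> \<integral> f d\<nu>\<close>, for \<open>f\<close> in \<open>Cc\<close>, continuous.\<close>

definition weak_star_topology :: "(real ^ 'n) measure topology" where
  "weak_star_topology = topology_generated_by
     {{\<nu> \<in> density_bounded_measures. integral\<^sup>L \<nu> f \<in> U} | f U. f \<in> Cc \<and> open U}"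

definition weak_star_borel :: "(real ^ 'n) measure measure" where
  "weak_star_borel = sigma density_bounded_measures {U. openin weak_star_topology U}"

definition SL :: "(real ^ 'n ^ 'n) set" where
  "SL = {g. det g = 1}"

definition act :: "real ^ 'n ^ 'n \<Rightarrow> (real ^ 'n) measure \<Rightarrow> (real ^ 'n) measure" where
  "act g \<nu> = distr \<nu> borel ((*v) g)"

definition ergodic_SL :: "(real ^ 'n) measure measure \<Rightarrow> bool" where
  "ergodic_SL \<mu> \<longleftrightarrow>
     (\<forall>A\<in>sets \<mu>. (\<forall>g\<in>SL. act g ` A = A) \<longrightarrow> emeasure \<mu> A = 0 \<or> emeasure \<mu> A = 1)"

definition siegel_measure :: "(real ^ 'n) measure measure \<Rightarrow> bool" where
  "siegel_measure \<mu> \<longleftrightarrow>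
     sets \<mu> = sets weak_star_borel \<and> prob_space \<mu> \<and>
     (\<forall>g\<in>SL. distr \<mu> weak_star_borel (act g) = \<mu>) \<and> ergodic_SL \<mu>"

definition mutually_singular :: "'a measure \<Rightarrow> 'a measure \<Rightarrow> bool" where
  "mutually_singular M N \<longleftrightarrow>
     (\<exists>A\<in>sets M \<inter> sets N. emeasure M A = 0 \<and> emeasure N (space N - A) = 0)"

text \<open>The zero measure is mutually singular to \<open>lborel\<close>, so the point mass at the zero measure is
  singular in this sense; see \<open>singular_siegel_measure_zero\<close> below.\<close>

definition singular_siegel_measure :: "(real ^ 'n) measure measure \<Rightarrow> bool" where
  "singular_siegel_measure \<mu> \<longleftrightarrow>
     siegel_measure \<mu> \<and> (AE \<nu> in \<mu>. mutually_singular \<nu> lborel)"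

definition add_lebesgue :: "real \<Rightarrow> (real ^ 'n) measure \<Rightarrow> (real ^ 'n) measure" where
  "add_lebesgue c \<nu> =
     measure_of UNIV (sets borel) (\<lambda>E. emeasure \<nu> E + emeasure (scale_measure (ennreal c) lborel) E)"


text \<open>\<open>measure_of\<close> and \<open>distr\<close> are only meaningful for countably additive set functions and
  measurable maps. The following facts show that this is the case for \<open>add_lebesgue\<close> and \<open>act\<close>, and for
  the pushforwards along them.\<close>

lemma sets_add_lebesgue [simp]: "sets (add_lebesgue c \<nu>) = sets borel"
  unfolding add_lebesgue_def by (metis sets.sets_measure_of_eq space_borel)

lemma emeasure_add_lebesgue:
  fixes \<nu> :: "(real ^ 'n) measure"
  assumes "sets \<nu> = sets borel" "E \<in> sets borel"
  shows "emeasure (add_lebesgue c \<nu>) E = emeasure \<nu> E + ennreal c * emeasure lborel E"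
proof -
  let ?f = "\<lambda>E. emeasure \<nu> E + emeasure (scale_measure (ennreal c) lborel) E"
  have sp: "space \<nu> = UNIV"
    using assms(1) sets_eq_imp_space_eq by fastforce
  have "countably_additive (sets borel) ?f"
  proof (rule countably_additiveI)
    fix A :: "nat \<Rightarrow> (real ^ 'n) set"
    assume A: "range A \<subseteq> sets borel" "disjoint_family A"
    have "(\<Sum>i. ?f (A i)) =
        (\<Sum>i. emeasure \<nu> (A i)) + (\<Sum>i. emeasure (scale_measure (ennreal c) lborel) (A i))"
      by (rule suminf_add[symmetric]) auto
    also have "\<dots> = ?f (\<Union>i. A i)"
      using A assms(1) by (subst (1 2) suminf_emeasure) auto
    finally show "(\<Sum>i. ?f (A i)) = ?f (\<Union>i. A i)" .
  qed
  then have "emeasure (add_lebesgue c \<nu>) E = ?f E"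
    by (intro emeasure_measure_of[OF add_lebesgue_def])
       (use assms in \<open>auto simp: positive_def\<close>)
  then show ?thesis by simp
qed

lemma sets_act [simp]: "sets (act g \<nu>) = sets borel"
  by (simp add: act_def)

lemma emeasure_act:
  fixes g :: "real ^ 'n ^ 'n"
  assumes "g \<in> SL" "sets \<nu> = sets borel" "E \<in> sets borel"
  shows "emeasure (act g \<nu>) E = emeasure \<nu> ((*v) (matrix_inv g) ` E)"
proof -
  have "invertible g"
    using assms(1) by (simp add: SL_def invertible_det_nz)
  then have inv: "g ** matrix_inv g = mat 1 \<and> matrix_inv g ** g = mat 1"
    unfolding invertible_def matrix_inv_def by (rule someI_ex)
  have sp: "space \<nu> = UNIV"
    using assms(2) sets_eq_imp_space_eq by fastforce
  have m: "(*v) g \<in> measurable \<nu> borel"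
    unfolding measurable_cong_sets[OF assms(2) refl]
    by (intro borel_measurable_continuous_onI matrix_vector_mult_linear_continuous_on)
  have "(*v) g -` E = (*v) (matrix_inv g) ` E"
  proof (intro set_eqI iffI)
    fix x assume "x \<in> (*v) g -` E"
    moreover have "x = matrix_inv g *v (g *v x)"
      using inv by (simp add: matrix_vector_mul_assoc)
    ultimately show "x \<in> (*v) (matrix_inv g) ` E" by blast
  next
    fix x assume "x \<in> (*v) (matrix_inv g) ` E"
    then show "x \<in> (*v) g -` E"
      using inv by (auto simp: matrix_vector_mul_assoc)
  qed
  then show ?thesis
    using assms(3) by (simp add: act_def emeasure_distr[OF m] sp)
qed


lemma density_bounded_measures_iff:
  fixes \<nu> :: "(real ^ 'n) measure"
  shows "\<nu> \<in> density_bounded_measures \<longleftrightarrow> sets \<nu> = sets borel \<and>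
    (\<exists>C::real. 0 \<le> C \<and> (\<forall>R>0. emeasure \<nu> (ball 0 R) \<le> ennreal (C * R ^ CARD('n))))"
    (is "?L \<longleftrightarrow> ?R")
proof
  assume L: ?L
  let ?S = "SUP R\<in>{0::real<..}. emeasure \<nu> (ball 0 R) / ennreal (R ^ CARD('n))"
  have fin: "?S < \<infinity>" using L by (simp add: density_bounded_measures_def)
  then obtain C where C: "0 \<le> C" "?S = ennreal C"
    by (cases ?S) auto
  have "emeasure \<nu> (ball 0 R) \<le> ennreal (C * R ^ CARD('n))" if "R > 0" for R :: real
  proof -
    let ?r = "ennreal (R ^ CARD('n))" and ?m = "emeasure \<nu> (ball 0 R)"
    have le: "?m / ?r \<le> ennreal C"
      unfolding C(2)[symmetric] by (rule SUP_upper) (use that in auto)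
    have r: "?r \<noteq> 0" "?r \<noteq> \<top>" using that by auto
    have "?m = ?r * (?m / ?r)"
      using r by (metis ennreal_times_divide mult.commute mult_divide_eq_ennreal)
    also have "\<dots> \<le> ?r * ennreal C"
      using le by (rule mult_left_mono) simp
    also have "\<dots> = ennreal (C * R ^ CARD('n))"
      using that C(1) by (simp add: ennreal_mult' mult.commute)
    finally show ?thesis .
  qed
  then show ?R using L C(1) by (auto simp: density_bounded_measures_def)
next
  assume ?R
  then obtain C where C: "0 \<le> C" "\<And>R. R > 0 \<Longrightarrow> emeasure \<nu> (ball 0 R) \<le> ennreal (C * R ^ CARD('n))"
    and s: "sets \<nu> = sets borel" by auto
  have "(SUP R\<in>{0::real<..}. emeasure \<nu> (ball 0 R) / ennreal (R ^ CARD('n))) \<le> ennreal C"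
  proof (rule SUP_least)
    fix R :: real assume "R \<in> {0<..}"
    then show "emeasure \<nu> (ball 0 R) / ennreal (R ^ CARD('n)) \<le> ennreal C"
      using C by (intro divide_le_posI_ennreal) (auto simp: ennreal_mult' mult.commute)
  qed
  then show ?L using s by (auto simp: density_bounded_measures_def intro: le_less_trans)
qed

lemma integrable_Cc:
  fixes \<nu> :: "(real ^ 'n) measure"
  assumes "\<nu> \<in> density_bounded_measures" "f \<in> Cc"
  shows "integrable \<nu> f"
proof -
  have s: "sets \<nu> = sets borel" using assms(1) by (simp add: density_bounded_measures_def)
  have cont: "continuous_on UNIV f" and cpt: "compact (closure {x. f x \<noteq> 0})"
    using assms(2) by (auto simp: Cc_def)
  obtain R where R: "R > 0" "closure {x. f x \<noteq> 0} \<subseteq> ball 0 R"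
    using bounded_subset_ballD[OF compact_imp_bounded[OF cpt], of 0] by auto
  have "bounded (f ` closure {x. f x \<noteq> 0})"
    by (intro compact_imp_bounded compact_continuous_image cpt continuous_on_subset[OF cont]) auto
  then obtain B where B: "\<And>x. x \<in> closure {x. f x \<noteq> 0} \<Longrightarrow> norm (f x) \<le> B"
    by (auto simp: bounded_iff)
  have B': "norm (f x) \<le> max B 0" for x
  proof (cases "f x = 0")
    case False
    then have "x \<in> closure {x. f x \<noteq> 0}"
      using closure_subset[of "{x. f x \<noteq> 0}"] by auto
    then show ?thesis using B by fastforce
  qed simp
  have fm: "f \<in> borel_measurable \<nu>"
    unfolding measurable_cong_sets[OF s refl] using cont by (rule borel_measurable_continuous_onI)
  have "emeasure \<nu> (ball 0 R) < \<infinity>"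
    using assms(1) R(1) unfolding density_bounded_measures_iff
    by (metis ennreal_less_top infinity_ennreal_def le_less_trans)
  moreover have "AE x in \<nu>. x \<in> space \<nu> - ball 0 R \<longrightarrow> f x = 0"
    using R(2) closure_subset[of "{x. f x \<noteq> 0}"] by (intro AE_I2) auto
  ultimately show ?thesis
    by (intro integrableI_bounded_set[of "ball 0 R" \<nu> f "max B 0"])
       (use fm s B' in \<open>auto intro!: AE_I2\<close>)
qed

lemma topspace_weak_star [simp]: "topspace weak_star_topology = density_bounded_measures"
proof -
  have "(\<lambda>x. 0) \<in> Cc" by (simp add: Cc_def)
  then show ?thesis
    unfolding weak_star_topology_def topology_generated_by_topspace by (auto intro!: exI[of _ UNIV])
qed

lemma space_weak_star_borel [simp]: "space weak_star_borel = density_bounded_measures"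
  by (simp add: weak_star_borel_def space_measure_of_conv)

lemma sets_weak_star_borel:
  "sets weak_star_borel =
     sigma_sets density_bounded_measures {U. openin weak_star_topology U}"
  unfolding weak_star_borel_def
  by (rule sets_measure_of) (use openin_subset in \<open>fastforce\<close>)

lemma continuous_map_imp_measurable_weak_star:
  fixes F :: "(real ^ 'n) measure \<Rightarrow> (real ^ 'n) measure"
  assumes "continuous_map weak_star_topology weak_star_topology F"
  shows "F \<in> measurable weak_star_borel weak_star_borel"
proof (rule measurable_sigma_sets[OF sets_weak_star_borel])
  fix U :: "(real ^ 'n) measure set" assume "U \<in> {U. openin weak_star_topology U}"
  then have "openin weak_star_topology (F -` U \<inter> density_bounded_measures)"
    using assms by (auto simp: continuous_map_alt)
  then show "F -` U \<inter> space weak_star_borel \<in> sets weak_star_borel"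
    by (auto simp: sets_weak_star_borel)
qed (use assms openin_subset[of weak_star_topology] in \<open>auto simp: continuous_map_def Pi_iff\<close>)

lemma continuous_map_weak_starI:
  fixes F :: "(real ^ 'n) measure \<Rightarrow> (real ^ 'n) measure"
  assumes "\<And>\<nu>. \<nu> \<in> density_bounded_measures \<Longrightarrow> F \<nu> \<in> density_bounded_measures"
    and "\<And>f. f \<in> Cc \<Longrightarrow> \<exists>h\<in>Cc. \<exists>k. \<forall>\<nu>\<in>density_bounded_measures.
           integral\<^sup>L (F \<nu>) f = integral\<^sup>L \<nu> h + k"
  shows "continuous_map weak_star_topology weak_star_topology F"
proof -
  have "openin weak_star_topology
      (F -` {\<nu> \<in> density_bounded_measures. integral\<^sup>L \<nu> f \<in> U} \<inter> density_bounded_measures)"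
    if f: "f \<in> Cc" and U: "open U" for f :: "real ^ 'n \<Rightarrow> real" and U
  proof -
    obtain h k where h: "h \<in> Cc" and
      eq: "\<And>\<nu>. \<nu> \<in> density_bounded_measures \<Longrightarrow> integral\<^sup>L (F \<nu>) f = integral\<^sup>L \<nu> h + k"
      using assms(2)[OF f] by blast
    have "open ((\<lambda>t. t + k) -` U)"
      using U by (intro continuous_open_vimage) (auto intro: continuous_intros)
    then have "openin weak_star_topology
        {\<nu> \<in> density_bounded_measures. integral\<^sup>L \<nu> h \<in> (\<lambda>t. t + k) -` U}"
      unfolding weak_star_topology_def using h by (intro topology_generated_by_Basis) blast
    also have "{\<nu> \<in> density_bounded_measures. integral\<^sup>L \<nu> h \<in> (\<lambda>t. t + k) -` U} =
        F -` {\<nu> \<in> density_bounded_measures. integral\<^sup>L \<nu> f \<in> U} \<inter> density_bounded_measures"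
      using assms(1) eq by auto
    finally show ?thesis .
  qed
  moreover have "F ` density_bounded_measures \<subseteq> topspace weak_star_topology"
    using assms(1) by auto
  ultimately show ?thesis
    unfolding topspace_weak_star[symmetric]
    by (subst (2) weak_star_topology_def, subst continuous_on_generated_topo_iff)
       (auto simp: weak_star_topology_def[symmetric] topology_generated_by_topspace[symmetric]
          simp del: topology_generated_by_topspace)
qed

lemma nn_integral_add_lebesgue:
  fixes \<nu> :: "(real ^ 'n) measure"
  assumes s: "sets \<nu> = sets borel" and f: "f \<in> borel_measurable borel"
  shows "nn_integral (add_lebesgue c \<nu>) f = nn_integral \<nu> f + ennreal c * nn_integral lborel f"
  using f
proof (induction rule: borel_measurable_induct)
  case (cong f g)
  then have "f = g" by auto
  with cong show ?case by simp
next
  case (set A)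
  then show ?case using s by (simp add: emeasure_add_lebesgue)
next
  case (mult u k)
  then show ?case
    by (subst (1 2 3) nn_integral_cmult)
       (auto simp: measurable_cong_sets[OF s refl] measurable_cong_sets[OF sets_add_lebesgue refl]
          algebra_simps)
next
  case (add u v)
  then show ?case
    by (subst (1 2 3) nn_integral_add)
       (auto simp: measurable_cong_sets[OF s refl] measurable_cong_sets[OF sets_add_lebesgue refl]
          algebra_simps)
next
  case (seq U)
  have m: "U i \<in> borel_measurable \<nu>" "U i \<in> borel_measurable (add_lebesgue c \<nu>)"
    "U i \<in> borel_measurable lborel" for i
    using seq.hyps(1) by (auto simp: measurable_cong_sets[OF s refl] measurable_cong_sets[OF sets_add_lebesgue refl])
  have mono: "incseq (\<lambda>i. nn_integral M (U i))" for M :: "(real ^ 'n) measure"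
    using \<open>incseq U\<close> by (auto simp: incseq_def le_fun_def intro!: nn_integral_mono)
  have sup: "nn_integral M (\<lambda>x. SUP i. U i x) = (SUP i. nn_integral M (U i))"
    if "\<And>i. U i \<in> borel_measurable M" for M :: "(real ^ 'n) measure"
    using \<open>incseq U\<close> that
    by (rule nn_integral_monotone_convergence_SUP)
  have "incseq (\<lambda>i. ennreal c * nn_integral lborel (U i))"
    using mono[of lborel] by (auto simp: incseq_def intro!: mult_left_mono)
  then show ?case
    unfolding SUP_apply[abs_def] sup[OF m(1)] sup[OF m(2)] sup[OF m(3)] seq.IH
    by (simp add: SUP_mult_left_ennreal ennreal_SUP_add mono)
qed

lemma integral_add_lebesgue:
  fixes \<nu> :: "(real ^ 'n) measure"
  assumes s: "sets \<nu> = sets borel" and c: "c \<ge> 0"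
    and f: "integrable \<nu> f" "integrable lborel f"
  shows "integral\<^sup>L (add_lebesgue c \<nu>) f = integral\<^sup>L \<nu> f + c * integral\<^sup>L lborel f"
proof -
  have fm[measurable]: "f \<in> borel_measurable borel"
    using f(2) by auto
  have fm': "f \<in> borel_measurable (add_lebesgue c \<nu>)"
    by (simp add: measurable_cong_sets[OF sets_add_lebesgue refl])
  have n: "nn_integral (add_lebesgue c \<nu>) (\<lambda>x. ennreal (g x)) =
      nn_integral \<nu> (\<lambda>x. ennreal (g x)) + ennreal c * nn_integral lborel (\<lambda>x. ennreal (g x))"
    if "g \<in> borel_measurable borel" for g :: "real ^ 'n \<Rightarrow> real"
    using that by (intro nn_integral_add_lebesgue[OF s]) auto
  have fin: "nn_integral \<nu> (\<lambda>x. ennreal (f x)) < \<infinity>" "nn_integral \<nu> (\<lambda>x. ennreal (- f x)) < \<infinity>"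
    "nn_integral lborel (\<lambda>x. ennreal (f x)) < \<infinity>" "nn_integral lborel (\<lambda>x. ennreal (- f x)) < \<infinity>"
    using f by (auto simp: real_integrable_def top.not_eq_extremum)
  have int: "integrable (add_lebesgue c \<nu>) f"
    unfolding real_integrable_def using fm' fin n[of f] n[of "\<lambda>x. - f x"]
    by (auto simp: ennreal_mult_eq_top_iff)
  show ?thesis
    unfolding real_lebesgue_integral_def[OF int] real_lebesgue_integral_def[OF f(1)]
      real_lebesgue_integral_def[OF f(2)] n[OF fm] n[OF borel_measurable_uminus[OF fm]]
    using fin c by (simp add: enn2real_plus enn2real_mult ennreal_mult_less_top algebra_simps)
qed

lemma add_lebesgue_in_density_bounded_measures:
  fixes \<nu> :: "(real ^ 'n) measure"
  assumes "c \<ge> 0" "\<nu> \<in> density_bounded_measures"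
  shows "add_lebesgue c \<nu> \<in> density_bounded_measures"
proof -
  have s: "sets \<nu> = sets borel" using assms(2) by (simp add: density_bounded_measures_iff)
  obtain C where C: "0 \<le> C" "\<And>R. R > 0 \<Longrightarrow> emeasure \<nu> (ball 0 R) \<le> ennreal (C * R ^ CARD('n))"
    using assms(2) by (auto simp: density_bounded_measures_iff)
  define K where "K = C + c * unit_ball_vol (real CARD('n))"
  have K: "0 \<le> K" using C(1) assms(1) by (auto simp: K_def intro!: add_nonneg_nonneg)
  have "emeasure (add_lebesgue c \<nu>) (ball 0 R) \<le> ennreal (K * R ^ CARD('n))" if R: "R > 0" for R
  proof -
    have "emeasure (add_lebesgue c \<nu>) (ball 0 R) =
        emeasure \<nu> (ball 0 R) + ennreal c * ennreal (unit_ball_vol (real CARD('n)) * R ^ CARD('n))"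
      using R by (simp add: emeasure_add_lebesgue[OF s] emeasure_ball)
    also have "\<dots> \<le> ennreal (C * R ^ CARD('n)) +
        ennreal c * ennreal (unit_ball_vol (real CARD('n)) * R ^ CARD('n))"
      using C(2)[OF R] by (rule add_right_mono)
    also have "\<dots> = ennreal (K * R ^ CARD('n))"
      using R C(1) assms(1) by (simp add: K_def ennreal_plus[symmetric] ennreal_mult[symmetric]
          algebra_simps del: ennreal_plus)
    finally show ?thesis .
  qed
  then show ?thesis using K by (auto simp: density_bounded_measures_iff)
qed

lemma lborel_Cc_integrable: "f \<in> Cc \<Longrightarrow> integrable lborel (f :: real ^ 'n \<Rightarrow> real)"
  by (rule integrable_Cc) (auto simp: density_bounded_measures_iff emeasure_ball
      intro!: exI[of _ "unit_ball_vol (real CARD('n))"])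

lemma measurable_add_lebesgue:
  "c \<ge> 0 \<Longrightarrow> add_lebesgue c \<in> measurable weak_star_borel (weak_star_borel :: (real ^ 'n) measure measure)"
proof (intro continuous_map_imp_measurable_weak_star continuous_map_weak_starI)
  fix f :: "real ^ 'n \<Rightarrow> real" assume c: "c \<ge> 0" and f: "f \<in> Cc"
  show "\<exists>h\<in>Cc. \<exists>k. \<forall>\<nu>\<in>density_bounded_measures. integral\<^sup>L (add_lebesgue c \<nu>) f = integral\<^sup>L \<nu> h + k"
    using f c integrable_Cc[OF _ f] lborel_Cc_integrable[OF f]
    by (intro bexI[of _ f] exI[of _ "c * integral\<^sup>L lborel f"] ballI integral_add_lebesgue)
       (auto simp: density_bounded_measures_iff)
qed (rule add_lebesgue_in_density_bounded_measures)

lemma invertible_SL: "g \<in> SL \<Longrightarrow> invertible g"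
  by (simp add: SL_def invertible_det_nz)

lemma measurable_mult_vec:
  fixes g :: "real ^ 'n ^ 'n"
  assumes "sets \<nu> = sets borel"
  shows "(*v) g \<in> measurable \<nu> borel"
  unfolding measurable_cong_sets[OF assms refl]
  by (intro borel_measurable_continuous_onI matrix_vector_mult_linear_continuous_on)

lemma SL_inverse:
  fixes g :: "real ^ 'n ^ 'n"
  assumes "g \<in> SL"
  obtains g' where "g' \<in> SL" "\<And>x. g' *v (g *v x) = x" "\<And>x. g *v (g' *v x) = x"
proof -
  obtain g' where g': "g ** g' = mat 1" "g' ** g = mat 1"
    using invertible_SL[OF assms] by (auto simp: invertible_def)
  have "det g * det g' = 1"
    using g'(1) by (metis det_I det_mul)
  then have "g' \<in> SL" using assms by (simp add: SL_def)
  then show ?thesis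
    by (rule that) (simp_all add: matrix_vector_mul_assoc g')
qed

lemma act_in_density_bounded_measures:
  fixes g :: "real ^ 'n ^ 'n"
  assumes g: "g \<in> SL" and \<nu>: "\<nu> \<in> density_bounded_measures"
  shows "act g \<nu> \<in> density_bounded_measures"
proof -
  have s: "sets \<nu> = sets borel" using \<nu> by (simp add: density_bounded_measures_iff)
  have sp: "space \<nu> = UNIV" using s sets_eq_imp_space_eq by fastforce
  obtain C where C: "0 \<le> C" "\<And>R. R > 0 \<Longrightarrow> emeasure \<nu> (ball 0 R) \<le> ennreal (C * R ^ CARD('n))"
    using \<nu> by (auto simp: density_bounded_measures_iff)
  obtain g' where g': "g' \<in> SL" "\<And>x. g' *v (g *v x) = x"
    using SL_inverse[OF g] by metis
  obtain B where B: "B > 0" "\<And>x. norm (g' *v x) \<le> norm x * B"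
    using bounded_linear.pos_bounded[OF matrix_vector_mul_bounded_linear[of g']] by auto
  have "emeasure (act g \<nu>) (ball 0 R) \<le> ennreal (C * B ^ CARD('n) * R ^ CARD('n))"
    if R: "R > 0" for R
  proof -
    have "emeasure (act g \<nu>) (ball 0 R) = emeasure \<nu> ((*v) g -` ball 0 R)"
      by (simp add: act_def emeasure_distr[OF measurable_mult_vec[OF s]] sp)
    also have "(*v) g -` ball 0 R \<subseteq> ball 0 (R * B)"
    proof
      fix x assume "x \<in> (*v) g -` ball 0 R"
      then have "norm (g *v x) * B < R * B" using B(1) by simp
      then show "x \<in> ball 0 (R * B)"
        using B(2)[of "g *v x"] by (simp add: g'(2))
    qed
    then have "emeasure \<nu> ((*v) g -` ball 0 R) \<le> emeasure \<nu> (ball 0 (R * B))"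
      by (rule emeasure_mono) (simp add: s)
    also have "\<dots> \<le> ennreal (C * B ^ CARD('n) * R ^ CARD('n))"
      using C(2)[of "R * B"] R B(1) by (simp add: power_mult_distrib ac_simps)
    finally show ?thesis .
  qed
  then show ?thesis
    unfolding density_bounded_measures_iff using C(1) B(1)
    by (auto intro!: exI[of _ "C * B ^ CARD('n)"])
qed

lemma measurable_act:
  assumes "g \<in> SL"
  shows "act g \<in> measurable weak_star_borel (weak_star_borel :: (real ^ 'n) measure measure)"
proof (intro continuous_map_imp_measurable_weak_star continuous_map_weak_starI)
  fix f :: "real ^ 'n \<Rightarrow> real" assume f: "f \<in> Cc"
  obtain g' where g': "\<And>x. g' *v (g *v x) = x" "\<And>x. g *v (g' *v x) = x"
    using SL_inverse[OF assms] by metis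
  have cont: "continuous_on UNIV f" and cpt: "compact (closure {x. f x \<noteq> 0})"
    using f by (auto simp: Cc_def)
  let ?K = "(*v) g' ` closure {x. f x \<noteq> 0}"
  have K: "compact ?K"
    by (intro compact_continuous_image cpt matrix_vector_mult_linear_continuous_on)
  have "{x. f (g *v x) \<noteq> 0} \<subseteq> ?K"
  proof
    fix x assume "x \<in> {x. f (g *v x) \<noteq> 0}"
    then have "g *v x \<in> closure {x. f x \<noteq> 0}"
      using closure_subset[of "{x. f x \<noteq> 0}"] by auto
    then show "x \<in> ?K" by (intro image_eqI[of _ _ "g *v x"]) (simp_all add: g')
  qed
  then have "closure {x. f (g *v x) \<noteq> 0} \<subseteq> ?K"
    by (rule closure_minimal) (rule compact_imp_closed[OF K])
  then have "compact (closure {x. f (g *v x) \<noteq> 0})"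
    using K by (metis closed_closure compact_Int_closed inf.absorb_iff2)
  moreover have "continuous_on UNIV (\<lambda>x. f (g *v x))"
    by (intro continuous_on_compose2[OF cont] matrix_vector_mult_linear_continuous_on) auto
  ultimately have h: "(\<lambda>x. f (g *v x)) \<in> Cc" by (simp add: Cc_def)
  show "\<exists>h\<in>Cc. \<exists>k. \<forall>\<nu>\<in>density_bounded_measures. integral\<^sup>L (act g \<nu>) f = integral\<^sup>L \<nu> h + k"
  proof (intro bexI[OF _ h] exI[of _ 0] ballI)
    fix \<nu> :: "(real ^ 'n) measure" assume "\<nu> \<in> density_bounded_measures"
    then show "integral\<^sup>L (act g \<nu>) f = (\<integral>x. f (g *v x) \<partial>\<nu>) + 0"
      unfolding act_def using borel_measurable_continuous_onI[OF cont]
      by (subst integral_distr) (auto simp: density_bounded_measures_iff intro!: measurable_mult_vec)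
  qed
qed (rule act_in_density_bounded_measures[OF assms])

lemma singular_siegel_measure_zero:
  "singular_siegel_measure
     (return weak_star_borel (null_measure (borel :: (real ^ 'n) measure)))"
proof -
  let ?z = "null_measure (borel :: (real ^ 'n) measure)"
  let ?\<mu> = "return weak_star_borel ?z"
  have z: "?z \<in> space weak_star_borel"
    by (auto simp: density_bounded_measures_iff intro!: exI[of _ 0])
  have fixz: "act g ?z = ?z" if "g \<in> SL" for g :: "real ^ 'n ^ 'n"
  proof (rule measure_eqI)
    show "emeasure (act g ?z) A = emeasure ?z A" if "A \<in> sets (act g ?z)" for A
      using that by (simp add: act_def emeasure_distr[OF measurable_mult_vec])
  qed simp
  have "siegel_measure ?\<mu>"
    unfolding siegel_measure_def ergodic_SL_def
    using z fixz prob_space_return[OF z]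
    by (auto simp: distr_return[OF measurable_act] indicator_def)
  moreover have "AE \<nu> in ?\<mu>. mutually_singular \<nu> lborel"
  proof -
    define f where "f n x = max 0 (real n - norm x)" for n and x :: "real ^ 'n"
    have f: "f n \<in> Cc" for n
    proof -
      have "{x. f n x \<noteq> 0} \<subseteq> cball 0 (real n)" by (auto simp: f_def)
      then have "bounded {x. f n x \<noteq> 0}" using bounded_cball bounded_subset by blast
      moreover have "continuous_on UNIV (f n)" unfolding f_def by (intro continuous_intros)
      ultimately show ?thesis by (simp add: Cc_def)
    qed
    have "{\<nu> \<in> space weak_star_borel. integral\<^sup>L \<nu> (f n) \<noteq> 0} \<in> sets weak_star_borel" for n
    proof -
      have "openin weak_star_topology {\<nu> \<in> density_bounded_measures. integral\<^sup>L \<nu> (f n) \<in> - {0}}"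
        unfolding weak_star_topology_def using f[of n]
        by (intro topology_generated_by_Basis) blast
      then show ?thesis by (auto simp: sets_weak_star_borel)
    qed
    then have m: "(\<Union>n. {\<nu> \<in> space weak_star_borel. integral\<^sup>L \<nu> (f n) \<noteq> 0}) \<in> sets weak_star_borel"
      by auto
    have "mutually_singular \<nu> lborel"
      if \<nu>: "\<nu> \<in> density_bounded_measures" "\<And>n. integral\<^sup>L \<nu> (f n) = 0" for \<nu>
    proof -
      have s: "sets \<nu> = sets borel" using \<nu>(1) by (simp add: density_bounded_measures_iff)
      have "AE x in \<nu>. f n x = 0" for n
        using \<nu>(2)[of n] integrable_Cc[OF \<nu>(1) f]
        by (subst (asm) integral_nonneg_eq_0_iff_AE) (auto simp: f_def)
      then have "AE x in \<nu>. \<forall>n. f n x = 0" by (simp add: AE_all_countable)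
      moreover have "\<exists>n. f n x \<noteq> 0" for x
      proof -
        obtain n where "norm x < real n" using reals_Archimedean2 by blast
        then show ?thesis by (intro exI[of _ n]) (simp add: f_def)
      qed
      ultimately have "AE x in \<nu>. False" by auto
      then have "emeasure \<nu> (space \<nu>) = 0" by (simp add: AE_iff_measurable[OF sets.top])
      moreover have "space \<nu> = UNIV" using s sets_eq_imp_space_eq by fastforce
      ultimately show ?thesis
        using s by (auto simp: mutually_singular_def intro!: bexI[of _ UNIV])
    qed
    then show ?thesis
      using m z by (intro AE_I[OF _ _, of _ _
          "\<Union>n. {\<nu> \<in> space weak_star_borel. integral\<^sup>L \<nu> (f n) \<noteq> 0}"]) auto
  qed
  ultimately show ?thesis by (simp add: singular_siegel_measure_def)
qed

end

theory Submission
  imports Defs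
begin

text \<open>
  Every \<open>\<nu>\<close> in the space of density bounded measures splits as a singular part plus a part \<open>f m\<close> with a
  density \<open>f\<close> with respect to Lebesgue measure \<open>m\<close>. The theorem says that, for almost every \<open>\<nu>\<close>, this density is
  almost everywhere equal to one and the same constant \<open>c\<close>; removing \<open>c m\<close> from \<open>\<nu>\<close> then transports \<open>\<mu>\<close> to a singular
  Siegel measure. Since \<open>f\<close> may be unbounded, it is replaced by \<open>min f t\<close>, the density of the
  lattice minimum of \<open>\<nu>\<close> and \<open>t m\<close>. The mass that this minimum gives to a set \<open>E\<close> is an infimum of simple expressions
  (definition \<open>meet_lebesgue\<close>), which makes it measurable in \<open>\<nu>\<close> and equivariant under determinant one matrices without
  any choice of a density.

  The heart is a rigidity statement about random measures \<open>\<rho>\<close> with \<open>\<rho> \<le> t m\<close> (theorem \<open>AE_scale_lborel\<close> in the locale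
  \<open>moment_invariant\<close>): if the second moments of the masses \<open>\<rho>(E)\<close> are invariant under \<open>SL\<close>, then \<open>\<rho>\<close> is almost surely
  a multiple of \<open>m\<close>. It is a form of the Mautner phenomenon. Fix two coordinates \<open>i, j\<close>, and let \<open>T\<close> be the half of
  the unit cube where \<open>x\<^sub>i < x\<^sub>j\<close>. For an invertible \<open>M\<close> let \<open>Y(M)\<close> be \<open>\<rho>(M T)\<close> divided by \<open>\<bar>det M\<bar>\<close>.
  The set \<open>T\<close> is cut by the hyperplane \<open>x\<^sub>i = x\<^sub>j / 2\<close> into two linear images of itself,
  so \<open>Y(M)\<close> is the mean of \<open>Y(M a)\<close> and \<open>Y(M b)\<close> with \<open>det a = det b = 1/2\<close>. The second moment of \<open>Y(M)\<close> depends only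
  on \<open>det M\<close>, hence by the parallelogram identity it grows when \<open>det M\<close> is halved, and the increment bounds the distance
  of \<open>Y(M)\<close> and \<open>Y(M a)\<close>. Being bounded, the second moments converge along \<open>det M = A 2\<^sup>-\<^sup>k\<close>, so \<open>Y(M)\<close> and \<open>Y(M a)\<close>
  are asymptotically equal as \<open>det M\<close> tends to \<open>0\<close>.

  The matrices \<open>B\<close> for which \<open>Y(M)\<close> and \<open>Y(M B)\<close> are asymptotically equal are closed under products. Conjugation by powers of
  \<open>a\<close>, or of its inverse, contracts the elementary shears in the \<open>(i, j)\<close> plane to the identity, while shears close to
  the identity hardly move \<open>T\<close>; therefore all these shears are among the matrices \<open>B\<close>, and so is a homothety \<open>\<kappa>\<close>
  of that plane of determinant \<open>1/2\<close>. Because \<open>\<kappa>\<close> commutes with \<open>a\<close> and \<open>b\<close>, the distance of \<open>Y(M)\<close> and \<open>Y(M \<kappa>)\<close> is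
  at most the mean of two distances of the same kind at half the determinant, and so it vanishes.
  Contracting with \<open>\<kappa>\<close> turns asymptotic equality into equality: almost surely \<open>Y(M) = Y(M B)\<close> for every shear \<open>B\<close>
  (lemma \<open>mean_density_shear\<close>). Since shears and stretches of \<open>T\<close> assemble the boxes with a vertex at the origin,
  the mass of such a box is proportional to its volume, and these boxes determine \<open>\<rho>\<close>.

  Applied to \<open>t = 1, 2, \<dots>\<close>, rigidity shows that almost every \<open>\<nu>\<close> has a constant absolutely continuous part.
  The sets of \<open>\<nu>\<close> for which this constant is at most \<open>q\<close> are measurable and invariant, and ergodicity makes
  the constant the same for almost every \<open>\<nu>\<close> (lemma \<open>siegel_constant_part\<close>).
\<close>

section \<open>Shears, stretches and the two halves of the unit cube\<close>

definition shear :: "'n::finite \<Rightarrow> 'n \<Rightarrow> real \<Rightarrow> real ^ 'n ^ 'n" where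
  "shear i j s = (\<chi> k l. if k = l then 1 else if k = i \<and> l = j then s else 0)"

definition stretch :: "'n::finite \<Rightarrow> real \<Rightarrow> real ^ 'n ^ 'n" where
  "stretch i s = (\<chi> k l. if k = l then (if k = i then s else 1) else 0)"

definition unit_cube :: "(real ^ 'n) set" where
  "unit_cube = {x. \<forall>k. 0 \<le> x $ k \<and> x $ k < 1}"

definition half_cube :: "'n \<Rightarrow> 'n \<Rightarrow> (real ^ 'n) set" where
  "half_cube i j = {x \<in> unit_cube. x $ i < x $ j}"

lemma shear_vec:
  assumes "i \<noteq> j"
  shows "(shear i j s *v x) $ k = x $ k + (if k = i then s * x $ j else 0)"
proof -
  have "(shear i j s *v x) $ k =
      (\<Sum>l\<in>UNIV. (if l = k then x $ l else 0) + (if l = j then (if k = i then s * x $ l else 0) else 0))"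
    unfolding shear_def matrix_vector_mult_def vec_lambda_beta
    by (rule sum.cong) (use assms in auto)
  then show ?thesis
    by (simp add: sum.distrib)
qed

lemma stretch_vec: "(stretch i s *v x) $ k = (if k = i then s else 1) * x $ k"
proof -
  have "(stretch i s *v x) $ k = (\<Sum>l\<in>UNIV. (if l = k then (if k = i then s else 1) * x $ l else 0))"
    unfolding stretch_def matrix_vector_mult_def vec_lambda_beta
    by (rule sum.cong) auto
  then show ?thesis by simp
qed

lemma det_shear:
  fixes i j :: "'n::finite"
  shows "i \<noteq> j \<Longrightarrow> det (shear i j s) = 1"
proof -
  assume ij: "i \<noteq> j"
  have "shear i j s = (\<chi> k. if k = i then row i (mat 1) + s *s row j (mat 1) else row k (mat 1))"
    using ij by (auto simp: shear_def vec_eq_iff row_def mat_def)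
  then show ?thesis
    using det_row_operation[OF ij, of "mat 1 :: real^'n^'n" s] by simp
qed

lemma det_stretch: "det (stretch i s) = s"
proof -
  have "det (stretch i s) = (\<Prod>k\<in>UNIV. if k = i then s else 1)"
    by (subst det_diagonal) (auto simp: stretch_def intro!: prod.cong)
  then show ?thesis by simp
qed

lemma matrix_eqI: "(\<And>x k. (A *v x) $ k = (B *v x) $ k) \<Longrightarrow> A = (B :: real ^ 'n ^ 'm)"
  by (simp add: matrix_eq vec_eq_iff)

lemma stretch_1: "stretch i 1 = mat 1"
  by (rule matrix_eqI) (simp add: stretch_vec)

lemma stretch_mult: "stretch i s ** stretch i t = stretch i (s * t)"
  by (rule matrix_eqI) (simp add: stretch_vec matrix_vector_mul_assoc[symmetric])

lemma stretch_shear_upper: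
  "i \<noteq> j \<Longrightarrow> stretch i p ** shear i j s = shear i j (p * s) ** stretch i p"
  by (rule matrix_eqI) (simp add: stretch_vec shear_vec matrix_vector_mul_assoc[symmetric] algebra_simps)

lemma stretch_shear_lower:
  "i \<noteq> j \<Longrightarrow> shear j i s ** stretch i p = stretch i p ** shear j i (s * p)"
  by (rule matrix_eqI) (simp add: stretch_vec shear_vec matrix_vector_mul_assoc[symmetric] algebra_simps)

text \<open>
  The classical factorisation in \<open>SL(2)\<close>: three shears give the matrix with rows \<open>(0, p)\<close> and \<open>(-1/p, 0)\<close>, and two
  matrices of this form multiply to the diagonal matrix with entries \<open>p\<close> and \<open>1/p\<close>.
\<close>

lemma torus_eq_shears:
  assumes "i \<noteq> j" "p \<noteq> 0"
  shows "stretch i p ** stretch j (1 / p) =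
    shear i j p ** shear j i (- 1 / p) ** shear i j p ** shear i j (- 1) ** shear j i 1 ** shear i j (- 1)"
  using assms
  by (intro matrix_eqI) (simp add: stretch_vec shear_vec matrix_vector_mul_assoc[symmetric] field_simps)

lemma matrix_image_eq:
  assumes "\<And>x. g *v (h *v x) = x" "\<And>x. h *v (g *v x) = x"
  shows "(*v) g ` S = {x. h *v x \<in> S}"
  using assms by (auto simp: image_iff) metis

lemma image_mult: "(*v) (A ** B) ` S = (*v) A ` (*v) B ` (S :: (real^'n) set)"
  by (simp add: image_image matrix_vector_mul_assoc)

lemma shear_image:
  assumes "i \<noteq> j"
  shows "(*v) (shear i j s) ` S = {x. shear i j (- s) *v x \<in> S}"
  by (rule matrix_image_eq) (use assms in \<open>simp_all add: vec_eq_iff shear_vec\<close>)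

lemma stretch_image:
  assumes "s \<noteq> 0"
  shows "(*v) (stretch i s) ` S = {x. stretch i (1 / s) *v x \<in> S}"
  by (rule matrix_image_eq) (simp_all add: vec_eq_iff stretch_vec assms)

lemma half_cube_iff:
  assumes "i \<noteq> j"
  shows "x \<in> half_cube i j \<longleftrightarrow> 0 \<le> x $ i \<and> x $ i < x $ j \<and> (\<forall>k. k \<noteq> i \<longrightarrow> 0 \<le> x $ k \<and> x $ k < 1)"
  unfolding half_cube_def unit_cube_def mem_Collect_eq using assms by (metis less_trans)

text \<open>
  The self-similarity that drives the whole argument: in the \<open>(i, j)\<close> plane the half cube is a triangle with
  one vertex at the origin, and the ray \<open>x\<^sub>i = p x\<^sub>j\<close> cuts the stretched triangle into two linear images of the
  original one. The strict and weak inequalities in the definition of the half cube make the union disjoint.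
\<close>

lemma half_cube_split:
  fixes i j :: "'n::finite"
  assumes ij: "i \<noteq> j" and pq: "0 < p" "0 < q"
  defines "A \<equiv> (*v) (stretch i p) ` half_cube i j"
    and "B \<equiv> (*v) (shear i j p ** stretch i q) ` half_cube i j"
  shows "(*v) (stretch i (p + q)) ` half_cube i j = A \<union> B" "A \<inter> B = {}"
proof -
  have s: "(*v) (stretch i p) ` half_cube i j =
      {x. 0 \<le> x $ i \<and> x $ i < p * x $ j \<and> (\<forall>k. k \<noteq> i \<longrightarrow> 0 \<le> x $ k \<and> x $ k < 1)}"
    if "0 < p" for p
    using that ij by (auto simp: stretch_image half_cube_iff stretch_vec field_simps zero_le_divide_iff)
  have B: "B = {x. p * x $ j \<le> x $ i \<and> x $ i < (p + q) * x $ j \<and> (\<forall>k. k \<noteq> i \<longrightarrow> 0 \<le> x $ k \<and> x $ k < 1)}"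
    unfolding B_def image_mult s[OF pq(2)] using ij
    by (auto simp: shear_image shear_vec algebra_simps)
  have A: "A = {x. 0 \<le> x $ i \<and> x $ i < p * x $ j \<and> (\<forall>k. k \<noteq> i \<longrightarrow> 0 \<le> x $ k \<and> x $ k < 1)}"
    unfolding A_def s[OF pq(1)] ..
  have *: "0 \<le> p * y" "p * y \<le> (p + q) * y" if "0 \<le> y" for y :: real
    using pq that by (auto intro!: mult_right_mono)
  show "A \<inter> B = {}"
    unfolding A B by auto
  have eq: "(0 \<le> x $ i \<and> x $ i < (p + q) * x $ j) \<longleftrightarrow>
      (0 \<le> x $ i \<and> x $ i < p * x $ j) \<or> (p * x $ j \<le> x $ i \<and> x $ i < (p + q) * x $ j)"
    if "0 \<le> x $ j" for x :: "real ^ 'n"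
    using * [OF that] by linarith
  show "(*v) (stretch i (p + q)) ` half_cube i j = A \<union> B"
    unfolding s[OF add_pos_pos[OF pq]] A B
  proof (intro set_eqI)
    fix x :: "real ^ 'n"
    show "x \<in> {x. 0 \<le> x $ i \<and> x $ i < (p + q) * x $ j \<and> (\<forall>k. k \<noteq> i \<longrightarrow> 0 \<le> x $ k \<and> x $ k < 1)} \<longleftrightarrow>
      x \<in> {x. 0 \<le> x $ i \<and> x $ i < p * x $ j \<and> (\<forall>k. k \<noteq> i \<longrightarrow> 0 \<le> x $ k \<and> x $ k < 1)} \<union>
        {x. p * x $ j \<le> x $ i \<and> x $ i < (p + q) * x $ j \<and> (\<forall>k. k \<noteq> i \<longrightarrow> 0 \<le> x $ k \<and> x $ k < 1)}"
      using eq[of x] ij by (cases "0 \<le> x $ j") auto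
  qed
qed

text \<open>
  Both triangles into which the diagonal cuts the unit square have a vertex at the origin, so the second is an image of
  the first under a matrix of determinant one. Their boundaries match up to the hyperplane \<open>x\<^sub>j = 0\<close>.
\<close>

lemma unit_cube_split:
  fixes i j :: "'n::finite"
  assumes ij: "i \<noteq> j"
  defines "B \<equiv> (*v) (shear i j 1 ** shear j i (- 1)) ` half_cube i j"
  shows "unit_cube - {x. x $ j = 0} = half_cube i j \<union> B" "half_cube i j \<inter> B = {}"
proof -
  have B: "B = {x. 0 < x $ j \<and> x $ j \<le> x $ i \<and> (\<forall>k. k \<noteq> j \<longrightarrow> 0 \<le> x $ k \<and> x $ k < 1)}"
    (is "_ = ?B")
  proof (intro set_eqI)
    fix x :: "real ^ 'n"
    let ?y = "shear j i 1 *v (shear i j (- 1) *v x)"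
    have y: "?y $ i = x $ i - x $ j" "?y $ j = x $ i" "\<And>k. k \<noteq> i \<Longrightarrow> k \<noteq> j \<Longrightarrow> ?y $ k = x $ k"
      using ij by (auto simp: shear_vec)
    have "x \<in> B \<longleftrightarrow> ?y \<in> half_cube i j"
      unfolding B_def image_mult using ij by (simp add: shear_image)
    also have "\<dots> \<longleftrightarrow> 0 \<le> x $ i - x $ j \<and> x $ i - x $ j < x $ i \<and> (0 \<le> x $ i \<and> x $ i < 1) \<and>
        (\<forall>k. k \<noteq> i \<and> k \<noteq> j \<longrightarrow> 0 \<le> x $ k \<and> x $ k < 1)"
      unfolding half_cube_iff[OF ij] using ij y by metis
    also have "\<dots> \<longleftrightarrow> x \<in> ?B"
      using ij by auto
    finally show "x \<in> B \<longleftrightarrow> x \<in> ?B" .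
  qed
  show "half_cube i j \<inter> B = {}" using ij by (auto simp: B half_cube_iff)
  show "unit_cube - {x. x $ j = 0} = half_cube i j \<union> B"
  proof (intro set_eqI)
    fix x :: "real ^ 'n"
    have "x \<in> unit_cube \<longleftrightarrow> (0 \<le> x $ i \<and> x $ i < 1) \<and> (0 \<le> x $ j \<and> x $ j < 1) \<and>
        (\<forall>k. k \<noteq> i \<and> k \<noteq> j \<longrightarrow> 0 \<le> x $ k \<and> x $ k < 1)" (is "_ \<longleftrightarrow> _ \<and> _ \<and> ?R")
      unfolding unit_cube_def mem_Collect_eq by metis
    moreover have "x \<in> half_cube i j \<longleftrightarrow> 0 \<le> x $ i \<and> x $ i < x $ j \<and> x $ j < 1 \<and> ?R"
      unfolding half_cube_iff[OF ij] using ij by (metis less_imp_le order_le_less_trans)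
    moreover have "x \<in> B \<longleftrightarrow> 0 < x $ j \<and> x $ j \<le> x $ i \<and> x $ i < 1 \<and> ?R"
      unfolding B mem_Collect_eq using ij by (metis less_imp_le order_less_le_trans)
    ultimately show "x \<in> unit_cube - {x. x $ j = 0} \<longleftrightarrow> x \<in> half_cube i j \<union> B"
      by auto
  qed
qed

lemma null_coordinate: "{x :: real ^ 'n. x $ k = c} \<in> null_sets lborel"
  using negligible_standard_hyperplane[of "axis k 1 :: real ^ 'n" c]
  by (simp add: negligible_iff_null_sets null_sets_completion_iff inner_axis axis_in_Basis_iff)

text \<open>
  Reflecting the triangle in the \<open>x\<^sub>j\<close> axis gives the same triangle as a shear, up to two edges. This reduces a
  matrix of determinant \<open>-1\<close> to one of determinant \<open>1\<close>.
\<close>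

lemma half_cube_reflect:
  fixes i j :: "'n::finite"
  assumes ij: "i \<noteq> j"
  shows "sym_diff ((*v) (stretch i (- 1)) ` half_cube i j) ((*v) (shear i j (- 1)) ` half_cube i j)
    \<subseteq> {x. x $ i = 0} \<union> (*v) (shear i j (- 1)) ` {x. x $ i = 0}"
proof -
  have 1: "(*v) (stretch i (- 1)) ` half_cube i j =
      {x. x $ i \<le> 0 \<and> - x $ j < x $ i \<and> (\<forall>k. k \<noteq> i \<longrightarrow> 0 \<le> x $ k \<and> x $ k < 1)}"
    using ij by (auto simp: stretch_image stretch_vec half_cube_iff)
  have 2: "(*v) (shear i j (- 1)) ` half_cube i j =
      {x. - x $ j \<le> x $ i \<and> x $ i < 0 \<and> (\<forall>k. k \<noteq> i \<longrightarrow> 0 \<le> x $ k \<and> x $ k < 1)}"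
    using ij by (auto simp: shear_image shear_vec half_cube_iff)
  have 3: "(*v) (shear i j (- 1)) ` {x. x $ i = 0} = {x. x $ i + x $ j = 0}"
    using ij by (auto simp: shear_image shear_vec)
  show ?thesis unfolding 1 2 3 by auto
qed

lemma measurable_mult_vec_borel [measurable]: "(*v) (M :: real ^ 'n ^ 'm) \<in> borel \<rightarrow>\<^sub>M borel"
  by (intro borel_measurable_continuous_onI matrix_vector_mult_linear_continuous_on)

lemma det_inverse_obtain:
  fixes M :: "real ^ 'n ^ 'n"
  assumes "det M \<noteq> 0"
  obtains M' where "M ** M' = mat 1" "M' ** M = mat 1" "det M * det M' = 1"
    "\<And>S. (*v) M ` S = {x. M' *v x \<in> S}"
proof -
  obtain M' where M': "M ** M' = mat 1" "M' ** M = mat 1"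
    using assms by (metis invertible_def invertible_det_nz)
  moreover have "det M * det M' = 1"
    using M'(1) by (metis det_I det_mul)
  moreover have "(*v) M ` S = {x. M' *v x \<in> S}" for S
    by (rule matrix_image_eq) (simp_all add: matrix_vector_mul_assoc M')
  ultimately show ?thesis using that by blast
qed

lemma borel_matrix_image [measurable]:
  fixes M :: "real ^ 'n ^ 'n"
  assumes "det M \<noteq> 0" "S \<in> sets borel"
  shows "(*v) M ` S \<in> sets borel"
proof -
  obtain M' where "(*v) M ` S = {x. M' *v x \<in> S}"
    using det_inverse_obtain[OF assms(1)] by metis
  also have "\<dots> = (*v) M' -` S \<inter> space borel" by auto
  also have "\<dots> \<in> sets borel"
    using assms(2) by (rule measurable_sets[OF measurable_mult_vec_borel])
  finally show ?thesis .
qed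

lemma bounded_matrix_image: "bounded S \<Longrightarrow> bounded ((*v) (M :: real ^ 'n ^ 'm) ` S)"
  by (intro bounded_linear_image matrix_vector_mul_bounded_linear)

section \<open>Linear images and Lebesgue measure\<close>

text \<open>
  It suffices to treat boxes, and a box can be translated so that its lower corner is the origin.
\<close>

lemma measure_shear_image:
  fixes i j :: "'n::finite"
  assumes ij: "i \<noteq> j" and S: "S \<in> lmeasurable"
  shows "(*v) (shear i j 1) ` S \<in> lmeasurable \<and> measure lebesgue ((*v) (shear i j 1) ` S) = 1 * measure lebesgue S"
proof -
  let ?h = "(*v) (shear i j (1::real))"
  have "measure lebesgue (?h ` cbox a b) = 1 * measure lebesgue (cbox a b)" for a b
  proof (cases "cbox a b = {}")
    case False
    have h: "?h = (\<lambda>x. \<chi> k. if k = i then x $ i + x $ j else x $ k)"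
      using ij by (auto simp: fun_eq_iff vec_eq_iff shear_vec)
    have c: "cbox a b = (+) a ` cbox 0 (b - a)"
      by (simp add: cbox_translation[symmetric])
    then have ne: "cbox 0 (b - a) \<noteq> {}"
      using False by auto
    have "?h ` cbox a b = (+) (?h a) ` ?h ` cbox 0 (b - a)"
      unfolding c by (simp add: image_image matrix_vector_right_distrib)
    then have "measure lebesgue (?h ` cbox a b) = measure lebesgue (?h ` cbox 0 (b - a))"
      by (simp only: measure_translation)
    also have "\<dots> = measure lebesgue (cbox 0 (b - a))"
      unfolding h by (rule measure_shear_interval[OF ij ne]) simp
    finally show ?thesis
      by (simp only: c measure_translation mult_1)
  qed simp
  then show ?thesis
    using measure_linear_sufficient[of ?h S 1] S by simp
qed

lemma measure_stretch_image:
  fixes A :: "real ^ 'n ^ 'n"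
  assumes A: "\<And>i j. i \<noteq> j \<Longrightarrow> A $ i $ j = 0" and S: "S \<in> lmeasurable"
  shows "(*v) A ` S \<in> lmeasurable \<and> measure lebesgue ((*v) A ` S) = \<bar>det A\<bar> * measure lebesgue S"
proof -
  have "(A *v x) $ k = A $ k $ k * x $ k" for x k
  proof -
    have "(A *v x) $ k = (\<Sum>l\<in>UNIV. if l = k then A $ k $ k * x $ k else 0)"
      unfolding matrix_vector_mult_def vec_lambda_beta by (rule sum.cong) (auto simp: A)
    then show ?thesis by simp
  qed
  then have "(*v) A = (\<lambda>x. \<chi> k. A $ k $ k * x $ k)"
    by (auto simp: fun_eq_iff vec_eq_iff)
  then show ?thesis
    using measurable_stretch[OF S, of "\<lambda>k. A $ k $ k"] measure_stretch[OF S, of "\<lambda>k. A $ k $ k"]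
    by (simp add: det_diagonal A)
qed

text \<open>
  By induction over elementary matrices, where a transposition is written as a product of shears and a reflection.
\<close>

lemma measure_matrix_image_lmeasurable:
  fixes A :: "real ^ 'n ^ 'n"
  assumes "det A \<noteq> 0"
  shows "\<forall>S\<in>lmeasurable. (*v) A ` S \<in> lmeasurable \<and> measure lebesgue ((*v) A ` S) = \<bar>det A\<bar> * measure lebesgue S"
    (is "?P A")
proof -
  have mult: "?P (A ** B)" if "?P A" "?P B" for A B :: "real ^ 'n ^ 'n"
    using that by (simp add: image_mult det_mul abs_mult)
  have str: "?P (stretch i s)" for i :: 'n and s
    by (intro ballI measure_stretch_image) (auto simp: stretch_def)
  have sh: "?P (shear i j 1)" if "i \<noteq> j" for i j :: 'n
    using measure_shear_image[OF that] det_shear[OF that] by simp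
  have shm: "?P (shear i j (- 1))" if ij: "i \<noteq> j" for i j :: 'n
  proof -
    have "shear i j (- 1) = stretch i (- 1) ** shear i j 1 ** stretch i (- 1)"
      using ij by (intro matrix_eqI) (simp add: stretch_vec shear_vec matrix_vector_mul_assoc[symmetric])
    moreover have "?P \<dots>" by (intro mult str sh[OF ij])
    ultimately show ?thesis by simp
  qed
  have "det A \<noteq> 0 \<longrightarrow> ?P A"
  proof (induction A rule: induct_matrix_elementary_alt)
    case (1 A B)
    then show ?case using mult[of A B] by (simp add: det_mul)
  next
    case (2 A i)
    then show ?case using det_zero_row(1)[of i A] by simp
  next
    case (3 A)
    then show ?case using measure_stretch_image[of A] by simp
  next
    case (4 m n)
    have "(\<chi> i j. mat 1 $ i $ Transposition.transpose m n j) =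
        stretch n (- 1) ** shear m n 1 ** shear n m (- 1) ** shear m n (1::real)" (is "?L = ?R")
    proof (rule matrix_eqI)
      fix x :: "real ^ 'n" and k
      have "(?L *v x) $ k = (\<Sum>l\<in>UNIV. if l = Transposition.transpose m n k then x $ l else 0)"
        unfolding matrix_vector_mult_def vec_lambda_beta mat_def
        by (rule sum.cong) (auto simp: transpose_eq_iff)
      then show "(?L *v x) $ k = (?R *v x) $ k"
        using 4 by (auto simp: stretch_vec shear_vec matrix_vector_mul_assoc[symmetric] transpose_def)
    qed
    moreover have "?P \<dots>" using 4 by (intro mult str sh shm) auto
    ultimately show ?case by simp
  next
    case (5 m n)
    have "(\<chi> i j. of_bool (i = m \<and> j = n \<or> i = j)) = shear m n (1::real)"
      using 5 by (auto simp: shear_def vec_eq_iff)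
    then show ?case using sh[OF 5] by simp
  qed
  then show ?thesis using assms by blast
qed

lemma measure_matrix_image:
  fixes M :: "real ^ 'n ^ 'n"
  assumes "det M \<noteq> 0" "S \<in> sets borel" "bounded S"
  shows "measure lborel ((*v) M ` S) = \<bar>det M\<bar> * measure lborel S"
proof -
  have "S \<in> lmeasurable"
    using assms by (simp add: bounded_set_imp_lmeasurable)
  then have "measure lebesgue ((*v) M ` S) = \<bar>det M\<bar> * measure lebesgue S"
    using measure_matrix_image_lmeasurable[OF assms(1)] by blast
  moreover have "measure lebesgue ((*v) M ` S) = measure lborel ((*v) M ` S)"
    using borel_matrix_image[OF assms(1,2)] by (intro measure_completion) simp
  moreover have "measure lebesgue S = measure lborel S"
    using assms(2) by (intro measure_completion) simp
  ultimately show ?thesis by simp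
qed
lemma unit_cube_borel [measurable]: "unit_cube \<in> sets borel"
  unfolding unit_cube_def by measurable

lemma half_cube_borel [measurable]: "half_cube i j \<in> sets borel"
  unfolding half_cube_def by measurable

lemma bounded_unit_cube: "bounded unit_cube"
proof (rule bounded_subset)
  show "bounded (cbox (0 :: real ^ 'n) 1)" by simp
  show "unit_cube \<subseteq> cbox (0 :: real ^ 'n) 1" by (auto simp: unit_cube_def mem_box_cart less_imp_le)
qed

lemma bounded_half_cube: "bounded (half_cube i j)"
  using bounded_unit_cube by (rule bounded_subset) (auto simp: half_cube_def)

lemma convex_half_cube: "convex (half_cube i j)"
proof -
  have "half_cube i j = (\<Inter>k. {x. axis k 1 \<bullet> x \<ge> 0} \<inter> {x. axis k 1 \<bullet> x < 1}) \<inter> {x. (axis i 1 - axis j 1) \<bullet> x < 0}"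
    by (auto simp: half_cube_def unit_cube_def inner_axis' inner_diff_left)
  then show ?thesis
    by (auto intro!: convex_Int convex_INT convex_halfspace_ge convex_halfspace_lt)
qed

lemma shear_vec_eq: "i \<noteq> j \<Longrightarrow> shear i j s *v x = x + (s * x $ j) *\<^sub>R axis i 1"
  by (auto simp: vec_eq_iff shear_vec axis_def)

text \<open>
  The frontier of a convex set is a null set, and off the frontier membership in the set is not affected by a
  sufficiently small shear; dominated convergence gives the claim.
\<close>

lemma sym_diff_shear_tendsto:
  fixes S :: "(real ^ 'n) set"
  assumes ij: "i \<noteq> j" and S: "convex S" "bounded S" "S \<in> sets borel"
    and s: "s \<longlonglongrightarrow> 0" "\<And>n. \<bar>s n\<bar> \<le> 1"
  shows "(\<lambda>n. measure lborel (sym_diff S ((*v) (shear i j (s n)) ` S))) \<longlonglongrightarrow> 0"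
proof -
  let ?D = "\<lambda>n. sym_diff S ((*v) (shear i j (s n)) ` S)"
  obtain r where r: "S \<subseteq> ball 0 r"
    using bounded_subset_ballD[OF S(2), of 0] by auto
  have D: "?D n \<in> sets borel" for n
    using S(3) det_shear[OF ij] by (intro sets.Un sets.Diff borel_matrix_image) auto
  have sub: "?D n \<subseteq> ball 0 (2 * r)" for n
  proof -
    have "norm (shear i j (s n) *v x) < 2 * r" if "x \<in> S" for x
    proof -
      have "norm (shear i j (s n) *v x) \<le> norm x + norm ((s n * x $ j) *\<^sub>R axis i 1 :: real ^ 'n)"
        unfolding shear_vec_eq[OF ij] by (rule norm_triangle_ineq)
      also have "\<dots> \<le> norm x + 1 * norm x"
        using mult_mono[OF s(2)[of n] component_le_norm_cart[of x j]]
        by (simp add: abs_mult)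
      also have "\<dots> < 2 * r" using r that by auto
      finally show ?thesis .
    qed
    moreover have "norm x < 2 * r" if "x \<in> S" for x
      using r that by (smt (verit) mem_ball_0 norm_ge_zero subsetD)
    ultimately show ?thesis by auto
  qed
  have "(\<lambda>n. \<integral>x. indicat_real (?D n) x \<partial>lborel) \<longlonglongrightarrow> (\<integral>x. 0 \<partial>(lborel :: (real ^ 'n) measure))"
  proof (rule integral_dominated_convergence)
    show "integrable lborel (indicat_real (ball (0 :: real ^ 'n) (2 * r)))"
      by (rule integrable_real_indicator) (use emeasure_bounded_finite[OF bounded_ball] in auto)
    show "AE x in lborel. norm (indicat_real (?D n) x) \<le> indicat_real (ball 0 (2 * r)) x" for n
      using sub[of n] by (intro AE_I2) (auto simp: indicator_def)
    have "frontier S \<in> null_sets lborel"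
      using negligible_convex_frontier[OF S(1)]
      by (simp add: negligible_iff_null_sets null_sets_completion_iff)
    then have "AE x in lborel. x \<notin> frontier S" by (rule AE_not_in)
    then show "AE x in lborel. (\<lambda>n. indicat_real (?D n) x) \<longlonglongrightarrow> 0"
    proof eventually_elim
      fix x assume x: "x \<notin> frontier S"
      have img: "(*v) (shear i j (s n)) ` S = {x. shear i j (- s n) *v x \<in> S}" for n
        by (rule shear_image[OF ij])
      have lim: "(\<lambda>n. shear i j (- s n) *v x) \<longlonglongrightarrow> x"
        unfolding shear_vec_eq[OF ij] using s(1) by (auto intro!: tendsto_eq_intros)
      have "eventually (\<lambda>n. x \<notin> ?D n) sequentially"
      proof (cases "x \<in> S")
        case True
        then have "x \<in> interior S"
          using x closure_subset by (auto simp: frontier_def)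
        then have "eventually (\<lambda>n. shear i j (- s n) *v x \<in> interior S) sequentially"
          using lim open_interior topological_tendstoD by blast
        then show ?thesis
          by eventually_elim (use True interior_subset in \<open>auto simp: img\<close>)
      next
        case False
        then have "x \<in> - closure S"
          using x interior_subset by (auto simp: frontier_def)
        then have "eventually (\<lambda>n. shear i j (- s n) *v x \<in> - closure S) sequentially"
          using lim topological_tendstoD by blast
        then show ?thesis
          by eventually_elim (use False closure_subset in \<open>auto simp: img\<close>)
      qed
      then show "(\<lambda>n. indicat_real (?D n) x) \<longlonglongrightarrow> 0"
        by (intro tendsto_eventually) (auto elim!: eventually_mono simp: indicator_def)
    qed
  qed (use D in auto)
  then show ?thesis using D by simp
qed

section \<open>Averages of a random measure over linear images of the half cube\<close>

text \<open>
  Random measures \<open>\<rho>\<close> dominated by \<open>t\<close> times Lebesgue measure. Invariance enters the argument only through the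
  second moments of the masses of bounded sets, which is therefore
  what is assumed, rather than an action of matrices on the probability space.
\<close>

locale moment_invariant = prob_space P for P :: "'w measure" +
  fixes \<rho> :: "'w \<Rightarrow> (real ^ 'n) measure" and t :: real
  assumes t_nonneg: "0 \<le> t"
    and sets_\<rho>: "w \<in> space P \<Longrightarrow> sets (\<rho> w) = sets borel"
    and \<rho>_le: "w \<in> space P \<Longrightarrow> E \<in> sets borel \<Longrightarrow> emeasure (\<rho> w) E \<le> ennreal t * emeasure lborel E"
    and \<rho>_measurable: "E \<in> sets borel \<Longrightarrow> bounded E \<Longrightarrow> (\<lambda>w. measure (\<rho> w) E) \<in> borel_measurable P"
    and moment: "det g = 1 \<Longrightarrow> E \<in> sets borel \<Longrightarrow> bounded E \<Longrightarrow>
      (\<integral>w. (measure (\<rho> w) ((*v) g ` E))\<^sup>2 \<partial>P) = (\<integral>w. (measure (\<rho> w) E)\<^sup>2 \<partial>P)"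
begin

lemma \<rho>_finite:
  assumes "w \<in> space P" "E \<in> sets borel" "bounded E"
  shows "emeasure (\<rho> w) E < \<infinity>"
proof -
  have "emeasure (\<rho> w) E \<le> ennreal t * emeasure lborel E"
    by (rule \<rho>_le[OF assms(1,2)])
  also have "\<dots> < \<infinity>"
    using emeasure_bounded_finite[OF assms(3)] by (simp add: ennreal_mult_less_top)
  finally show ?thesis .
qed

lemma \<rho>_measure_le:
  assumes "w \<in> space P" "E \<in> sets borel" "bounded E"
  shows "measure (\<rho> w) E \<le> t * measure lborel E"
proof -
  have "ennreal (measure (\<rho> w) E) \<le> ennreal t * ennreal (measure lborel E)"
    using \<rho>_le[OF assms(1,2)] \<rho>_finite[OF assms] emeasure_bounded_finite[OF assms(3)]
    by (simp add: emeasure_eq_ennreal_measure less_top)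
  then show ?thesis
    using t_nonneg by (simp add: ennreal_mult''[symmetric])
qed

lemma \<rho>_add:
  assumes "w \<in> space P" "A \<in> sets borel" "B \<in> sets borel" "bounded A" "bounded B" "A \<inter> B = {}"
  shows "measure (\<rho> w) (A \<union> B) = measure (\<rho> w) A + measure (\<rho> w) B"
  using assms \<rho>_finite[of w A] \<rho>_finite[of w B]
  by (intro measure_Union) (auto simp: sets_\<rho>)

lemma \<rho>_diff_le:
  assumes "w \<in> space P" "A \<in> sets borel" "B \<in> sets borel" "bounded A" "bounded B"
  shows "\<bar>measure (\<rho> w) A - measure (\<rho> w) B\<bar> \<le> t * measure lborel (sym_diff A B)"
proof -
  have *: "measure (\<rho> w) A \<le> measure (\<rho> w) B + measure (\<rho> w) (sym_diff A B)"
    if "A \<in> sets borel" "B \<in> sets borel" "bounded A" "bounded B" for A B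
  proof -
    have b: "bounded (sym_diff A B)" "bounded (B \<union> sym_diff A B)"
      using that by (auto intro: bounded_subset)
    have "measure (\<rho> w) A \<le> measure (\<rho> w) (B \<union> sym_diff A B)"
      using that b assms(1) by (intro measure_mono_fmeasurable) (auto simp: sets_\<rho> intro!: fmeasurableI \<rho>_finite)
    also have "\<dots> \<le> measure (\<rho> w) B + measure (\<rho> w) (sym_diff A B)"
      using that assms(1) by (intro measure_Un_le) (auto simp: sets_\<rho>)
    finally show ?thesis .
  qed
  have "sym_diff A B = sym_diff B A" by auto
  moreover have "measure (\<rho> w) (sym_diff A B) \<le> t * measure lborel (sym_diff A B)"
    using assms by (intro \<rho>_measure_le) (auto intro: bounded_subset)
  ultimately show ?thesis
    using *[of A B] *[of B A] assms by auto
qed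

lemma \<rho>_eq_mod_null:
  assumes "w \<in> space P" "A \<in> sets borel" "B \<in> sets borel" "bounded A" "bounded B"
    and "sym_diff A B \<subseteq> N" "N \<in> null_sets lborel"
  shows "measure (\<rho> w) A = measure (\<rho> w) B"
proof -
  have "sym_diff A B \<in> null_sets lborel"
    using assms by (intro null_sets_subset[OF assms(7)]) auto
  then have "measure lborel (sym_diff A B) = 0"
    by (simp add: measure_eq_0_null_sets)
  then show ?thesis using \<rho>_diff_le[OF assms(1-5)] by simp
qed

end

text \<open>
  The coordinates \<open>i\<close> and \<open>j\<close> span the plane in which the matrices act; \<open>mean_density\<close> and \<open>density_dist\<close> below
  are taken with respect to the half cube of this pair.
\<close>

locale moment_invariant_plane = moment_invariant P \<rho> t
  for P :: "'w measure" and \<rho> :: "'w \<Rightarrow> (real ^ 'n) measure" and t +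
  fixes i j :: 'n
  assumes ij: "i \<noteq> j"
begin

definition mean_density :: "'w \<Rightarrow> real ^ 'n ^ 'n \<Rightarrow> real" where
  "mean_density w M = measure (\<rho> w) ((*v) M ` half_cube i j) / \<bar>det M\<bar>"

definition density_dist :: "real ^ 'n ^ 'n \<Rightarrow> real ^ 'n ^ 'n \<Rightarrow> real" where
  "density_dist M N = (\<integral>w. \<bar>mean_density w M - mean_density w N\<bar> \<partial>P)"

lemma image_half_cube [simp]:
  "det M \<noteq> 0 \<Longrightarrow> (*v) M ` half_cube i j \<in> sets borel" "bounded ((*v) M ` half_cube i j)"
  by (auto intro: borel_matrix_image bounded_matrix_image bounded_half_cube)

lemma mean_density_measurable [measurable]: "det M \<noteq> 0 \<Longrightarrow> (\<lambda>w. mean_density w M) \<in> borel_measurable P"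
  unfolding mean_density_def by (intro borel_measurable_divide \<rho>_measurable) auto

lemma mean_density_nonneg: "0 \<le> mean_density w M"
  by (simp add: mean_density_def)

lemma mean_density_le:
  assumes "det M \<noteq> 0" "w \<in> space P"
  shows "mean_density w M \<le> t * measure lborel (half_cube i j)"
proof -
  have "measure (\<rho> w) ((*v) M ` half_cube i j) \<le> t * (\<bar>det M\<bar> * measure lborel (half_cube i j))"
    using \<rho>_measure_le[OF assms(2), of "(*v) M ` half_cube i j"] assms(1)
    by (simp add: measure_matrix_image bounded_half_cube)
  then show ?thesis using assms(1) by (simp add: mean_density_def field_simps)
qed

lemma mean_density_bound: "det M \<noteq> 0 \<Longrightarrow> w \<in> space P \<Longrightarrow> \<bar>mean_density w M\<bar> \<le> t * measure lborel (half_cube i j)"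
  using mean_density_le mean_density_nonneg by (simp add: abs_of_nonneg)

lemma integrable_mean_density: "det M \<noteq> 0 \<Longrightarrow> integrable P (\<lambda>w. mean_density w M)"
  by (rule integrable_const_bound[of _ "t * measure lborel (half_cube i j)"]) (auto simp: mean_density_bound)

lemma integrable_mean_density_mult:
  assumes "det M \<noteq> 0" "det N \<noteq> 0"
  shows "integrable P (\<lambda>w. mean_density w M * mean_density w N)"
proof (rule integrable_const_bound)
  show "AE w in P. norm (mean_density w M * mean_density w N) \<le>
      (t * measure lborel (half_cube i j)) * (t * measure lborel (half_cube i j))"
    using assms by (intro AE_I2) (simp add: abs_mult mult_mono' mean_density_bound)
qed (use assms in measurable)

lemma integrable_mean_density_power2: "det M \<noteq> 0 \<Longrightarrow> integrable P (\<lambda>w. (mean_density w M)\<^sup>2)"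
  using integrable_mean_density_mult[of M M] by (simp add: power2_eq_square)

lemma density_dist_nonneg: "0 \<le> density_dist M N" and density_dist_sym: "density_dist M N = density_dist N M" and density_dist_refl: "density_dist M M = 0"
  by (auto simp: density_dist_def abs_minus_commute)

lemma integrable_mean_density_diff: "det M \<noteq> 0 \<Longrightarrow> det N \<noteq> 0 \<Longrightarrow> integrable P (\<lambda>w. \<bar>mean_density w M - mean_density w N\<bar>)"
  by (intro integrable_abs Bochner_Integration.integrable_diff integrable_mean_density)

lemma density_dist_triangle:
  assumes "det L \<noteq> 0" "det M \<noteq> 0" "det N \<noteq> 0"
  shows "density_dist L N \<le> density_dist L M + density_dist M N"
proof -
  have "density_dist L N \<le> (\<integral>w. \<bar>mean_density w L - mean_density w M\<bar> + \<bar>mean_density w M - mean_density w N\<bar> \<partial>P)"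
    unfolding density_dist_def using assms
    by (intro integral_mono Bochner_Integration.integrable_add integrable_mean_density_diff) auto
  also have "\<dots> = density_dist L M + density_dist M N"
    unfolding density_dist_def using assms by (intro Bochner_Integration.integral_add integrable_mean_density_diff)
  finally show ?thesis .
qed

lemma density_dist_zero_AE:
  assumes "det M \<noteq> 0" "det N \<noteq> 0" "density_dist M N = 0"
  shows "AE w in P. mean_density w M = mean_density w N"
  using integral_nonneg_eq_0_iff_AE[OF integrable_mean_density_diff[OF assms(1,2)]] assms(3)
  by (auto simp: density_dist_def)

lemma \<rho>_split:
  assumes "w \<in> space P" "det M \<noteq> 0" "0 < p" "0 < q"
  shows "measure (\<rho> w) ((*v) (M ** stretch i (p + q)) ` half_cube i j) =
    measure (\<rho> w) ((*v) (M ** stretch i p) ` half_cube i j) +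
    measure (\<rho> w) ((*v) (M ** (shear i j p ** stretch i q)) ` half_cube i j)"
proof -
  let ?A = "(*v) (M ** stretch i p) ` half_cube i j"
  let ?B = "(*v) (M ** (shear i j p ** stretch i q)) ` half_cube i j"
  obtain M' where M': "M' ** M = mat 1"
    using det_inverse_obtain[OF assms(2)] by metis
  have "inj ((*v) M)"
    by (rule injI) (metis M' matrix_vector_mul_assoc matrix_vector_mul_lid)
  then have "?A \<inter> ?B = (*v) M ` ((*v) (stretch i p) ` half_cube i j \<inter> (*v) (shear i j p ** stretch i q) ` half_cube i j)"
    by (simp add: image_mult image_Int)
  then have "?A \<inter> ?B = {}"
    using half_cube_split(2)[OF ij assms(3,4)] by simp
  moreover have "(*v) (M ** stretch i (p + q)) ` half_cube i j = ?A \<union> ?B"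
    by (simp only: image_mult[of M] half_cube_split(1)[OF ij assms(3,4)] image_Un)
  ultimately show ?thesis
    using \<rho>_add[of w ?A ?B] assms ij by (simp add: det_mul det_stretch det_shear)
qed

lemma mean_density_halves:
  assumes "w \<in> space P" "det M \<noteq> 0"
  shows "mean_density w M = (mean_density w (M ** stretch i (1/2)) + mean_density w (M ** (shear i j (1/2) ** stretch i (1/2)))) / 2"
  using \<rho>_split[OF assms, of "1/2" "1/2"] assms(2) ij
  by (simp add: mean_density_def det_mul det_stretch det_shear stretch_1 abs_mult field_simps)

text \<open>
  If \<open>det M = det N\<close>, then \<open>M\<close> is \<open>N\<close> multiplied from the left by a matrix of determinant one, which does not change
  the second moment.
\<close>

lemma energy_eq:
  assumes "det M \<noteq> 0" "det M = det N"
  shows "(\<integral>w. (mean_density w M)\<^sup>2 \<partial>P) = (\<integral>w. (mean_density w N)\<^sup>2 \<partial>P)"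
proof -
  obtain N' where N': "N' ** N = mat 1" "det N * det N' = 1"
    using det_inverse_obtain[of N] assms by metis
  have "M = M ** N' ** N"
    by (metis N'(1) matrix_mul_assoc matrix_mul_rid)
  moreover have "det (M ** N') = 1"
    using N'(2) assms by (simp add: det_mul)
  ultimately have "(\<integral>w. (measure (\<rho> w) ((*v) M ` half_cube i j))\<^sup>2 \<partial>P) =
      (\<integral>w. (measure (\<rho> w) ((*v) N ` half_cube i j))\<^sup>2 \<partial>P)"
    using moment[of "M ** N'" "(*v) N ` half_cube i j"] assms
    by (metis image_half_cube image_mult)
  then show ?thesis
    using assms by (simp add: mean_density_def power_divide)
qed

text \<open>
  With \<open>Y = (Y\<^sub>a + Y\<^sub>b) / 2\<close> the square of \<open>Y - Y\<^sub>a\<close> equals \<open>Y\<^sub>a\<^sup>2 / 2 + Y\<^sub>b\<^sup>2 / 2 - Y\<^sup>2\<close>; the expectations of \<open>Y\<^sub>a\<^sup>2\<close> and \<open>Y\<^sub>b\<^sup>2\<close> agree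
  because both matrices have the same determinant, and the first absolute moment is controlled by the second moment.
\<close>

lemma density_dist_half_energy:
  assumes "det M \<noteq> 0"
  shows "(density_dist M (M ** stretch i (1/2)))\<^sup>2 \<le> (\<integral>w. (mean_density w (M ** stretch i (1/2)))\<^sup>2 \<partial>P) - (\<integral>w. (mean_density w M)\<^sup>2 \<partial>P)"
proof -
  let ?a = "M ** stretch i (1/2)" and ?b = "M ** (shear i j (1/2) ** stretch i (1/2))"
  have dets: "det ?a \<noteq> 0" "det ?b \<noteq> 0" "det ?b = det ?a"
    using assms ij by (auto simp: det_mul det_stretch det_shear)
  let ?Z = "\<lambda>w. \<bar>mean_density w M - mean_density w ?a\<bar>"
  have Z: "(?Z w)\<^sup>2 = (mean_density w ?a)\<^sup>2 / 2 + (mean_density w ?b)\<^sup>2 / 2 - (mean_density w M)\<^sup>2" if "w \<in> space P" for w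
    unfolding mean_density_halves[OF that assms] by (simp add: power2_eq_square field_simps)
  have iZ2: "integrable P (\<lambda>w. (?Z w)\<^sup>2)"
  proof (subst Bochner_Integration.integrable_cong[OF refl Z])
    show "integrable P (\<lambda>w. (mean_density w ?a)\<^sup>2 / 2 + (mean_density w ?b)\<^sup>2 / 2 - (mean_density w M)\<^sup>2)"
      using integrable_mean_density_power2[OF assms] integrable_mean_density_power2[OF dets(1)] integrable_mean_density_power2[OF dets(2)]
      by simp
  qed simp
  have "(expectation ?Z)\<^sup>2 \<le> expectation (\<lambda>w. (?Z w)\<^sup>2)"
    using variance_eq[OF integrable_mean_density_diff[OF assms dets(1)] iZ2] variance_positive[of ?Z] by linarith
  also have "\<dots> = (\<integral>w. (mean_density w ?a)\<^sup>2 / 2 + (mean_density w ?b)\<^sup>2 / 2 - (mean_density w M)\<^sup>2 \<partial>P)"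
    by (rule Bochner_Integration.integral_cong[OF refl Z])
  also have "\<dots> = (\<integral>w. (mean_density w ?a)\<^sup>2 \<partial>P) / 2 + (\<integral>w. (mean_density w ?b)\<^sup>2 \<partial>P) / 2 - (\<integral>w. (mean_density w M)\<^sup>2 \<partial>P)"
    using integrable_mean_density_power2 assms dets by simp
  also have "(\<integral>w. (mean_density w ?b)\<^sup>2 \<partial>P) = (\<integral>w. (mean_density w ?a)\<^sup>2 \<partial>P)"
    using energy_eq dets by metis
  finally show ?thesis by (simp add: density_dist_def)
qed

text \<open>
  The bound does not depend on \<open>M\<close>: the symmetric difference of the two images is contained in the image
  under \<open>M\<close> of a fixed set, and the factor \<open>\<bar>det M\<bar>\<close> cancels.
\<close>

lemma density_dist_shear_le:
  assumes "det M \<noteq> 0" "k \<noteq> l"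
  shows "density_dist M (M ** shear k l s) \<le> t * measure lborel (sym_diff (half_cube i j) ((*v) (shear k l s) ` half_cube i j))"
proof -
  let ?S = "sym_diff (half_cube i j) ((*v) (shear k l s) ` half_cube i j)"
  have S: "?S \<in> sets borel" "bounded ?S"
    using assms bounded_half_cube[of i j]
    by (auto simp: det_shear bounded_diff)
  have d: "det (M ** shear k l s) = det M"
    using assms by (simp add: det_mul det_shear)
  have "\<bar>mean_density w M - mean_density w (M ** shear k l s)\<bar> \<le> t * measure lborel ?S" if w: "w \<in> space P" for w
  proof -
    let ?A = "(*v) M ` half_cube i j" and ?B = "(*v) (M ** shear k l s) ` half_cube i j"
    have "sym_diff ?A ?B \<subseteq> (*v) M ` ?S"
      by (auto simp: image_mult)
    then have "measure lborel (sym_diff ?A ?B) \<le> measure lborel ((*v) M ` ?S)"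
      using assms d S by (intro measure_mono_fmeasurable) (auto intro!: fmeasurableI emeasure_bounded_finite bounded_matrix_image borel_matrix_image)
    also have "\<dots> = \<bar>det M\<bar> * measure lborel ?S"
      by (rule measure_matrix_image[OF assms(1) S])
    finally have m: "t * measure lborel (sym_diff ?A ?B) \<le> t * (\<bar>det M\<bar> * measure lborel ?S)"
      using t_nonneg by (rule mult_left_mono)
    have "\<bar>mean_density w M - mean_density w (M ** shear k l s)\<bar> = \<bar>measure (\<rho> w) ?A - measure (\<rho> w) ?B\<bar> / \<bar>det M\<bar>"
      unfolding mean_density_def d by (simp add: diff_divide_distrib[symmetric])
    also have "\<dots> \<le> t * measure lborel (sym_diff ?A ?B) / \<bar>det M\<bar>"
      using assms d w by (intro divide_right_mono \<rho>_diff_le) auto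
    also have "\<dots> \<le> t * measure lborel ?S"
      using m assms(1) by (simp add: field_simps)
    finally show ?thesis .
  qed
  then have "density_dist M (M ** shear k l s) \<le> (\<integral>w. t * measure lborel ?S \<partial>P)"
    unfolding density_dist_def using assms d by (intro integral_mono integrable_mean_density_diff) auto
  then show ?thesis by (simp add: prob_space)
qed

end

section \<open>Matrices that asymptotically fix the averages\<close>

context moment_invariant_plane begin

text \<open>
  Right multiplication by \<open>B\<close> changes the mean density less and less as the determinant of \<open>M\<close> tends to zero. The
  determinants of \<open>M\<close> are confined to \<open>A\<close> times the powers of two, because convergence of the second moments
  is known along such sequences only, and not uniformly in \<open>A\<close>.
\<close>

definition asymp_fixed :: "real \<Rightarrow> real ^ 'n ^ 'n \<Rightarrow> bool" where
  "asymp_fixed A B \<longleftrightarrow> (\<exists>z::int. det B = 2 powi z) \<and>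
     (\<forall>\<epsilon>>0. \<exists>\<delta>>0. \<forall>M. (\<exists>z::int. det M = A * 2 powi z) \<and> \<bar>det M\<bar> < \<delta> \<longrightarrow> density_dist M (M ** B) < \<epsilon>)"

lemma asymp_fixedD:
  assumes "asymp_fixed A B" "0 < \<epsilon>"
  obtains \<delta> where "0 < \<delta>" "\<And>M z. det M = A * 2 powi z \<Longrightarrow> \<bar>det M\<bar> < \<delta> \<Longrightarrow> density_dist M (M ** B) < \<epsilon>"
  using assms unfolding asymp_fixed_def by blast

lemma asymp_fixed_det: "asymp_fixed A B \<Longrightarrow> \<exists>z::int. det B = 2 powi z"
  by (simp add: asymp_fixed_def)

lemma level_mult:
  fixes M B :: "real ^ 'n ^ 'n"
  assumes "det M = A * 2 powi z" "det B = 2 powi y"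
  shows "det (M ** B) = A * 2 powi (z + y)"
  using assms by (simp add: det_mul power_int_add)

text \<open>
  The contraction principle: if \<open>B\<close> is, for every \<open>n\<close>, a product of two asymptotically fixing matrices with a
  matrix \<open>U\<^sub>n\<close> between them, and \<open>U\<^sub>n\<close> moves the mean densities by an amount that tends to zero uniformly in \<open>M\<close>, then
  \<open>B\<close> is asymptotically fixing. For each \<open>\<epsilon>\<close> only one suitable \<open>n\<close> is used, so the two outer factors may
  depend on \<open>n\<close>.
\<close>

lemma asymp_fixed_conjugate:
  assumes A: "A \<noteq> 0"
    and B: "\<And>n. \<exists>G H. asymp_fixed A G \<and> asymp_fixed A H \<and> B = G ** U n ** H"
    and U: "\<And>n. det (U n) = 1" "\<And>n M. det M \<noteq> 0 \<Longrightarrow> density_dist M (M ** U n) \<le> \<eta> n" "\<eta> \<longlonglongrightarrow> 0"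
  shows "asymp_fixed A B"
  unfolding asymp_fixed_def
proof (intro conjI allI impI)
  show "\<exists>z::int. det B = 2 powi z"
  proof -
    obtain G H where "asymp_fixed A G" "asymp_fixed A H" "B = G ** U 0 ** H" using B by blast
    then show ?thesis using asymp_fixed_det[of A G] asymp_fixed_det[of A H] U(1)
      by (auto simp: det_mul power_int_add[symmetric])
  qed
  fix \<epsilon> :: real assume "0 < \<epsilon>"
  then have e3: "0 < \<epsilon> / 3" by simp
  have "eventually (\<lambda>n. \<eta> n < \<epsilon> / 3) sequentially"
    using U(3) e3 by (rule order_tendstoD)
  then obtain n where n: "\<eta> n < \<epsilon> / 3"
    by (auto simp: eventually_sequentially)
  obtain G H where GH: "asymp_fixed A G" "asymp_fixed A H" "B = G ** U n ** H" using B by blast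
  obtain y where y: "det G = 2 powi y" using asymp_fixed_det[OF GH(1)] by blast
  obtain \<delta>1 where d1: "0 < \<delta>1" "\<And>M z. det M = A * 2 powi z \<Longrightarrow> \<bar>det M\<bar> < \<delta>1 \<Longrightarrow> density_dist M (M ** G) < \<epsilon> / 3"
    using asymp_fixedD[OF GH(1) e3] by blast
  obtain \<delta>2 where d2: "0 < \<delta>2" "\<And>M z. det M = A * 2 powi z \<Longrightarrow> \<bar>det M\<bar> < \<delta>2 \<Longrightarrow> density_dist M (M ** H) < \<epsilon> / 3"
    using asymp_fixedD[OF GH(2) e3] by blast
  have yp: "(0::real) < 2 powi y" by simp
  show "\<exists>\<delta>>0. \<forall>M. (\<exists>z::int. det M = A * 2 powi z) \<and> \<bar>det M\<bar> < \<delta> \<longrightarrow> density_dist M (M ** B) < \<epsilon>"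
  proof (intro exI[of _ "min \<delta>1 (\<delta>2 / 2 powi y)"] conjI allI impI)
    show "0 < min \<delta>1 (\<delta>2 / 2 powi y)" using d1(1) d2(1) by simp
    fix M :: "real ^ 'n ^ 'n"
    assume "(\<exists>z::int. det M = A * 2 powi z) \<and> \<bar>det M\<bar> < min \<delta>1 (\<delta>2 / 2 powi y)"
    then obtain z where z: "det M = A * 2 powi z" and M: "\<bar>det M\<bar> < \<delta>1" "\<bar>det M\<bar> * 2 powi y < \<delta>2"
      using pos_less_divide_eq[OF yp] by (metis min_less_iff_conj)
    let ?N = "M ** G ** U n"
    have MG: "det (M ** G) = A * 2 powi (z + y)" using level_mult[OF z y] .
    have N: "det ?N = A * 2 powi (z + y)" using MG U(1) by (simp add: det_mul)
    have "\<bar>det ?N\<bar> < \<delta>2" using M(2) z by (simp add: N power_int_add abs_mult mult.assoc)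
    then have 3: "density_dist ?N (?N ** H) < \<epsilon> / 3" by (rule d2(2)[OF N])
    have 2: "density_dist (M ** G) ?N \<le> \<eta> n" using MG A by (intro U(2)) simp
    have 1: "density_dist M (M ** G) < \<epsilon> / 3" by (rule d1(2)[OF z M(1)])
    obtain x where x: "det H = 2 powi x" using asymp_fixed_det[OF GH(2)] by blast
    have dets: "det M \<noteq> 0" "det (M ** G) \<noteq> 0" "det ?N \<noteq> 0" "det (?N ** H) \<noteq> 0"
      using A z MG N x by (auto simp: det_mul[of ?N])
    have "density_dist M (?N ** H) \<le> density_dist M (M ** G) + density_dist (M ** G) (?N ** H)"
      by (rule density_dist_triangle[OF dets(1,2,4)])
    also have "density_dist (M ** G) (?N ** H) \<le> density_dist (M ** G) ?N + density_dist ?N (?N ** H)"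
      by (rule density_dist_triangle[OF dets(2,3,4)])
    also have "M ** B = ?N ** H" by (simp add: GH(3) matrix_mul_assoc)
    ultimately show "density_dist M (M ** B) < \<epsilon>" using 1 2 3 n by (simp add: GH(3) matrix_mul_assoc)
  qed
qed

lemma asymp_fixed_mult:
  assumes "A \<noteq> 0" "asymp_fixed A G" "asymp_fixed A H"
  shows "asymp_fixed A (G ** H)"
proof (rule asymp_fixed_conjugate[OF assms(1), of _ "\<lambda>_. mat 1" "\<lambda>_. 0"])
  show "\<exists>G' H'. asymp_fixed A G' \<and> asymp_fixed A H' \<and> G ** H = G' ** mat 1 ** H'"
    using assms by (intro exI[of _ G] exI[of _ H]) simp
qed (auto simp: density_dist_refl)

lemma asymp_fixed_1: "asymp_fixed A (mat 1)"
  unfolding asymp_fixed_def by (auto simp: density_dist_refl intro!: exI[of _ "0::int"] exI[of _ "1::real"])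

text \<open>
  Along \<open>det M = A / 2\<^sup>k\<close> the second moments increase with \<open>k\<close> and are bounded; their increments, which control the
  distance in question, therefore tend to zero.
\<close>

lemma asymp_fixed_halve:
  assumes A: "A \<noteq> 0"
  shows "asymp_fixed A (stretch i (1/2))"
  unfolding asymp_fixed_def
proof (intro conjI allI impI)
  show "\<exists>z::int. det (stretch i (1/2)) = 2 powi z"
    by (intro exI[of _ "- 1"]) (simp add: det_stretch power_int_minus)
  fix \<epsilon> :: real assume e: "0 < \<epsilon>"
  define e where "e k = (\<integral>w. (mean_density w (stretch i (A / 2 ^ k)))\<^sup>2 \<partial>P)" for k :: nat
  have e_eq: "(\<integral>w. (mean_density w M)\<^sup>2 \<partial>P) = e k" if "det M = A / 2 ^ k" for M k
    unfolding e_def using that A by (intro energy_eq) (auto simp: det_stretch)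
  have half: "det (M ** stretch i (1/2)) = A / 2 ^ Suc k" if "det M = A / 2 ^ k" for M k
    using that by (simp add: det_mul det_stretch)
  have step: "(density_dist M (M ** stretch i (1/2)))\<^sup>2 \<le> e (Suc k) - e k" if "det M = A / 2 ^ k" for M k
    using density_dist_half_energy[of M] e_eq[OF that] e_eq[OF half[OF that]] that A by simp
  have "e k \<le> e (Suc k)" for k
    using step[of "stretch i (A / 2 ^ k)" k] by (simp add: det_stretch) (smt (verit) zero_le_power2)
  then have inc: "incseq e" by (rule incseq_SucI)
  have "e k \<le> (t * measure lborel (half_cube i j))\<^sup>2" for k
  proof -
    have d: "det (stretch i (A / 2 ^ k)) \<noteq> 0" using A by (simp add: det_stretch)
    have "e k \<le> (\<integral>w. (t * measure lborel (half_cube i j))\<^sup>2 \<partial>P)"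
      unfolding e_def using d
      by (intro integral_mono integrable_mean_density_power2 power_mono mean_density_le mean_density_nonneg) auto
    then show ?thesis by (simp add: prob_space)
  qed
  then obtain L where L: "e \<longlonglongrightarrow> L"
    using incseq_convergent[OF inc] by blast
  have "(\<lambda>k. e (Suc k) - e k) \<longlonglongrightarrow> L - L"
    by (intro tendsto_diff L LIMSEQ_Suc[OF L])
  moreover have "L - L < \<epsilon>\<^sup>2" using e by simp
  ultimately have "eventually (\<lambda>k. e (Suc k) - e k < \<epsilon>\<^sup>2) sequentially"
    by (rule order_tendstoD)
  then obtain K where K: "\<And>k. k \<ge> K \<Longrightarrow> e (Suc k) - e k < \<epsilon>\<^sup>2"
    by (auto simp: eventually_sequentially)
  show "\<exists>\<delta>>0. \<forall>M. (\<exists>z::int. det M = A * 2 powi z) \<and> \<bar>det M\<bar> < \<delta> \<longrightarrow> density_dist M (M ** stretch i (1/2)) < \<epsilon>"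
  proof (intro exI[of _ "\<bar>A\<bar> * 2 powi (- int K)"] conjI allI impI)
    show "0 < \<bar>A\<bar> * 2 powi (- int K)" using A by simp
    fix M :: "real ^ 'n ^ 'n"
    assume "(\<exists>z::int. det M = A * 2 powi z) \<and> \<bar>det M\<bar> < \<bar>A\<bar> * 2 powi (- int K)"
    then obtain z where z: "det M = A * 2 powi z" "(2::real) powi z < 2 powi (- int K)"
      using A by (auto simp: abs_mult)
    have "z < - int K"
      using z(2) power_int_increasing[of "- int K" z "2::real"] by (auto simp: not_le[symmetric])
    then obtain k where k: "z = - int k" "k \<ge> K"
      by (intro that[of "nat (- z)"]) auto
    have "det M = A / 2 ^ k" by (simp add: z(1) k(1) power_int_minus divide_inverse)
    from step[OF this] K[OF k(2)] have "(density_dist M (M ** stretch i (1/2)))\<^sup>2 < \<epsilon>\<^sup>2" by linarith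
    then show "density_dist M (M ** stretch i (1/2)) < \<epsilon>"
      using e by (simp add: power_less_imp_less_base)
  qed
qed

text \<open>
  The property of \<open>G\<close> is applied at \<open>M H\<close>, whose determinant differs from that of \<open>M\<close> by a fixed power of two.
\<close>

lemma asymp_fixed_inverse:
  assumes A: "A \<noteq> 0" and G: "asymp_fixed A G" and H: "G ** H = mat 1" "H ** G = mat 1"
  shows "asymp_fixed A H"
  unfolding asymp_fixed_def
proof (intro conjI allI impI)
  obtain y where y: "det G = 2 powi y" using asymp_fixed_det[OF G] by blast
  have "det G * det H = 1" using H(1) by (metis det_I det_mul)
  then have h: "det H = 2 powi (- y)" using y by (simp add: power_int_minus field_simps)
  then show "\<exists>z::int. det H = 2 powi z" by blast
  fix \<epsilon> :: real assume "0 < \<epsilon>"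
  from asymp_fixedD[OF G this] obtain \<delta> where d: "0 < \<delta>" "\<And>M z. det M = A * 2 powi z \<Longrightarrow> \<bar>det M\<bar> < \<delta> \<Longrightarrow> density_dist M (M ** G) < \<epsilon>"
    by blast
  show "\<exists>\<delta>>0. \<forall>M. (\<exists>z::int. det M = A * 2 powi z) \<and> \<bar>det M\<bar> < \<delta> \<longrightarrow> density_dist M (M ** H) < \<epsilon>"
  proof (intro exI[of _ "\<delta> * 2 powi y"] conjI allI impI)
    show "0 < \<delta> * 2 powi y" using d(1) by simp
    fix M :: "real ^ 'n ^ 'n"
    assume "(\<exists>z::int. det M = A * 2 powi z) \<and> \<bar>det M\<bar> < \<delta> * 2 powi y"
    then obtain z where z: "det M = A * 2 powi z" "\<bar>det M\<bar> < \<delta> * 2 powi y" by blast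
    have "density_dist (M ** H) (M ** H ** G) < \<epsilon>"
      using level_mult[OF z(1) h] z(2)
      by (intro d(2)) (auto simp: det_mul h power_int_minus abs_mult field_simps)
    then show "density_dist M (M ** H) < \<epsilon>"
      by (simp add: density_dist_sym matrix_mul_assoc[symmetric] H)
  qed
qed

lemma asymp_fixed_stretch:
  assumes A: "A \<noteq> 0"
  shows "asymp_fixed A (stretch i (2 ^ n))" "asymp_fixed A (stretch i (1 / 2 ^ n))"
proof (induction n)
  case 0
  show "asymp_fixed A (stretch i (2 ^ 0))" "asymp_fixed A (stretch i (1 / 2 ^ 0))" by (simp_all add: stretch_1 asymp_fixed_1)
next
  case (Suc n)
  have "asymp_fixed A (stretch i 2)"
    using asymp_fixed_inverse[OF A asymp_fixed_halve[OF A], of "stretch i 2"] by (simp add: stretch_mult stretch_1)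
  then show "asymp_fixed A (stretch i (2 ^ Suc n))"
    using asymp_fixed_mult[OF A _ Suc(1), of "stretch i 2"] by (simp add: stretch_mult)
  show "asymp_fixed A (stretch i (1 / 2 ^ Suc n))"
    using asymp_fixed_mult[OF A asymp_fixed_halve[OF A] Suc(2)] by (simp add: stretch_mult)
qed

text \<open>
  The exponent is shifted so that all the shears have parameter at most one in absolute value, which keeps the
  sheared sets in a common ball.
\<close>

lemma shear_contraction:
  assumes kl: "k \<noteq> l"
  shows "(\<lambda>n. t * measure lborel (sym_diff (half_cube i j) ((*v) (shear k l (s / 2 ^ (n + nat \<lceil>\<bar>s\<bar>\<rceil>))) ` half_cube i j))) \<longlonglongrightarrow> 0"
proof -
  have b: "\<bar>s / 2 ^ (n + nat \<lceil>\<bar>s\<bar>\<rceil>)\<bar> \<le> 1" for n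
  proof -
    have "\<bar>s\<bar> \<le> real (nat \<lceil>\<bar>s\<bar>\<rceil>)" by linarith
    also have "\<dots> \<le> real (n + nat \<lceil>\<bar>s\<bar>\<rceil>)" by simp
    also have "\<dots> \<le> 2 ^ (n + nat \<lceil>\<bar>s\<bar>\<rceil>)"
      using of_nat_less_two_power less_imp_le by blast
    finally show ?thesis by (simp add: abs_divide divide_le_eq)
  qed
  have "(\<lambda>n. s * (1/2) ^ n) \<longlonglongrightarrow> s * 0"
    by (intro tendsto_mult tendsto_const LIMSEQ_power_zero) simp
  then have "(\<lambda>n. s / 2 ^ n) \<longlonglongrightarrow> 0"
    by (simp add: power_divide)
  then have "(\<lambda>n. s / 2 ^ (n + nat \<lceil>\<bar>s\<bar>\<rceil>)) \<longlonglongrightarrow> 0"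
    by (rule LIMSEQ_ignore_initial_segment)
  from tendsto_mult_right_zero[OF sym_diff_shear_tendsto[OF kl convex_half_cube bounded_half_cube half_cube_borel this b]]
  show ?thesis .
qed

text \<open>
  Conjugating by \<open>stretch i (2\<^sup>n)\<close> divides the parameter of the shear by \<open>2\<^sup>n\<close>.
\<close>

lemma asymp_fixed_upper:
  assumes A: "A \<noteq> 0"
  shows "asymp_fixed A (shear i j s)"
proof (rule asymp_fixed_conjugate[OF A _ _ _ shear_contraction[OF ij, of s], of _ "\<lambda>n. shear i j (s / 2 ^ (n + nat \<lceil>\<bar>s\<bar>\<rceil>))"])
  fix n
  let ?n = "n + nat \<lceil>\<bar>s\<bar>\<rceil>"
  have "shear i j s = shear i j s ** (stretch i (2 ^ ?n) ** stretch i (1 / 2 ^ ?n))"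
    by (simp add: stretch_mult stretch_1)
  also have "\<dots> = stretch i (2 ^ ?n) ** shear i j (s / 2 ^ ?n) ** stretch i (1 / 2 ^ ?n)"
    by (simp add: matrix_mul_assoc stretch_shear_upper[OF ij])
  finally show "\<exists>G H. asymp_fixed A G \<and> asymp_fixed A H \<and> shear i j s = G ** shear i j (s / 2 ^ ?n) ** H"
    using asymp_fixed_stretch[OF A] by blast
qed (rule det_shear[OF ij] density_dist_shear_le[OF _ ij], assumption?)+

text \<open>
  For the transposed shear the contracting conjugation is by the inverse stretch.
\<close>

lemma asymp_fixed_lower:
  assumes A: "A \<noteq> 0"
  shows "asymp_fixed A (shear j i s)"
proof (rule asymp_fixed_conjugate[OF A _ _ _ shear_contraction[OF ij[symmetric], of s], of _ "\<lambda>n. shear j i (s / 2 ^ (n + nat \<lceil>\<bar>s\<bar>\<rceil>))"])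
  fix n
  let ?n = "n + nat \<lceil>\<bar>s\<bar>\<rceil>"
  have "shear j i s = (shear j i s ** stretch i (1 / 2 ^ ?n)) ** stretch i (2 ^ ?n)"
    by (simp add: matrix_mul_assoc[symmetric] stretch_mult stretch_1)
  also have "\<dots> = stretch i (1 / 2 ^ ?n) ** shear j i (s / 2 ^ ?n) ** stretch i (2 ^ ?n)"
    by (simp add: stretch_shear_lower[OF ij])
  finally show "\<exists>G H. asymp_fixed A G \<and> asymp_fixed A H \<and> shear j i s = G ** shear j i (s / 2 ^ ?n) ** H"
    using asymp_fixed_stretch[OF A] by blast
qed (rule det_shear[OF ij[symmetric]] density_dist_shear_le[OF _ ij[symmetric]], assumption?)+

text \<open>
  The homothety with ratio \<open>1 / sqrt 2\<close> of the \<open>(i, j)\<close> plane, identity in the other coordinates. It is written as the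
  product of a matrix that is known to fix the mean densities asymptotically and of a product of shears.
\<close>

definition \<kappa> :: "real ^ 'n ^ 'n" where
  "\<kappa> = stretch i (1/2) ** (stretch i (sqrt 2) ** stretch j (1 / sqrt 2))"

lemma det_\<kappa>: "det \<kappa> = 1/2"
  by (simp add: \<kappa>_def det_mul det_stretch)

lemma asymp_fixed_\<kappa>:
  assumes "A \<noteq> 0"
  shows "asymp_fixed A \<kappa>"
proof -
  have "sqrt 2 \<noteq> (0::real)" by simp
  note torus = torus_eq_shears[OF ij this]
  show ?thesis
    unfolding \<kappa>_def torus using assms
    by (intro asymp_fixed_mult asymp_fixed_upper asymp_fixed_lower asymp_fixed_halve)
qed

lemma \<kappa>_vec: "(\<kappa> *v x) $ k = (if k = i \<or> k = j then x $ k / sqrt 2 else x $ k)"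
proof -
  have "sqrt 2 * y / 2 = y / sqrt 2" for y
    using real_sqrt_mult_self[of 2] by (simp add: field_simps)
  then show ?thesis
    using ij by (simp add: \<kappa>_def stretch_vec matrix_vector_mul_assoc[symmetric])
qed

lemma \<kappa>_commute:
  "\<kappa> ** shear i j s = shear i j s ** \<kappa>" "\<kappa> ** shear j i s = shear j i s ** \<kappa>" "\<kappa> ** stretch i s = stretch i s ** \<kappa>"
proof -
  have "(\<kappa> ** shear i j s *v x) $ k = (shear i j s ** \<kappa> *v x) $ k"
    "(\<kappa> ** shear j i s *v x) $ k = (shear j i s ** \<kappa> *v x) $ k"
    "(\<kappa> ** stretch i s *v x) $ k = (stretch i s ** \<kappa> *v x) $ k" for x k
    unfolding matrix_vector_mul_assoc[symmetric] \<kappa>_vec shear_vec[OF ij] shear_vec[OF ij[symmetric]] stretch_vec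
    using ij by (simp_all add: add_divide_distrib)
  then show "\<kappa> ** shear i j s = shear i j s ** \<kappa>" "\<kappa> ** shear j i s = shear j i s ** \<kappa>" "\<kappa> ** stretch i s = stretch i s ** \<kappa>"
    by (blast intro: matrix_eqI)+
qed

text \<open>
  If the distance for \<open>B\<close> at one determinant is bounded by the distances at half the determinant, then
  iterating brings the determinant into the range where the distance is arbitrarily small.
\<close>

lemma density_dist_zero_of_asymp_fixed:
  assumes M: "det M \<noteq> 0" and B: "asymp_fixed (det M) B"
    and step: "\<And>M \<epsilon>. det M \<noteq> 0 \<Longrightarrow> (\<And>N. det N = det M / 2 \<Longrightarrow> density_dist N (N ** B) \<le> \<epsilon>) \<Longrightarrow> density_dist M (M ** B) \<le> \<epsilon>"
  shows "density_dist M (M ** B) = 0"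
proof -
  have "density_dist M (M ** B) \<le> 0 + \<epsilon>" if e: "0 < \<epsilon>" for \<epsilon>
  proof -
    obtain \<delta> where d: "0 < \<delta>" "\<And>N z. det N = det M * 2 powi z \<Longrightarrow> \<bar>det N\<bar> < \<delta> \<Longrightarrow> density_dist N (N ** B) < \<epsilon>"
      using asymp_fixedD[OF B e] by blast
    obtain n where n: "\<bar>det M\<bar> / 2 ^ n < \<delta>"
    proof -
      obtain n where "(1/2) ^ n < \<delta> / \<bar>det M\<bar>"
        using real_arch_pow_inv[of "\<delta> / \<bar>det M\<bar>" "1/2"] d(1) M by auto
      then show ?thesis using M by (intro that[of n]) (simp add: field_simps)
    qed
    have ind: "density_dist N (N ** B) \<le> \<epsilon>" if "det N \<noteq> 0" "\<And>N'. det N' = det N / 2 ^ k \<Longrightarrow> density_dist N' (N' ** B) \<le> \<epsilon>" for k N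
      using that
    proof (induction k arbitrary: N)
      case (Suc k)
      show ?case
      proof (rule step[OF Suc.prems(1)])
        fix N' :: "real ^ 'n ^ 'n" assume N': "det N' = det N / 2"
        show "density_dist N' (N' ** B) \<le> \<epsilon>"
        proof (rule Suc.IH)
          show "det N' \<noteq> 0" using N' Suc.prems(1) by simp
          show "density_dist L (L ** B) \<le> \<epsilon>" if "det L = det N' / 2 ^ k" for L
            using that N' by (intro Suc.prems(2)) simp
        qed
      qed
    qed simp
    have "density_dist M (M ** B) \<le> \<epsilon>"
    proof (rule ind[OF M])
      fix N' :: "real ^ 'n ^ 'n" assume N': "det N' = det M / 2 ^ n"
      then have "det N' = det M * 2 powi (- int n)" by (simp add: power_int_minus divide_inverse)
      moreover have "\<bar>det N'\<bar> < \<delta>" using n by (simp add: N')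
      ultimately show "density_dist N' (N' ** B) \<le> \<epsilon>" using d(2) less_imp_le by blast
    qed
    then show ?thesis by simp
  qed
  then have "density_dist M (M ** B) \<le> 0" by (rule field_le_epsilon)
  then show ?thesis using density_dist_nonneg[of M "M ** B"] by simp
qed

text \<open>
  As \<open>\<kappa>\<close> commutes with the two matrices that cut the half cube, the difference of the mean densities at \<open>M\<close>
  and \<open>M \<kappa>\<close> is the average of the corresponding differences for the two pieces.
\<close>

lemma density_dist_\<kappa>:
  assumes "det M \<noteq> 0"
  shows "density_dist M (M ** \<kappa>) = 0"
proof (rule density_dist_zero_of_asymp_fixed[OF assms asymp_fixed_\<kappa>[OF assms]])
  fix M :: "real ^ 'n ^ 'n" and \<epsilon>
  assume M: "det M \<noteq> 0" and le: "\<And>N. det N = det M / 2 \<Longrightarrow> density_dist N (N ** \<kappa>) \<le> \<epsilon>"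
  let ?a = "stretch i (1/2)" and ?b = "shear i j (1/2) ** stretch i (1/2)"
  have ab: "det (M ** ?a) = det M / 2" "det (M ** ?b) = det M / 2"
    using ij by (auto simp: det_mul det_stretch det_shear)
  have c: "M ** \<kappa> ** ?a = M ** ?a ** \<kappa>" "M ** \<kappa> ** ?b = M ** ?b ** \<kappa>"
    by (simp add: matrix_mul_assoc[symmetric] \<kappa>_commute, metis matrix_mul_assoc \<kappa>_commute)
  have nz: "det (M ** \<kappa>) \<noteq> 0" "det (M ** ?a ** \<kappa>) \<noteq> 0" "det (M ** ?b ** \<kappa>) \<noteq> 0" "det (M ** ?a) \<noteq> 0" "det (M ** ?b) \<noteq> 0"
    using M ab by (auto simp: det_mul[of _ \<kappa>] det_\<kappa>)
  have avg: "\<bar>(a + b) / 2 - (c + d) / 2\<bar> \<le> (\<bar>a - c\<bar> + \<bar>b - d\<bar>) / 2" for a b c d :: real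
    using abs_triangle_ineq[of "a - c" "b - d"] by (simp add: diff_divide_distrib[symmetric] algebra_simps)
  have "\<bar>mean_density w M - mean_density w (M ** \<kappa>)\<bar> \<le> (\<bar>mean_density w (M ** ?a) - mean_density w (M ** ?a ** \<kappa>)\<bar> + \<bar>mean_density w (M ** ?b) - mean_density w (M ** ?b ** \<kappa>)\<bar>) / 2"
    if w: "w \<in> space P" for w
    unfolding mean_density_halves[OF w M] mean_density_halves[OF w nz(1)] c by (rule avg)
  then have "density_dist M (M ** \<kappa>) \<le> (\<integral>w. (\<bar>mean_density w (M ** ?a) - mean_density w (M ** ?a ** \<kappa>)\<bar> + \<bar>mean_density w (M ** ?b) - mean_density w (M ** ?b ** \<kappa>)\<bar>) / 2 \<partial>P)"
    unfolding density_dist_def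
    by (intro integral_mono integrable_mean_density_diff[OF M nz(1)] integrable_divide_zero Bochner_Integration.integrable_add impI
      integrable_mean_density_diff[OF nz(4,2)] integrable_mean_density_diff[OF nz(5,3)])
  also have "\<dots> = (density_dist (M ** ?a) (M ** ?a ** \<kappa>) + density_dist (M ** ?b) (M ** ?b ** \<kappa>)) / 2"
    unfolding density_dist_def using integrable_mean_density_diff[OF nz(4,2)] integrable_mean_density_diff[OF nz(5,3)] by simp
  also have "\<dots> \<le> \<epsilon>" using le[OF ab(1)] le[OF ab(2)] by simp
  finally show "density_dist M (M ** \<kappa>) \<le> \<epsilon>" .
qed

text \<open>
  Moving from \<open>M\<close> to \<open>M \<kappa>\<close> and from \<open>M B\<close> to \<open>M B \<kappa> = M \<kappa> B\<close> costs nothing, and halves the determinant.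
\<close>

lemma density_dist_commuting:
  assumes M: "det M \<noteq> 0" and B: "\<And>A. A \<noteq> 0 \<Longrightarrow> asymp_fixed A B" "\<kappa> ** B = B ** \<kappa>"
  shows "density_dist M (M ** B) = 0"
proof (rule density_dist_zero_of_asymp_fixed[OF M B(1)[OF M]])
  fix M :: "real ^ 'n ^ 'n" and \<epsilon>
  assume M: "det M \<noteq> 0" and le: "\<And>N. det N = det M / 2 \<Longrightarrow> density_dist N (N ** B) \<le> \<epsilon>"
  have "det B \<noteq> 0" using asymp_fixed_det[OF B(1)[of 1]] by auto
  then have nz: "det (M ** B) \<noteq> 0" "det (M ** \<kappa>) \<noteq> 0" "det (M ** \<kappa> ** B) \<noteq> 0"
    using M by (auto simp: det_mul det_\<kappa>)
  have "M ** \<kappa> ** B = M ** B ** \<kappa>" by (metis B(2) matrix_mul_assoc)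
  then have 3: "density_dist (M ** \<kappa> ** B) (M ** B) = 0" using density_dist_\<kappa>[OF nz(1)] by (simp add: density_dist_sym)
  have 2: "density_dist (M ** \<kappa>) (M ** \<kappa> ** B) \<le> \<epsilon>" by (rule le) (simp add: det_mul det_\<kappa>)
  show "density_dist M (M ** B) \<le> \<epsilon>"
    using density_dist_triangle[OF M nz(2,1)] density_dist_triangle[OF nz(2,3,1)] density_dist_\<kappa>[OF M] 2 3 by linarith
qed

lemma mean_density_shear:
  assumes "det M \<noteq> 0"
  shows "AE w in P. mean_density w M = mean_density w (M ** shear i j s)" "AE w in P. mean_density w M = mean_density w (M ** shear j i s)"
proof -
  show "AE w in P. mean_density w M = mean_density w (M ** shear i j s)"
    by (rule density_dist_zero_AE[OF assms _ density_dist_commuting[OF assms asymp_fixed_upper \<kappa>_commute(1)]])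
       (use assms ij in \<open>simp_all add: det_mul det_shear\<close>)
  show "AE w in P. mean_density w M = mean_density w (M ** shear j i s)"
    by (rule density_dist_zero_AE[OF assms _ density_dist_commuting[OF assms asymp_fixed_lower \<kappa>_commute(2)]])
       (use assms ij in \<open>simp_all add: det_mul det_shear\<close>)
qed

end

section \<open>Coordinate boxes\<close>

lemma null_matrix_image:
  fixes M :: "real ^ 'n ^ 'n"
  assumes "det M \<noteq> 0" "N \<in> null_sets lborel"
  shows "(*v) M ` N \<in> null_sets lborel"
proof -
  have N: "N \<in> sets borel" "negligible N"
    using assms(2) by (auto simp: negligible_iff_null_sets intro: null_sets_completionI)
  have "N \<in> lmeasurable" "measure lebesgue N = 0"
    using N(2) by (auto simp: negligible_imp_measurable negligible_imp_measure0)
  then have "(*v) M ` N \<in> lmeasurable" "measure lebesgue ((*v) M ` N) = 0"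
    using measure_matrix_image_lmeasurable[OF assms(1)] by auto
  then have "negligible ((*v) M ` N)"
    by (simp add: negligible_iff_measure)
  then show ?thesis
    using borel_matrix_image[OF assms(1) N(1)] by (simp add: negligible_iff_null_sets null_sets_completion_iff)
qed

context moment_invariant_plane begin

text \<open>
  Both sides express the mass of the stretched half cube, cut by the ray \<open>x\<^sub>i = p x\<^sub>j\<close>. The second piece is
  a sheared stretch; the shear can be moved to the right of the stretch, where it does not matter.
\<close>

lemma mean_density_stretch_add:
  assumes M: "det M \<noteq> 0" and pq: "0 < p" "0 < q"
  shows "AE w in P. (p + q) * mean_density w (M ** stretch i (p + q)) =
    p * mean_density w (M ** stretch i p) + q * mean_density w (M ** stretch i q)"
proof -
  have B: "M ** (shear i j p ** stretch i q) = M ** stretch i q ** shear i j (p / q)"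
    using stretch_shear_upper[OF ij, of q "p / q"] pq by (simp add: matrix_mul_assoc[symmetric])
  have "det (M ** stretch i q) \<noteq> 0" using M pq by (simp add: det_mul det_stretch)
  from mean_density_shear(1)[OF this, of "p / q"] AE_space show ?thesis
  proof eventually_elim
    case (elim w)
    have d: "det (M ** stretch i q ** shear i j (p / q)) = det M * q" "det (M ** stretch i p) = det M * p"
      "det (M ** stretch i (p + q)) = det M * (p + q)"
      using ij by (simp_all add: det_mul det_stretch det_shear)
    have mean_density: "(p + q) * mean_density w (M ** stretch i (p + q)) =
        measure (\<rho> w) ((*v) (M ** stretch i (p + q)) ` half_cube i j) / \<bar>det M\<bar>"
      "p * mean_density w (M ** stretch i p) = measure (\<rho> w) ((*v) (M ** stretch i p) ` half_cube i j) / \<bar>det M\<bar>"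
      "q * mean_density w (M ** stretch i q ** shear i j (p / q)) =
        measure (\<rho> w) ((*v) (M ** stretch i q ** shear i j (p / q)) ` half_cube i j) / \<bar>det M\<bar>"
      unfolding mean_density_def d abs_mult using pq by simp_all
    have "(p + q) * mean_density w (M ** stretch i (p + q)) =
        p * mean_density w (M ** stretch i p) + q * mean_density w (M ** stretch i q ** shear i j (p / q))"
      unfolding mean_density using \<rho>_split[OF elim(2) M pq] by (simp add: B add_divide_distrib)
    then show ?case using elim(1) by simp
  qed
qed

text \<open>
  The mass as a function of the stretching factor is additive, hence linear on the positive rationals.
\<close>

lemma mean_density_stretch_rational:
  assumes M: "det M \<noteq> 0" and p: "0 < p" "p \<in> \<rat>"
  shows "AE w in P. mean_density w (M ** stretch i p) = mean_density w M"
proof -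
  have mult: "AE w in P. mean_density w (M ** stretch i (Suc n * q)) = mean_density w (M ** stretch i q)" if q: "0 < q" for n :: nat and q :: real
  proof (induction n)
    case (Suc n)
    have "AE w in P. (Suc n * q + q) * mean_density w (M ** stretch i (Suc n * q + q)) =
      Suc n * q * mean_density w (M ** stretch i (Suc n * q)) + q * mean_density w (M ** stretch i q)"
      using q by (intro mean_density_stretch_add[OF M]) auto
    with Suc show ?case
    proof eventually_elim
      case (elim w)
      have e: "Suc n * q + q = Suc (Suc n) * q" by (simp add: algebra_simps)
      have "Suc (Suc n) * q * mean_density w (M ** stretch i (Suc (Suc n) * q)) = Suc (Suc n) * q * mean_density w (M ** stretch i q)"
        using elim(2) unfolding elim(1) e by (simp add: algebra_simps)
      then show ?case using q by (simp only: mult_cancel_left) auto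
    qed
  qed simp
  obtain m n :: nat where mn: "p = real (Suc m) / real (Suc n)"
  proof -
    obtain a b :: nat where ab: "b \<noteq> 0" "\<bar>p\<bar> = real a / real b"
      using p(2) by (rule Rats_abs_nat_div_natE)
    then have "a \<noteq> 0" using p(1) by (intro notI) simp
    with ab p(1) show ?thesis by (intro that[of "a - 1" "b - 1"]) auto
  qed
  have 1: "AE w in P. mean_density w (M ** stretch i (real (Suc n) * p)) = mean_density w (M ** stretch i p)"
    by (rule mult[OF p(1)])
  have 2: "AE w in P. mean_density w (M ** stretch i (real (Suc m) * 1)) = mean_density w (M ** stretch i 1)"
    by (rule mult) simp
  have "real (Suc n) * p = real (Suc m) * 1" by (simp add: mn)
  with 1 2 show ?thesis by (auto simp: stretch_1)
qed

lemma mean_density_reflect: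
  assumes M: "det M \<noteq> 0"
  shows "AE w in P. mean_density w (M ** stretch i (- 1)) = mean_density w M"
proof -
  let ?Z = "{x :: real ^ 'n. x $ i = 0}"
  let ?N = "(*v) M ` (?Z \<union> (*v) (shear i j (- 1)) ` ?Z)"
  have N: "?N \<in> null_sets lborel"
    using null_coordinate[of i 0] det_shear[OF ij] by (intro null_matrix_image[OF M] null_sets.Un null_matrix_image) auto
  have "sym_diff ((*v) (M ** stretch i (- 1)) ` half_cube i j) ((*v) (M ** shear i j (- 1)) ` half_cube i j) \<subseteq> ?N"
    using half_cube_reflect[OF ij] unfolding image_mult[of M] by blast
  then have "mean_density w (M ** stretch i (- 1)) = mean_density w (M ** shear i j (- 1))" if "w \<in> space P" for w
    using \<rho>_eq_mod_null[OF that _ _ _ _ _ N] M ij by (simp add: mean_density_def det_mul det_stretch det_shear)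
  with mean_density_shear(1)[OF M, of "- 1"] show ?thesis
    by (auto simp: AE_conj_iff elim!: AE_mp)
qed

text \<open>
  Up to a null set the cube consists of the half cube and of its image under a product of two shears, and shears do not
  change the mean density.
\<close>

lemma measure_cube:
  assumes M: "det M \<noteq> 0"
  shows "AE w in P. measure (\<rho> w) ((*v) M ` unit_cube) = 2 * \<bar>det M\<bar> * mean_density w M"
proof -
  let ?W = "shear i j 1 ** shear j i (- 1)"
  let ?Z = "{x :: real ^ 'n. x $ j = 0}"
  let ?A = "(*v) M ` half_cube i j" and ?B = "(*v) (M ** ?W) ` half_cube i j"
  have W: "det (M ** shear i j 1) = det M" "det (M ** ?W) = det M"
    using ij by (auto simp: det_mul det_shear)
  have "measure (\<rho> w) ((*v) M ` unit_cube) = \<bar>det M\<bar> * (mean_density w M + mean_density w (M ** ?W))" if w: "w \<in> space P" for w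
  proof -
    obtain M' where M': "M' ** M = mat 1"
      using det_inverse_obtain[OF M] by metis
    have "inj ((*v) M)"
      by (rule injI) (metis M' matrix_vector_mul_assoc matrix_vector_mul_lid)
    then have dis: "?A \<inter> ?B = {}"
      unfolding image_mult[of M ?W] using unit_cube_split(2)[OF ij]
      by (simp add: image_Int[symmetric])
    have N: "(*v) M ` ?Z \<in> null_sets lborel" using M null_coordinate by (rule null_matrix_image)
    have un: "(*v) M ` (unit_cube - ?Z) = ?A \<union> ?B"
      unfolding unit_cube_split(1)[OF ij] image_Un image_mult[of M ?W] ..
    have AB: "?A \<in> sets borel" "?B \<in> sets borel" "bounded ?A" "bounded ?B"
      using M W by auto
    have "measure (\<rho> w) ((*v) M ` unit_cube) = measure (\<rho> w) (?A \<union> ?B)"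
    proof (rule \<rho>_eq_mod_null[OF w _ _ _ _ _ N])
      show "sym_diff ((*v) M ` unit_cube) (?A \<union> ?B) \<subseteq> (*v) M ` ?Z"
        unfolding un[symmetric] by auto
    qed (use AB M bounded_unit_cube in \<open>auto intro!: borel_matrix_image bounded_matrix_image\<close>)
    also have "\<dots> = measure (\<rho> w) ?A + measure (\<rho> w) ?B"
      by (rule \<rho>_add[OF w AB dis])
    finally show ?thesis using M by (simp add: mean_density_def W field_simps)
  qed
  then have "AE w in P. measure (\<rho> w) ((*v) M ` unit_cube) = \<bar>det M\<bar> * (mean_density w M + mean_density w (M ** ?W))"
    by (rule AE_I2)
  moreover have "AE w in P. mean_density w M = mean_density w (M ** shear i j 1)" by (rule mean_density_shear(1)[OF M])
  moreover have "AE w in P. mean_density w (M ** shear i j 1) = mean_density w (M ** shear i j 1 ** shear j i (- 1))"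
    using M W by (intro mean_density_shear(2)) simp
  ultimately show ?thesis
    by eventually_elim (simp add: matrix_mul_assoc)
qed

text \<open>
  A negative factor is the composition of a positive one with a reflection.
\<close>

lemma measure_cube_stretch:
  assumes M: "det M \<noteq> 0" and p: "p \<noteq> 0" "p \<in> \<rat>"
  shows "AE w in P. measure (\<rho> w) ((*v) (M ** stretch i p) ` unit_cube) = \<bar>p\<bar> * measure (\<rho> w) ((*v) M ` unit_cube)"
proof -
  have Mp: "det (M ** stretch i p) = det M * p" "det (M ** stretch i p) \<noteq> 0"
    using M p by (simp_all add: det_mul det_stretch)
  have "AE w in P. mean_density w (M ** stretch i p) = mean_density w M"
  proof (cases "0 < p")
    case True
    then show ?thesis using p by (intro mean_density_stretch_rational[OF M])
  next
    case False
    then have "AE w in P. mean_density w (M ** stretch i (- p)) = mean_density w M"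
      using p by (intro mean_density_stretch_rational[OF M]) auto
    moreover have "AE w in P. mean_density w (M ** stretch i (- p) ** stretch i (- 1)) = mean_density w (M ** stretch i (- p))"
      using M p by (intro mean_density_reflect) (simp add: det_mul det_stretch)
    moreover have "M ** stretch i (- p) ** stretch i (- 1) = M ** stretch i p"
      by (simp add: matrix_mul_assoc[symmetric] stretch_mult)
    ultimately show ?thesis by auto
  qed
  with measure_cube[OF Mp(2)] measure_cube[OF M] show ?thesis
    by eventually_elim (simp add: Mp abs_mult)
qed

end

definition diagonal :: "('n::finite \<Rightarrow> real) \<Rightarrow> real ^ 'n ^ 'n" where
  "diagonal c = (\<chi> k l. if k = l then c k else 0)"

lemma diagonal_vec: "(diagonal c *v x) $ k = c k * x $ k"
proof -
  have "(diagonal c *v x) $ k = (\<Sum>l\<in>UNIV. if l = k then c k * x $ l else 0)"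
    unfolding diagonal_def matrix_vector_mult_def vec_lambda_beta by (rule sum.cong) auto
  then show ?thesis by simp
qed

lemma det_diagonal_prod: "det (diagonal c) = (\<Prod>k\<in>UNIV. c k)"
  by (subst det_diagonal) (auto simp: diagonal_def)

context moment_invariant begin

text \<open>
  The coordinates are stretched one after the other; each stretch uses the plane of its coordinate and any other one.
\<close>

lemma measure_box_rational:
  assumes card: "CARD('n) > 1" and c: "\<And>k. c k \<noteq> 0" "\<And>k. c k \<in> \<rat>"
  shows "AE w in P. measure (\<rho> w) ((*v) (diagonal c) ` unit_cube) = (\<Prod>k\<in>UNIV. \<bar>c k\<bar>) * measure (\<rho> w) unit_cube"
proof -
  have "AE w in P. measure (\<rho> w) ((*v) (diagonal (\<lambda>k. if k \<in> S then c k else 1)) ` unit_cube) =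
      (\<Prod>k\<in>S. \<bar>c k\<bar>) * measure (\<rho> w) unit_cube" (is "AE w in P. ?Q S w") if "finite S" for S
    using that
  proof induction
    case empty
    have "diagonal (\<lambda>k. 1) = (mat 1 :: real ^ 'n ^ 'n)" by (rule matrix_eqI) (simp add: diagonal_vec)
    then show ?case by simp
  next
    case (insert i S)
    obtain j where ij: "i \<noteq> j"
    proof -
      have "UNIV \<noteq> {i}" using card by (metis card.empty card_insert_disjoint empty_iff finite.emptyI less_not_refl One_nat_def)
      then obtain j where "j \<noteq> i" by blast
      then show ?thesis using that[of j] by simp
    qed
    interpret moment_invariant_plane P \<rho> t i j by unfold_locales (rule ij)
    let ?D = "diagonal (\<lambda>k. if k \<in> S then c k else 1)"
    have "diagonal (\<lambda>k. if k \<in> insert i S then c k else 1) = ?D ** stretch i (c i)"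
      using insert.hyps by (intro matrix_eqI) (auto simp: diagonal_vec stretch_vec matrix_vector_mul_assoc[symmetric])
    moreover have "det ?D \<noteq> 0" using c by (simp add: det_diagonal_prod)
    ultimately have "AE w in P. measure (\<rho> w) ((*v) (diagonal (\<lambda>k. if k \<in> insert i S then c k else 1)) ` unit_cube) =
        \<bar>c i\<bar> * measure (\<rho> w) ((*v) ?D ` unit_cube)"
      using measure_cube_stretch[of ?D "c i"] c by simp
    with insert.IH show ?case
      by eventually_elim (use insert.hyps in simp)
  qed
  from this[of UNIV] show ?thesis by simp
qed

end

section \<open>Measures determined by coordinate boxes\<close>

lemma diagonal_cube:
  "(\<And>k. c k \<noteq> 0) \<Longrightarrow> (*v) (diagonal c) ` unit_cube = {x. \<forall>k. 0 \<le> x $ k / c k \<and> x $ k / c k < 1}"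
  by (subst matrix_image_eq[where h = "diagonal (\<lambda>k. 1 / c k)"])
     (auto simp: vec_eq_iff diagonal_vec unit_cube_def)

lemma of_rat_max: "(of_rat (max a b) :: real) = max (of_rat a) (of_rat b)"
  and of_rat_min: "(of_rat (min a b) :: real) = min (of_rat a) (of_rat b)"
  by (simp_all add: max_def min_def of_rat_less_eq)

lemma sigma_sets_rational_boxes:
  "sigma_sets UNIV (range (\<lambda>(l, u). box (\<chi> k. of_rat (l k)) (\<chi> k. of_rat (u k)))) = sets (borel :: (real ^ 'n) measure)"
  (is "sigma_sets UNIV (range ?b) = _")
proof
  show "sigma_sets UNIV (range ?b) \<subseteq> sets borel"
    by (subst sets.sigma_sets_subset[of _ "borel :: (real ^ 'n) measure", simplified]) auto
  have "U \<in> sigma_sets UNIV (range ?b)" if U: "open U" for U :: "(real ^ 'n) set"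
  proof -
    have "U = (\<Union>lu\<in>{lu. ?b lu \<subseteq> U}. ?b lu)"
    proof (intro equalityI subsetI)
      fix x assume "x \<in> U"
      then obtain e where e: "0 < e" "ball x e \<subseteq> U" using U openE by blast
      obtain a b where ab: "\<forall>i\<in>Basis. a \<bullet> i \<in> \<rat> \<and> b \<bullet> i \<in> \<rat>" "x \<in> box a b" "box a b \<subseteq> ball x e"
        using rational_boxes[OF e(1), of x] by auto
      have "\<forall>k. \<exists>q. a $ k = of_rat q" "\<forall>k. \<exists>q. b $ k = of_rat q"
        using ab(1) by (auto simp: Basis_vec_def inner_axis Rats_def)
      then obtain l u where "\<And>k. a $ k = of_rat (l k)" "\<And>k. b $ k = of_rat (u k)"
        by metis
      then have "a = (\<chi> k. of_rat (l k))" "b = (\<chi> k. of_rat (u k))" by (auto simp: vec_eq_iff)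
      with ab e show "x \<in> (\<Union>lu\<in>{lu. ?b lu \<subseteq> U}. ?b lu)"
        by (intro UN_I[of "(l, u)"]) auto
    qed auto
    moreover have "(\<Union>lu\<in>{lu. ?b lu \<subseteq> U}. ?b lu) \<in> sigma_sets UNIV (range ?b)"
      by (rule sigma_sets_UNION) (auto intro: countable_image[of "{lu. ?b lu \<subseteq> U}"])
    ultimately show ?thesis by simp
  qed
  then show "sets borel \<subseteq> sigma_sets UNIV (range ?b)"
    unfolding borel_def by (subst sets_measure_of) (auto intro!: sigma_sets_mono)
qed

text \<open>
  Boxes with a vertex at the origin do not form an intersection stable family, because boxes in different
  orthants meet in null sets. The proportionality is therefore extended to all rational boxes, one
  coordinate at a time, by writing an interval as a sum or a difference of intervals with one end point zero.
  All identities hold up to hyperplanes parallel to the coordinate hyperplanes, which \<open>\<nu>\<close> does not charge.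
\<close>

lemma measure_eq_scale_lborel:
  fixes \<nu> :: "(real ^ 'n) measure"
  assumes sets: "sets \<nu> = sets borel"
    and le: "\<And>E. E \<in> sets borel \<Longrightarrow> emeasure \<nu> E \<le> ennreal t * emeasure lborel E"
    and cubes: "\<And>c :: 'n \<Rightarrow> rat. (\<And>k. c k \<noteq> 0) \<Longrightarrow>
      measure \<nu> ((*v) (diagonal (\<lambda>k. of_rat (c k))) ` unit_cube) = (\<Prod>k\<in>UNIV. \<bar>of_rat (c k)\<bar>) * a"
    and a: "0 \<le> a"
  shows "\<nu> = scale_measure (ennreal a) lborel"
proof -
  define Bx :: "('n \<Rightarrow> rat) \<Rightarrow> ('n \<Rightarrow> rat) \<Rightarrow> (real ^ 'n) set"
    where "Bx l u = box (\<chi> k. of_rat (l k)) (\<chi> k. of_rat (u k))" for l u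
  have Bx: "x \<in> Bx l u \<longleftrightarrow> (\<forall>k. of_rat (l k) < x $ k \<and> x $ k < of_rat (u k))" for x l u
    by (simp add: Bx_def mem_box_cart)
  have [measurable]: "Bx l u \<in> sets borel" for l u by (simp add: Bx_def)
  have fin: "emeasure \<nu> E < \<infinity>" if "E \<in> sets borel" "bounded E" for E
    using le[OF that(1)] emeasure_bounded_finite[OF that(2)]
    by (metis ennreal_less_top ennreal_mult_less_top infinity_ennreal_def order_le_less_trans)
  have null: "N \<in> null_sets \<nu>" if "N \<in> null_sets lborel" for N
    using le[of N] that sets by (auto simp: null_sets_def)
  have plane: "{x. x $ k = c} \<in> null_sets \<nu>" for k c by (intro null null_coordinate)
  have mod: "measure \<nu> A = measure \<nu> B" if "A \<in> sets borel" "B \<in> sets borel" "sym_diff A B \<subseteq> N" "N \<in> null_sets \<nu>" for A B N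
  proof -
    have "AE x in \<nu>. x \<in> A \<longleftrightarrow> x \<in> B"
      using that(3) by (intro AE_I'[OF that(4)]) auto
    then have "emeasure \<nu> A = emeasure \<nu> B"
      using that sets by (intro emeasure_eq_AE) auto
    then show ?thesis by (simp add: measure_def)
  qed
  have Bx_upd: "x \<in> Bx (l(i := y)) (u(i := z)) \<longleftrightarrow> of_rat y < x $ i \<and> x $ i < of_rat z \<and>
      (\<forall>k. k \<noteq> i \<longrightarrow> of_rat (l k) < x $ k \<and> x $ k < of_rat (u k))" for x l u i y z
    unfolding Bx by (metis fun_upd_apply)
  have split: "measure \<nu> (Bx (l(i := x)) (u(i := y))) =
      measure \<nu> (Bx (l(i := x)) (u(i := z))) + measure \<nu> (Bx (l(i := z)) (u(i := y)))"
    if "x \<le> z" "z \<le> y" for l u i x y z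
  proof -
    let ?L = "Bx (l(i := x)) (u(i := z))" and ?R = "Bx (l(i := z)) (u(i := y))"
    have xyz: "(of_rat x :: real) \<le> of_rat z" "(of_rat z :: real) \<le> of_rat y"
      using that by (simp_all add: of_rat_less_eq)
    have "measure \<nu> (Bx (l(i := x)) (u(i := y))) = measure \<nu> (?L \<union> ?R)"
    proof (rule mod[OF _ _ _ plane[of i "of_rat z"]])
      show "sym_diff (Bx (l(i := x)) (u(i := y))) (?L \<union> ?R) \<subseteq> {x. x $ i = of_rat z}"
      proof
        fix v assume "v \<in> sym_diff (Bx (l(i := x)) (u(i := y))) (?L \<union> ?R)"
        then have "\<not> v $ i < of_rat z" "\<not> of_rat z < v $ i"
          unfolding Un_iff Diff_iff Bx_upd using xyz by auto
        then show "v \<in> {x. x $ i = of_rat z}" by simp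
      qed
    qed auto
    also have "\<dots> = measure \<nu> ?L + measure \<nu> ?R"
    proof (rule measure_Union)
      show "?L \<inter> ?R = {}" by (auto simp: Bx_upd)
      have "emeasure \<nu> (Bx l u) < \<infinity>" for l u
        using fin[of "Bx l u"] by (simp add: Bx_def)
      then show "emeasure \<nu> ?L \<noteq> \<infinity>" "emeasure \<nu> ?R \<noteq> \<infinity>" by (metis less_irrefl)+
    qed (use sets in auto)
    finally show ?thesis .
  qed
  have boxes: "measure \<nu> (Bx l u) = a * (\<Prod>k\<in>UNIV. of_rat (u k - l k))"
    if "\<And>k. l k < u k" "\<And>k. k \<notin> S \<Longrightarrow> l k = 0 \<or> u k = 0" "finite S" for l u S
    using that(3,1,2)
  proof (induction arbitrary: l u)
    case empty
    \<comment> \<open>The end point of the interval that is not zero; its sign tells on which side of the origin the interval lies.\<close>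
    define c where "c k = (if l k = 0 then u k else l k)" for k
    have c0: "c k \<noteq> 0" for k using empty(1)[of k] by (auto simp: c_def)
    have lu: "(l k = 0 \<and> u k = c k \<and> 0 < c k) \<or> (u k = 0 \<and> l k = c k \<and> c k < 0)" for k
      using empty(1)[of k] empty(2)[of k] by (auto simp: c_def)
    let ?C = "{x. \<forall>k. 0 \<le> x $ k / of_rat (c k) \<and> x $ k / of_rat (c k) < (1::real)}"
    have C: "?C = (*v) (diagonal (\<lambda>k. of_rat (c k))) ` unit_cube"
      using c0 by (subst diagonal_cube) auto
    have iff: "of_rat (l k) < y \<and> y < of_rat (u k) \<longleftrightarrow> 0 < y / of_rat (c k) \<and> y / of_rat (c k) < 1" for k and y :: real
      using lu[of k] by (auto simp: zero_less_divide_iff divide_less_eq)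
    have "measure \<nu> (Bx l u) = measure \<nu> ?C"
    proof (rule mod)
      show "(\<Union>k. {x. x $ k = 0}) \<in> null_sets \<nu>" by (intro null_sets_UN plane)
      show "sym_diff (Bx l u) ?C \<subseteq> (\<Union>k. {x. x $ k = 0})"
      proof
        fix v assume v: "v \<in> sym_diff (Bx l u) ?C"
        have Bxc: "w \<in> Bx l u \<longleftrightarrow> (\<forall>k. 0 < w $ k / of_rat (c k) \<and> w $ k / of_rat (c k) < 1)" for w
          unfolding Bx iff ..
        then have "v \<in> ?C" "v \<notin> Bx l u" using v by (auto simp only: Un_iff Diff_iff mem_Collect_eq intro: less_imp_le)
        then obtain k where "v $ k / of_rat (c k) = 0"
          unfolding Bxc mem_Collect_eq by (metis order_le_less)
        then show "v \<in> (\<Union>k. {x. x $ k = 0})" using c0[of k] by auto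
      qed
      show "?C \<in> sets borel"
        unfolding C using c0 by (intro borel_matrix_image) (auto simp: det_diagonal_prod)
    qed simp
    also have "\<dots> = (\<Prod>k\<in>UNIV. \<bar>of_rat (c k)\<bar>) * a" unfolding C using c0 by (rule cubes)
    also have "(\<Prod>k\<in>UNIV. \<bar>of_rat (c k) :: real\<bar>) = (\<Prod>k\<in>UNIV. of_rat (u k - l k))"
    proof (rule prod.cong[OF refl])
      show "\<bar>of_rat (c k) :: real\<bar> = of_rat (u k - l k)" for k
        using lu[of k] by (auto simp: of_rat_minus)
    qed
    finally show ?case by simp
  next
    case (insert i S)
    let ?W = "\<Prod>k\<in>UNIV - {i}. of_rat (u k - l k) :: real"
    have W: "(\<Prod>k\<in>UNIV. of_rat ((u(i := y)) k - (l(i := x)) k)) = of_rat (y - x) * ?W" for x y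
      by (subst prod.remove[of _ i]) (auto intro!: prod.cong)
    have IH: "measure \<nu> (Bx (l(i := x)) (u(i := y))) = a * (of_rat (y - x) * ?W)" if "x < y" "x = 0 \<or> y = 0" for x y
      unfolding W[symmetric] by (rule insert.IH) (use insert.prems insert.hyps that in auto)
    note sp = split[of _ _ _ l i u]
    let ?x = "l i" and ?y = "u i"
    have xy: "?x < ?y" by (rule insert.prems)
    consider "?x = 0 \<or> ?y = 0" | "0 < ?x" | "?y < 0" | "?x < 0" "0 < ?y" by linarith
    then have "measure \<nu> (Bx (l(i := ?x)) (u(i := ?y))) = a * (of_rat (?y - ?x) * ?W)"
    proof cases
      case 1
      then show ?thesis by (rule IH[OF xy])
    next
      case 2
      then show ?thesis
        using sp[of 0 ?x ?y] xy IH[of 0 ?y] IH[of 0 ?x] by (simp add: of_rat_diff algebra_simps)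
    next
      case 3
      then show ?thesis
        using sp[of ?x ?y 0] xy IH[of ?x 0] IH[of ?y 0] by (simp add: of_rat_diff of_rat_minus algebra_simps)
    next
      case 4
      then show ?thesis
        using sp[of ?x 0 ?y] xy IH[of ?x 0] IH[of 0 ?y] by (simp add: of_rat_diff of_rat_minus algebra_simps)
    qed
    then show ?case using W[of ?y ?x] by simp
  qed
  show ?thesis
  proof (rule measure_eqI_generator_eq[where \<Omega> = UNIV and E = "range (\<lambda>(l, u). Bx l u)" and A = "\<lambda>n. Bx (\<lambda>_. - of_nat n) (\<lambda>_. of_nat n)"])
    show "Int_stable (range (\<lambda>(l, u). Bx l u))"
    proof (rule Int_stableI)
      fix A B assume "A \<in> range (\<lambda>(l, u). Bx l u)" "B \<in> range (\<lambda>(l, u). Bx l u)"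
      then obtain l u l' u' where AB: "A = Bx l u" "B = Bx l' u'" by auto
      have "A \<inter> B = Bx (\<lambda>k. max (l k) (l' k)) (\<lambda>k. min (u k) (u' k))"
        unfolding AB set_eq_iff Int_iff Bx of_rat_max of_rat_min max_less_iff_conj min_less_iff_conj
        by blast
      then show "A \<inter> B \<in> range (\<lambda>(l, u). Bx l u)" by auto
    qed
    show "sets \<nu> = sigma_sets UNIV (range (\<lambda>(l, u). Bx l u))"
      "sets (scale_measure (ennreal a) lborel) = sigma_sets UNIV (range (\<lambda>(l, u). Bx l u))"
      using sigma_sets_rational_boxes[where 'n = 'n] sets by (simp_all only: Bx_def sets_scale_measure sets_lborel)
    show "(\<Union>n. Bx (\<lambda>_. - of_nat n) (\<lambda>_. of_nat n)) = UNIV"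
    proof -
      have "\<exists>n. x \<in> Bx (\<lambda>_. - of_nat n) (\<lambda>_. of_nat n)" for x
      proof -
        obtain n where "norm x < real n" using reals_Archimedean2 by blast
        then have "- real n < x $ k \<and> x $ k < real n" for k
          using component_le_norm_cart[of x k] by linarith
        then show ?thesis by (intro exI[of _ n]) (simp add: Bx of_rat_minus)
      qed
      then show ?thesis by blast
    qed
    show "emeasure \<nu> X = emeasure (scale_measure (ennreal a) lborel) X" if X_in: "X \<in> range (\<lambda>(l, u). Bx l u)" for X
    proof -
      obtain l u where X: "X = Bx l u" using X_in by auto
      show ?thesis
      proof (cases "\<forall>k. l k < u k")
        case True
        have "emeasure \<nu> X = ennreal (a * (\<Prod>k\<in>UNIV. of_rat (u k - l k)))"
          using boxes[of l u UNIV] True fin[of X] X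
          by (simp add: emeasure_eq_ennreal_measure Bx_def less_top)
        moreover have "emeasure lborel X = ennreal (\<Prod>k\<in>UNIV. of_rat (u k - l k))"
        proof -
          let ?a = "(\<chi> k. of_rat (l k)) :: real ^ 'n" and ?b = "(\<chi> k. of_rat (u k)) :: real ^ 'n"
          have "cbox ?a ?b \<noteq> {}"
            using True by (auto simp: interval_ne_empty_cart of_rat_less_eq less_imp_le)
          then have "measure lborel (cbox ?a ?b) = (\<Prod>k\<in>UNIV. of_rat (u k - l k))"
            by (simp add: content_cbox_cart of_rat_diff)
          moreover have "emeasure lborel X = emeasure lborel (cbox ?a ?b)"
            unfolding X Bx_def emeasure_lborel_box_eq emeasure_lborel_cbox_eq ..
          ultimately show ?thesis
            using emeasure_bounded_finite[of "cbox ?a ?b"] by (simp add: emeasure_eq_ennreal_measure less_top)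
        qed
        ultimately show ?thesis using a by (simp add: ennreal_mult')
      next
        case False
        then have "X = {}"
          unfolding X set_eq_iff Bx by (metis empty_iff less_trans of_rat_less)
        then show ?thesis by simp
      qed
    qed
    show "emeasure \<nu> (Bx (\<lambda>_. - of_nat n) (\<lambda>_. of_nat n)) \<noteq> \<infinity>" for n
      using fin[of "Bx (\<lambda>_. - of_nat n) (\<lambda>_. of_nat n)"] by (simp add: Bx_def)
  qed auto
qed

text \<open>
  There are only countably many rational boxes, so almost surely all of them have mass proportional
  to their volume.
\<close>

theorem (in moment_invariant) AE_scale_lborel:
  assumes "CARD('n) > 1"
  shows "AE w in P. \<rho> w = scale_measure (ennreal (measure (\<rho> w) unit_cube)) lborel"
proof -
  have "AE w in P. \<forall>c :: 'n \<Rightarrow> rat. (\<forall>k. c k \<noteq> 0) \<longrightarrow>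
      measure (\<rho> w) ((*v) (diagonal (\<lambda>k. of_rat (c k))) ` unit_cube) =
        (\<Prod>k\<in>UNIV. \<bar>of_rat (c k)\<bar>) * measure (\<rho> w) unit_cube"
    unfolding AE_all_countable
    using measure_box_rational[OF assms, of "\<lambda>k. of_rat (_ k)"] by (intro allI AE_impI) auto
  with AE_space show ?thesis
  proof eventually_elim
    case (elim w)
    show ?case
      by (rule measure_eq_scale_lborel[OF sets_\<rho>[OF elim(1)] \<rho>_le[OF elim(1)]]) (use elim(2) in auto)
  qed
qed

section \<open>The Lebesgue decomposition and the minimum of a measure with a multiple of Lebesgue measure\<close>

lemma sigma_finite_density_bounded:
  fixes \<nu> :: "(real ^ 'n) measure"
  assumes "\<nu> \<in> density_bounded_measures"
  shows "sigma_finite_measure \<nu>"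
proof
  have s: "sets \<nu> = sets borel" using assms by (simp add: density_bounded_measures_iff)
  obtain C where C: "\<And>R. R > 0 \<Longrightarrow> emeasure \<nu> (ball 0 R) \<le> ennreal (C * R ^ CARD('n))"
    using assms by (auto simp: density_bounded_measures_iff)
  show "\<exists>A. countable A \<and> A \<subseteq> sets \<nu> \<and> \<Union> A = space \<nu> \<and> (\<forall>a\<in>A. emeasure \<nu> a \<noteq> \<infinity>)"
  proof (intro exI[of _ "range (\<lambda>n. ball 0 (real (Suc n)))"] conjI ballI)
    have "\<exists>n. norm x < real (Suc n)" for x :: "real ^ 'n"
      using reals_Archimedean2[of "norm x"] by (metis less_trans of_nat_less_iff lessI)
    then show "\<Union> (range (\<lambda>n. ball 0 (real (Suc n)))) = space \<nu>"
      using sets_eq_imp_space_eq[OF s] by auto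
    show "emeasure \<nu> a \<noteq> \<infinity>" if a: "a \<in> range (\<lambda>n. ball 0 (real (Suc n)))" for a
    proof -
      obtain n where "a = ball 0 (real (Suc n))" using a by blast
      then have "emeasure \<nu> a \<le> ennreal (C * real (Suc n) ^ CARD('n))" using C by simp
      then show ?thesis by (simp add: neq_top_trans[OF ennreal_neq_top])
    qed
  qed (auto simp: s)
qed

lemma emeasure_bounded_density_bounded:
  fixes \<nu> :: "(real ^ 'n) measure"
  assumes "\<nu> \<in> density_bounded_measures" "bounded E"
  shows "emeasure \<nu> E < \<infinity>"
proof -
  obtain C where C: "\<And>R. R > 0 \<Longrightarrow> emeasure \<nu> (ball 0 R) \<le> ennreal (C * R ^ CARD('n))"
    using assms by (auto simp: density_bounded_measures_iff)
  obtain R where R: "0 < R" "E \<subseteq> ball 0 R"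
    using bounded_subset_ballD[OF assms(2), of 0] by auto
  have "emeasure \<nu> E \<le> emeasure \<nu> (ball 0 R)"
    using R assms by (intro emeasure_mono) (auto simp: density_bounded_measures_iff)
  also have "\<dots> \<le> ennreal (C * R ^ CARD('n))" by (rule C[OF R(1)])
  finally show ?thesis by (simp add: le_less_trans[OF _ ennreal_less_top])
qed

text \<open>
  Lebesgue measure has a density \<open>h\<close> with respect to the sum of \<open>\<nu>\<close> and Lebesgue measure. The set where \<open>h\<close>
  vanishes is Lebesgue null and carries the singular part, and off this set \<open>\<nu>\<close> is absolutely continuous.
\<close>

lemma lebesgue_decomposition:
  fixes \<nu> :: "(real ^ 'n) measure"
  assumes "\<nu> \<in> density_bounded_measures"
  shows "\<exists>f N. f \<in> borel_measurable borel \<and> N \<in> null_sets lborel \<and>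
    (\<forall>E\<in>sets borel. emeasure \<nu> E = emeasure \<nu> (E \<inter> N) + (\<integral>\<^sup>+x. f x * indicator E x \<partial>lborel))"
proof -
  have s: "sets \<nu> = sets borel" using assms by (simp add: density_bounded_measures_iff)
  let ?l = "add_lebesgue 1 \<nu>"
  have l: "emeasure ?l E = emeasure \<nu> E + emeasure lborel E" if "E \<in> sets borel" for E
    using emeasure_add_lebesgue[OF s that, of 1] by simp
  interpret l: sigma_finite_measure ?l
    using assms by (intro sigma_finite_density_bounded add_lebesgue_in_density_bounded_measures) auto
  have "absolutely_continuous ?l lborel"
    unfolding absolutely_continuous_def null_sets_def using l by auto
  then obtain h where h: "h \<in> borel_measurable ?l" "density ?l h = lborel"
    using l.Radon_Nikodym[of lborel] by auto
  have hb [measurable]: "h \<in> borel_measurable borel"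
    using h(1) by (simp add: measurable_cong_sets[OF sets_add_lebesgue refl])
  define N where "N = {x. h x = 0}"
  have Nb [measurable]: "N \<in> sets borel" unfolding N_def by measurable
  have m: "emeasure lborel E = (\<integral>\<^sup>+x. h x * indicator E x \<partial>?l)" if "E \<in> sets borel" for E
    using emeasure_density[OF h(1), of E] that by (simp add: h(2))
  have "emeasure lborel N = (\<integral>\<^sup>+x. 0 \<partial>?l)"
    unfolding m[OF Nb] by (intro nn_integral_cong) (auto simp: N_def indicator_def)
  then have N: "N \<in> null_sets lborel" by (simp add: null_setsI)
  let ?n = "density \<nu> (indicator (- N))"
  have n: "emeasure ?n E = emeasure \<nu> (E - N)" if "E \<in> sets borel" for E :: "(real ^ 'n) set"
  proof -
    have "emeasure ?n E = (\<integral>\<^sup>+x. indicator (- N) x * indicator E x \<partial>\<nu>)"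
      using that s by (intro emeasure_density) (auto simp: measurable_cong_sets[OF s refl])
    also have "\<dots> = (\<integral>\<^sup>+x. indicator (E - N) x \<partial>\<nu>)"
      by (intro nn_integral_cong) (auto simp: indicator_def)
    finally show ?thesis using that s by simp
  qed
  have "absolutely_continuous lborel ?n"
    unfolding absolutely_continuous_def
  proof
    fix E :: "(real ^ 'n) set" assume "E \<in> null_sets lborel"
    then have E: "E \<in> sets borel" "emeasure lborel E = 0" by auto
    have "AE x in ?l. h x * indicator E x = 0"
      using m[OF E(1)] E hb
      by (subst nn_integral_0_iff_AE[symmetric]) (auto simp: measurable_cong_sets[OF sets_add_lebesgue refl])
    then have "AE x in ?l. x \<notin> E - N"
      by eventually_elim (auto simp: N_def indicator_def)
    then have "emeasure ?l (E - N) = 0"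
      using E(1) by (subst (asm) AE_iff_measurable[of "E - N"]) (auto simp: sets_eq_imp_space_eq[OF sets_add_lebesgue])
    then have "emeasure \<nu> (E - N) = 0" using l[of "E - N"] E(1) by simp
    then show "E \<in> null_sets ?n"
      using E(1) n[OF E(1)] s by (auto simp: null_sets_def)
  qed
  moreover have "sets ?n = sets lborel" using s by simp
  ultimately obtain f where f: "f \<in> borel_measurable borel" "density lborel f = ?n"
    using sigma_finite_measure.Radon_Nikodym[OF sigma_finite_lborel, of ?n] by auto
  have "emeasure \<nu> E = emeasure \<nu> (E \<inter> N) + (\<integral>\<^sup>+x. f x * indicator E x \<partial>lborel)" if E: "E \<in> sets borel" for E :: "(real ^ 'n) set"
  proof -
    have "emeasure \<nu> E = emeasure \<nu> (E \<inter> N) + emeasure \<nu> (E - N)"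
      using E s by (subst plus_emeasure) (auto simp: Int_Diff_Un Int_commute intro: arg_cong[where f = "emeasure \<nu>"])
    then show ?thesis using emeasure_density[of f lborel E] f E n[OF E] by simp
  qed
  then show ?thesis using f(1) N by blast
qed

text \<open>
  The minimum of \<open>\<nu>\<close> and \<open>t\<close> times Lebesgue measure in the lattice of measures, evaluated on \<open>E\<close>.
\<close>

definition meet_lebesgue :: "real \<Rightarrow> (real ^ 'n) measure \<Rightarrow> (real ^ 'n) set \<Rightarrow> ennreal" where
  "meet_lebesgue t \<nu> E = (INF A\<in>sets borel. emeasure \<nu> (E \<inter> A) + ennreal t * emeasure lborel (E - A))"

text \<open>
  The infimum is attained where the set \<open>A\<close> consists of the points off the singular part at which the density is at
  most \<open>t\<close>.
\<close>

lemma meet_lebesgue_eq_integral: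
  fixes \<nu> :: "(real ^ 'n) measure"
  assumes f [measurable]: "f \<in> borel_measurable borel" and N: "N \<in> null_sets lborel"
    and \<nu>: "\<And>E. E \<in> sets borel \<Longrightarrow> emeasure \<nu> E = emeasure \<nu> (E \<inter> N) + (\<integral>\<^sup>+x. f x * indicator E x \<partial>lborel)"
    and E [measurable]: "E \<in> sets borel"
  shows "meet_lebesgue t \<nu> E = (\<integral>\<^sup>+x. min (f x) (ennreal t) * indicator E x \<partial>lborel)"
proof (rule antisym)
  have [measurable]: "N \<in> sets borel" using N by auto
  have leb: "ennreal t * emeasure lborel (E - A) = (\<integral>\<^sup>+x. ennreal t * indicator (E - A) x \<partial>lborel)"
    if [measurable]: "A \<in> sets borel" for A
    by (subst nn_integral_cmult_indicator) auto
  define A where "A = {x. f x \<le> ennreal t} - N"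
  have A [measurable]: "A \<in> sets borel" unfolding A_def by measurable
  have "meet_lebesgue t \<nu> E \<le> emeasure \<nu> (E \<inter> A) + ennreal t * emeasure lborel (E - A)"
    unfolding meet_lebesgue_def by (rule INF_lower[OF A])
  also have "emeasure \<nu> (E \<inter> A) = (\<integral>\<^sup>+x. f x * indicator (E \<inter> A) x \<partial>lborel)"
  proof -
    have "E \<inter> A \<inter> N = {}" by (auto simp: A_def)
    then show ?thesis using \<nu>[of "E \<inter> A"] by simp
  qed
  also have "\<dots> + ennreal t * emeasure lborel (E - A) =
      (\<integral>\<^sup>+x. f x * indicator (E \<inter> A) x + ennreal t * indicator (E - A) x \<partial>lborel)"
    unfolding leb[OF A] by (subst nn_integral_add) auto
  also have "\<dots> = (\<integral>\<^sup>+x. min (f x) (ennreal t) * indicator E x \<partial>lborel)"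
    using AE_not_in[OF N]
    by (intro nn_integral_cong_AE, eventually_elim) (auto simp: A_def indicator_def min_def)
  finally show "meet_lebesgue t \<nu> E \<le> (\<integral>\<^sup>+x. min (f x) (ennreal t) * indicator E x \<partial>lborel)" .
  show "(\<integral>\<^sup>+x. min (f x) (ennreal t) * indicator E x \<partial>lborel) \<le> meet_lebesgue t \<nu> E"
    unfolding meet_lebesgue_def
  proof (rule INF_greatest)
    fix A :: "(real ^ 'n) set" assume A [measurable]: "A \<in> sets borel"
    have "(\<integral>\<^sup>+x. min (f x) (ennreal t) * indicator E x \<partial>lborel) \<le>
        (\<integral>\<^sup>+x. f x * indicator (E \<inter> A) x + ennreal t * indicator (E - A) x \<partial>lborel)"
      by (intro nn_integral_mono) (auto simp: indicator_def)
    also have "\<dots> = (\<integral>\<^sup>+x. f x * indicator (E \<inter> A) x \<partial>lborel) + ennreal t * emeasure lborel (E - A)"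
      unfolding leb[OF A] by (subst nn_integral_add) auto
    also have "(\<integral>\<^sup>+x. f x * indicator (E \<inter> A) x \<partial>lborel) \<le> emeasure \<nu> (E \<inter> A)"
      using \<nu>[of "E \<inter> A"] by simp
    finally show "(\<integral>\<^sup>+x. min (f x) (ennreal t) * indicator E x \<partial>lborel) \<le>
        emeasure \<nu> (E \<inter> A) + ennreal t * emeasure lborel (E - A)"
      by (simp add: add_right_mono)
  qed
qed

definition ac_density :: "(real ^ 'n) measure \<Rightarrow> real ^ 'n \<Rightarrow> ennreal" where
  "ac_density \<nu> = (SOME f. f \<in> borel_measurable borel \<and> (\<exists>N\<in>null_sets lborel.
    \<forall>E\<in>sets borel. emeasure \<nu> E = emeasure \<nu> (E \<inter> N) + (\<integral>\<^sup>+x. f x * indicator E x \<partial>lborel)))"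

lemma ac_density:
  assumes "\<nu> \<in> density_bounded_measures"
  shows "ac_density \<nu> \<in> borel_measurable borel"
    and "\<exists>N\<in>null_sets lborel. \<forall>E\<in>sets borel.
      emeasure \<nu> E = emeasure \<nu> (E \<inter> N) + (\<integral>\<^sup>+x. ac_density \<nu> x * indicator E x \<partial>lborel)"
  using someI_ex[of "\<lambda>f. f \<in> borel_measurable borel \<and> (\<exists>N\<in>null_sets lborel.
    \<forall>E\<in>sets borel. emeasure \<nu> E = emeasure \<nu> (E \<inter> N) + (\<integral>\<^sup>+x. f x * indicator E x \<partial>lborel))"]
    lebesgue_decomposition[OF assms]
  unfolding ac_density_def by blast+

text \<open>
  The measure with values \<open>meet_lebesgue t \<nu>\<close>, written with a density so that countable additivity is
  immediate.
\<close>

definition meet_measure :: "real \<Rightarrow> (real ^ 'n) measure \<Rightarrow> (real ^ 'n) measure" where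
  "meet_measure t \<nu> = density lborel (\<lambda>x. min (ac_density \<nu> x) (ennreal t))"

lemma sets_meet_measure [simp]: "sets (meet_measure t \<nu>) = sets borel"
  by (simp add: meet_measure_def)

lemma emeasure_meet_measure:
  assumes "\<nu> \<in> density_bounded_measures" "E \<in> sets borel"
  shows "emeasure (meet_measure t \<nu>) E = meet_lebesgue t \<nu> E"
proof -
  have [measurable]: "ac_density \<nu> \<in> borel_measurable borel" using ac_density(1)[OF assms(1)] .
  show ?thesis
    using meet_lebesgue_eq_integral[OF ac_density(1)[OF assms(1)]] ac_density(2)[OF assms(1)] assms(2)
    unfolding meet_measure_def by (subst emeasure_density) auto
qed

lemma meet_lebesgue_le: "E \<in> sets borel \<Longrightarrow> meet_lebesgue t \<nu> E \<le> ennreal t * emeasure lborel E"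
  unfolding meet_lebesgue_def by (rule INF_lower2[of "{}"]) auto

section \<open>Measurability and equivariance\<close>

lemma measurable_integral_Cc:
  assumes "f \<in> Cc"
  shows "(\<lambda>\<nu>. integral\<^sup>L \<nu> f) \<in> borel_measurable (weak_star_borel :: (real ^ 'n) measure measure)"
proof (rule borel_measurableI)
  fix U :: "real set" assume "open U"
  then have "openin weak_star_topology {\<nu> \<in> density_bounded_measures. integral\<^sup>L \<nu> f \<in> U}"
    unfolding weak_star_topology_def using assms by (intro topology_generated_by_Basis) blast
  moreover have "(\<lambda>\<nu>. integral\<^sup>L \<nu> f) -` U \<inter> space weak_star_borel =
      {\<nu> \<in> density_bounded_measures. integral\<^sup>L \<nu> f \<in> U}" by auto
  ultimately show "(\<lambda>\<nu>. integral\<^sup>L \<nu> f) -` U \<inter> space weak_star_borel \<in> sets weak_star_borel"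
    by (auto simp: sets_weak_star_borel)
qed

text \<open>
  The indicator of a bounded open set is an increasing limit of functions in \<open>Cc\<close>, built from the distance to
  the complement.
\<close>

lemma measurable_emeasure_open:
  fixes U :: "(real ^ 'n) set"
  assumes U: "open U" "bounded U"
  shows "(\<lambda>\<nu>. emeasure \<nu> U) \<in> borel_measurable weak_star_borel"
proof -
  have U': "- U \<noteq> {}" using U(2) by (metis Compl_empty_eq double_complement not_bounded_UNIV)
  define f where "f n x = min 1 (real n * infdist x (- U))" for n x
  have f0: "0 \<le> f n x" "f n x \<le> 1" for n x by (auto simp: f_def infdist_nonneg)
  have nz: "f n x = 0" if "x \<notin> U" for n x using that by (simp add: f_def)
  have cont: "continuous_on UNIV (f n)" for n
    unfolding f_def by (intro continuous_intros)
  have sub: "closure {x. f n x \<noteq> 0} \<subseteq> closure U" for n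
    using nz by (intro closure_mono) blast
  have f: "f n \<in> Cc" for n
  proof -
    have "compact (closure U)" using U(2) by simp
    then have "compact (closure {x. f n x \<noteq> 0})"
      using sub[of n] by (metis closed_closure compact_Int_closed inf.absorb_iff2)
    then show ?thesis using cont by (simp add: Cc_def)
  qed
  have inc: "incseq (\<lambda>n x. ennreal (f n x))"
    by (auto simp: incseq_def le_fun_def f_def intro!: ennreal_leI min.mono mult_right_mono infdist_nonneg)
  have sup: "(SUP n. ennreal (f n x)) = indicator U x" for x
  proof (cases "x \<in> U")
    case True
    have "x \<notin> closure (- U)" using True U(1) by (simp add: closure_complement interior_open)
    then have "0 < infdist x (- U)" using U' by (metis in_closure_iff_infdist_zero infdist_nonneg order_le_less)
    then obtain n where "1 < real n * infdist x (- U)" using ex_less_of_nat_mult by blast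
    then have "f n x = 1" by (simp add: f_def)
    then have "1 \<le> (SUP n. ennreal (f n x))" by (metis SUP_upper UNIV_I ennreal_1)
    moreover have "(SUP n. ennreal (f n x)) \<le> 1" using f0 by (intro SUP_least) simp
    ultimately show ?thesis using True by simp
  qed (simp add: nz)
  have "emeasure \<nu> U = (SUP n. ennreal (integral\<^sup>L \<nu> (f n)))" if \<nu>: "\<nu> \<in> density_bounded_measures" for \<nu>
  proof -
    have s: "sets \<nu> = sets borel" using \<nu> by (simp add: density_bounded_measures_iff)
    have "emeasure \<nu> U = (\<integral>\<^sup>+x. (SUP n. ennreal (f n x)) \<partial>\<nu>)"
      using U(1) s by (simp add: sup)
    also have "\<dots> = (SUP n. \<integral>\<^sup>+x. ennreal (f n x) \<partial>\<nu>)"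
      using inc borel_measurable_continuous_onI[OF cont]
      by (intro nn_integral_monotone_convergence_SUP) (auto simp: measurable_cong_sets[OF s refl])
    also have "\<dots> = (SUP n. ennreal (integral\<^sup>L \<nu> (f n)))"
      using integrable_Cc[OF \<nu> f] f0 by (simp add: nn_integral_eq_integral)
    finally show ?thesis .
  qed
  then show ?thesis
    using measurable_integral_Cc[OF f] by (subst measurable_cong) (auto intro!: borel_measurable_SUP)
qed

lemma measurable_emeasure_bounded:
  fixes E :: "(real ^ 'n) set"
  assumes "E \<in> sets borel"
  shows "(\<lambda>\<nu>. emeasure \<nu> (E \<inter> ball 0 r)) \<in> borel_measurable weak_star_borel"
proof -
  have "Int_stable {S :: (real ^ 'n) set. open S}" by (auto intro!: Int_stableI)
  moreover have "{S. open S} \<subseteq> Pow (UNIV :: (real ^ 'n) set)" by simp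
  moreover have "E \<in> sigma_sets UNIV {S. open S}" using assms by (simp add: borel_def)
  ultimately show ?thesis
  proof (induction rule: sigma_sets_induct_disjoint)
    case (basic A)
    then show ?case by (intro measurable_emeasure_open) (auto intro: bounded_subset)
  next
    case (compl A)
    have A: "A \<in> sets borel" using compl(1) by (simp add: borel_def)
    have eq: "emeasure \<nu> ((UNIV - A) \<inter> ball 0 r) = emeasure \<nu> (ball 0 r) - emeasure \<nu> (A \<inter> ball 0 r)"
      if \<nu>: "\<nu> \<in> density_bounded_measures" for \<nu>
    proof -
      have s: "sets \<nu> = sets borel" using \<nu> by (simp add: density_bounded_measures_iff)
      have "emeasure \<nu> (ball 0 r - A \<inter> ball 0 r) = emeasure \<nu> (ball 0 r) - emeasure \<nu> (A \<inter> ball 0 r)"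
        using A s emeasure_bounded_density_bounded[OF \<nu> bounded_subset[OF bounded_ball Int_lower2], of A 0 r]
        by (intro emeasure_Diff) auto
      moreover have "(UNIV - A) \<inter> ball 0 r = ball 0 r - A \<inter> ball 0 r" by auto
      ultimately show ?thesis by simp
    qed
    have m: "(\<lambda>\<nu>. emeasure \<nu> (ball 0 r) - emeasure \<nu> (A \<inter> ball 0 r)) \<in> borel_measurable weak_star_borel"
      using compl.IH measurable_emeasure_open[of "ball 0 r"] by (intro borel_measurable_minus_ennreal) auto
    show ?case by (rule measurable_cong[THEN iffD2, OF _ m]) (simp add: eq)
  next
    case (union A)
    have A: "A i \<in> sets borel" for i using union(2) by (auto simp: borel_def)
    have "emeasure \<nu> (\<Union> (range A) \<inter> ball 0 r) = (\<Sum>i. emeasure \<nu> (A i \<inter> ball 0 r))"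
      if \<nu>: "\<nu> \<in> density_bounded_measures" for \<nu>
    proof -
      have s: "sets \<nu> = sets borel" using \<nu> by (simp add: density_bounded_measures_iff)
      have "disjoint_family (\<lambda>i. A i \<inter> ball 0 r)"
        using union(1) unfolding disjoint_family_on_def by blast
      then have "(\<Sum>i. emeasure \<nu> (A i \<inter> ball 0 r)) = emeasure \<nu> (\<Union>i. A i \<inter> ball 0 r)"
        using A s by (intro suminf_emeasure) auto
      moreover have "(\<Union>i. A i \<inter> ball 0 r) = \<Union> (range A) \<inter> ball 0 r" by auto
      ultimately show ?thesis by simp
    qed
    then show ?case
      using union.IH by (subst measurable_cong) auto
  qed simp
qed

lemma measurable_emeasure:
  fixes E :: "(real ^ 'n) set"
  assumes "E \<in> sets borel" "bounded E"
  shows "(\<lambda>\<nu>. emeasure \<nu> E) \<in> borel_measurable weak_star_borel"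
proof -
  obtain r where "E \<subseteq> ball 0 r"
    using bounded_subset_ballD[OF assms(2), of 0] by auto
  then show ?thesis using measurable_emeasure_bounded[OF assms(1), of r] by (simp add: Int_absorb2)
qed

lemma countable_open_approximation:
  obtains \<A> :: "(real ^ 'n) set set" where "countable \<A>" "\<A> \<subseteq> sets borel"
    "\<And>U. open U \<Longrightarrow> \<exists>A. range A \<subseteq> \<A> \<and> incseq A \<and> U = (\<Union>n. A n)"
proof -
  obtain B :: "(real ^ 'n) set set" where B: "countable B" "topological_basis B"
    using ex_countable_basis by blast
  let ?A = "{\<Union>F | F. finite F \<and> F \<subseteq> B}"
  have "countable ((\<Union>) ` {F. finite F \<and> F \<subseteq> B})"
    using B(1) by (intro countable_image countable_Collect_finite_subset)
  moreover have "?A = (\<Union>) ` {F. finite F \<and> F \<subseteq> B}" by auto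
  ultimately have "countable ?A" by simp
  moreover have "?A \<subseteq> sets borel"
    using topological_basis_open[OF B(2)] by (auto intro!: borel_open open_Union)
  moreover have "\<exists>A. range A \<subseteq> ?A \<and> incseq A \<and> U = (\<Union>n. A n)" if U: "open U" for U
  proof -
    obtain B' where B': "B' \<subseteq> B" "\<Union>B' = U"
      using B(2) U unfolding topological_basis_def by blast
    show ?thesis
    proof (cases "B' = {}")
      case True
      then show ?thesis using B' by (intro exI[of _ "\<lambda>_. {}"]) (auto simp: incseq_def)
    next
      case False
      have cB': "countable B'" using B' B(1) countable_subset by blast
      define A where "A n = \<Union> (from_nat_into B' ` {..<n})" for n
      have "A n \<in> ?A" for n
        using from_nat_into[OF False] B' unfolding A_def
        by (intro CollectI exI[of _ "from_nat_into B' ` {..<n}"] conjI) auto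
      moreover have "incseq A" unfolding incseq_def A_def by (intro allI impI Union_mono image_mono) auto
      moreover have "(\<Union>n. A n) = U"
      proof -
        have "(\<Union>n. A n) = \<Union> (range (from_nat_into B'))" by (auto simp: A_def)
        then show ?thesis using range_from_nat_into[OF False cB'] B'(2) by simp
      qed
      ultimately show ?thesis by (intro exI[of _ A]) auto
    qed
  qed
  ultimately show ?thesis using that[of ?A] by blast
qed

text \<open>
  The infimum may be restricted to a countable family of sets that approximates open sets from inside: \<open>A\<close> is
  enlarged to an open set at small cost for \<open>\<nu>\<close> by outer regularity, and an open set is exhausted from inside at small cost
  for Lebesgue measure. Hence the minimum is a countable infimum of measurable functions of \<open>\<nu>\<close>.
\<close>

lemma meet_lebesgue_eq_INF:
  fixes \<nu> :: "(real ^ 'n) measure"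
  assumes \<A>: "\<A> \<subseteq> sets borel" "\<And>U. open U \<Longrightarrow> \<exists>A. range A \<subseteq> \<A> \<and> incseq A \<and> U = (\<Union>n. A n)"
    and \<nu>: "\<nu> \<in> density_bounded_measures" and E [measurable]: "E \<in> sets borel" "bounded E"
  shows "meet_lebesgue t \<nu> E = (INF A\<in>\<A>. emeasure \<nu> (E \<inter> A) + ennreal t * emeasure lborel (E - A))"
    (is "_ = ?I")
proof (rule antisym)
  show "meet_lebesgue t \<nu> E \<le> ?I" unfolding meet_lebesgue_def using \<A>(1) by (rule INF_superset_mono) simp
  have s: "sets \<nu> = sets borel" using \<nu> by (simp add: density_bounded_measures_iff)
  let ?n = "density \<nu> (indicator E)"
  have n: "emeasure ?n A = emeasure \<nu> (E \<inter> A)" if "A \<in> sets borel" for A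
  proof -
    have "emeasure ?n A = (\<integral>\<^sup>+x. indicator E x * indicator A x \<partial>\<nu>)"
      using that s E(1) by (intro emeasure_density) (auto simp: measurable_cong_sets[OF s refl])
    also have "\<dots> = (\<integral>\<^sup>+x. indicator (E \<inter> A) x \<partial>\<nu>)"
      by (intro nn_integral_cong) (auto simp: indicator_def)
    finally show ?thesis using that s E(1) by simp
  qed
  have fin: "emeasure \<nu> (E \<inter> A) < \<infinity>" for A
    using \<nu> E(2) by (intro emeasure_bounded_density_bounded) (auto intro: bounded_subset)
  have fin': "emeasure ?n (space ?n) \<noteq> \<infinity>"
    using n[of UNIV] fin[of UNIV] sets_eq_imp_space_eq[OF s] by simp
  show "?I \<le> meet_lebesgue t \<nu> E"
    unfolding meet_lebesgue_def
  proof (rule INF_greatest)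
    fix A :: "(real ^ 'n) set" assume A [measurable]: "A \<in> sets borel"
    show "?I \<le> emeasure \<nu> (E \<inter> A) + ennreal t * emeasure lborel (E - A)"
    proof (rule ennreal_le_epsilon)
      fix e :: real assume e: "0 < e"
      \<comment> \<open>Outer regularity applies to the finite measure \<open>\<nu>\<close> restricted to \<open>E\<close>.\<close>
      have "(INF U\<in>{U. A \<subseteq> U \<and> open U}. emeasure ?n U) = emeasure ?n A"
        using s A fin' by (intro outer_regular[symmetric]) auto
      also have "\<dots> < emeasure ?n A + ennreal e"
      proof -
        obtain c where "0 \<le> c" "emeasure ?n A = ennreal c"
          using fin[of A] n[OF A] by (cases "emeasure ?n A") auto
        then show ?thesis using e by (simp add: ennreal_plus[symmetric] ennreal_less_iff del: ennreal_plus)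
      qed
      finally obtain U where U: "A \<subseteq> U" "open U" "emeasure ?n U < emeasure ?n A + ennreal e"
        by (auto simp: INF_less_iff)
      have [measurable]: "U \<in> sets borel" using U(2) by simp
      obtain F where F: "range F \<subseteq> \<A>" "incseq F" "U = (\<Union>n. F n)" using \<A>(2)[OF U(2)] by blast
      have Fb [measurable]: "F n \<in> sets borel" for n using F(1) \<A>(1) by auto
      have "?I \<le> emeasure \<nu> (E \<inter> U) + ennreal t * emeasure lborel (E - F n)" for n
      proof -
        have "?I \<le> emeasure \<nu> (E \<inter> F n) + ennreal t * emeasure lborel (E - F n)"
          using F(1) by (intro INF_lower) auto
        also have "emeasure \<nu> (E \<inter> F n) \<le> emeasure \<nu> (E \<inter> U)"
          using F(3) s by (intro emeasure_mono) auto
        finally show ?thesis by (simp add: add_right_mono)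
      qed
      moreover have "(\<lambda>n. emeasure lborel (E - F n)) \<longlonglongrightarrow> emeasure lborel (\<Inter>n. E - F n)"
        using F(2) emeasure_bounded_finite[OF bounded_subset[OF E(2) Diff_subset]]
        by (intro Lim_emeasure_decseq) (auto simp: incseq_def decseq_def less_top)
      moreover have "(\<Inter>n. E - F n) = E - U" using F(3) by auto
      ultimately have "?I \<le> emeasure \<nu> (E \<inter> U) + ennreal t * emeasure lborel (E - U)"
        by (intro LIMSEQ_le_const[where a = ?I and X = "\<lambda>n. emeasure \<nu> (E \<inter> U) + ennreal t * emeasure lborel (E - F n)"]
            tendsto_add tendsto_const ennreal_tendsto_cmult) auto
      also have "\<dots> \<le> (emeasure \<nu> (E \<inter> A) + ennreal e) + ennreal t * emeasure lborel (E - A)"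
        using U n[OF A] n[of U] by (intro add_mono mult_left_mono emeasure_mono) auto
      finally show "?I \<le> emeasure \<nu> (E \<inter> A) + ennreal t * emeasure lborel (E - A) + ennreal e"
        by (simp add: ac_simps)
    qed
  qed
qed

lemma measurable_meet_lebesgue:
  fixes E :: "(real ^ 'n) set"
  assumes E: "E \<in> sets borel" "bounded E"
  shows "(\<lambda>\<nu>. meet_lebesgue t \<nu> E) \<in> borel_measurable weak_star_borel"
proof -
  obtain \<A> :: "(real ^ 'n) set set" where \<A>: "countable \<A>" "\<A> \<subseteq> sets borel"
    "\<And>U. open U \<Longrightarrow> \<exists>A. range A \<subseteq> \<A> \<and> incseq A \<and> U = (\<Union>n. A n)"
    using countable_open_approximation by blast
  have "(\<lambda>\<nu>. INF A\<in>\<A>. emeasure \<nu> (E \<inter> A) + ennreal t * emeasure lborel (E - A)) \<in> borel_measurable weak_star_borel"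
    using \<A>(1,2) E
    by (intro borel_measurable_INF borel_measurable_add measurable_const measurable_emeasure) (auto intro: bounded_subset)
  then show ?thesis
    using meet_lebesgue_eq_INF[OF \<A>(2,3) _ E] by (subst measurable_cong) auto
qed

lemma act_inverse:
  assumes g: "\<And>x. g' *v (g *v x) = x" and \<nu>: "sets \<nu> = sets borel"
  shows "act g' (act g \<nu>) = (\<nu> :: (real ^ 'n) measure)"
proof -
  have "act g' (act g \<nu>) = distr \<nu> borel ((*v) g' \<circ> (*v) g)"
    unfolding act_def by (rule distr_distr[OF measurable_mult_vec[OF refl] measurable_mult_vec[OF \<nu>]])
  also have "(*v) g' \<circ> (*v) g = (\<lambda>x. x)" using g by auto
  also have "distr \<nu> borel (\<lambda>x. x) = \<nu>" using \<nu> by (intro distr_id2) simp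
  finally show ?thesis .
qed

lemma emeasure_act_image:
  fixes g :: "real ^ 'n ^ 'n"
  assumes g: "g \<in> SL" and \<nu>: "sets \<nu> = sets borel" and E: "E \<in> sets borel"
  shows "emeasure (act g \<nu>) ((*v) g ` E) = emeasure \<nu> E"
proof -
  obtain g' where g': "\<And>x. g' *v (g *v x) = x" "\<And>x. g *v (g' *v x) = x"
    using SL_inverse[OF g] by metis
  have "(*v) g ` E \<in> sets borel" using g E by (intro borel_matrix_image) (auto simp: SL_def)
  then have "emeasure (act g \<nu>) ((*v) g ` E) = emeasure \<nu> ((*v) g -` (*v) g ` E \<inter> space \<nu>)"
    unfolding act_def by (intro emeasure_distr measurable_mult_vec \<nu>)
  also have "(*v) g -` (*v) g ` E \<inter> space \<nu> = E"
    using g'(1) sets_eq_imp_space_eq[OF \<nu>] by (auto simp: image_iff) (metis g'(1))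
  finally show ?thesis .
qed

lemma emeasure_lborel_image:
  fixes g :: "real ^ 'n ^ 'n"
  assumes g: "g \<in> SL" and E: "E \<in> sets borel"
  shows "emeasure lborel ((*v) g ` E) = emeasure lborel E"
proof -
  obtain g' where g': "\<And>x. g' *v (g *v x) = x" "\<And>x. g *v (g' *v x) = x" "g' \<in> SL"
    using SL_inverse[OF g] by metis
  have d: "det g = 1" "det g' = 1" using g g'(3) by (auto simp: SL_def)
  have "lborel = act g lborel"
  proof (rule lborel_eqI)
    fix l u :: "real ^ 'n" assume le: "\<And>b. b \<in> Basis \<Longrightarrow> l \<bullet> b \<le> u \<bullet> b"
    have "emeasure (act g lborel) (box l u) = emeasure lborel ((*v) g' ` box l u)"
      using emeasure_act_image[OF g, of lborel "(*v) g' ` box l u"] d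
      by (simp add: image_image g' borel_matrix_image)
    also have "\<dots> = ennreal (measure lborel ((*v) g' ` box l u))"
      using emeasure_bounded_finite[OF bounded_matrix_image[OF bounded_box, of g' l u]]
      by (simp add: emeasure_eq_ennreal_measure less_top)
    also have "\<dots> = ennreal (measure lborel (box l u))"
      using measure_matrix_image[of g' "box l u"] d by simp
    finally show "emeasure (act g lborel) (box l u) = (\<Prod>b\<in>Basis. (u - l) \<bullet> b)"
      using le by (simp add: emeasure_eq_ennreal_measure[symmetric] emeasure_lborel_box)
  qed simp
  then show ?thesis using emeasure_act_image[OF g _ E, of lborel] by simp
qed

text \<open>
  The matrix permutes the competitors \<open>A\<close> in the infimum; one inequality for \<open>g\<close> and its inverse gives equality.
\<close>

lemma meet_lebesgue_act:
  fixes g :: "real ^ 'n ^ 'n"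
  assumes g: "g \<in> SL" and \<nu>: "sets \<nu> = sets borel" and E: "E \<in> sets borel"
  shows "meet_lebesgue t (act g \<nu>) ((*v) g ` E) = meet_lebesgue t \<nu> E"
proof -
  have le: "meet_lebesgue t (act g \<nu>) ((*v) g ` E) \<le> meet_lebesgue t \<nu> E"
    if g: "g \<in> SL" and \<nu>: "sets \<nu> = sets borel" and E: "E \<in> sets borel" for g \<nu> and E :: "(real ^ 'n) set"
    unfolding meet_lebesgue_def[of t \<nu>]
  proof (rule INF_greatest)
    fix A :: "(real ^ 'n) set" assume A: "A \<in> sets borel"
    obtain g' where g': "\<And>x. g' *v (g *v x) = x" using SL_inverse[OF g] by metis
    have inj: "inj ((*v) g)" by (rule injI) (metis g')
    have "meet_lebesgue t (act g \<nu>) ((*v) g ` E) \<le> emeasure (act g \<nu>) ((*v) g ` E \<inter> (*v) g ` A) +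
        ennreal t * emeasure lborel ((*v) g ` E - (*v) g ` A)"
      unfolding meet_lebesgue_def using g A by (intro INF_lower borel_matrix_image) (auto simp: SL_def)
    also have "\<dots> = emeasure \<nu> (E \<inter> A) + ennreal t * emeasure lborel (E - A)"
      unfolding image_Int[OF inj, symmetric] image_set_diff[OF inj, symmetric]
      using emeasure_act_image[OF g \<nu>, of "E \<inter> A"] emeasure_lborel_image[OF g, of "E - A"] A E by simp
    finally show "meet_lebesgue t (act g \<nu>) ((*v) g ` E) \<le> emeasure \<nu> (E \<inter> A) + ennreal t * emeasure lborel (E - A)" .
  qed
  obtain g' where g': "\<And>x. g' *v (g *v x) = x" "g' \<in> SL" using SL_inverse[OF g] by metis
  have "meet_lebesgue t (act g' (act g \<nu>)) ((*v) g' ` (*v) g ` E) \<le> meet_lebesgue t (act g \<nu>) ((*v) g ` E)"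
    using g E by (intro le g'(2)) (auto simp: SL_def intro: borel_matrix_image)
  then have "meet_lebesgue t \<nu> E \<le> meet_lebesgue t (act g \<nu>) ((*v) g ` E)"
    by (simp add: act_inverse[OF g'(1) \<nu>] image_image g'(1))
  with le[OF g \<nu> E] show ?thesis by simp
qed

section \<open>Measures with constant absolutely continuous part\<close>

lemma emeasure_unit_cube: "emeasure lborel (unit_cube :: (real ^ 'n) set) = 1"
proof (rule antisym)
  have "cbox 0 (1 :: real ^ 'n) \<noteq> {}" by (simp add: interval_ne_empty_cart)
  then have "measure lborel (cbox 0 (1 :: real ^ 'n)) = 1" by (simp add: content_cbox_cart)
  then have one: "emeasure lborel (cbox 0 (1 :: real ^ 'n)) = 1"
    using emeasure_bounded_finite[of "cbox 0 (1 :: real ^ 'n)"] by (simp add: emeasure_eq_ennreal_measure less_top)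
  then have one': "emeasure lborel (box 0 (1 :: real ^ 'n)) = 1"
    unfolding emeasure_lborel_box_eq emeasure_lborel_cbox_eq .
  show "emeasure lborel (unit_cube :: (real ^ 'n) set) \<le> 1"
    unfolding one[symmetric] by (intro emeasure_mono) (auto simp: unit_cube_def mem_box_cart less_imp_le)
  show "1 \<le> emeasure lborel (unit_cube :: (real ^ 'n) set)"
    unfolding one'[symmetric] by (intro emeasure_mono) (auto simp: unit_cube_def mem_box_cart less_imp_le)
qed

lemma measure_unit_cube: "measure lborel (unit_cube :: (real ^ 'n) set) = 1"
  by (simp add: measure_def emeasure_unit_cube)

text \<open>
  The absolutely continuous part of \<open>\<nu>\<close> is \<open>c\<close> times Lebesgue measure; \<open>N\<close> carries the singular part.
\<close>

definition has_constant_part :: "real \<Rightarrow> (real ^ 'n) measure \<Rightarrow> bool" where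
  "has_constant_part c \<nu> \<longleftrightarrow> \<nu> \<in> density_bounded_measures \<and> (\<exists>N\<in>null_sets lborel.
     \<forall>E\<in>sets borel. emeasure \<nu> E = emeasure \<nu> (E \<inter> N) + ennreal c * emeasure lborel E)"

text \<open>
  A single \<open>t > c\<close> is enough, since \<open>min f t = c < t\<close> forces \<open>f = c\<close>. This makes the property accessible to
  the measurable quantities \<open>meet_measure\<close>.
\<close>

lemma has_constant_part_iff_meet:
  fixes \<nu> :: "(real ^ 'n) measure"
  assumes \<nu>: "\<nu> \<in> density_bounded_measures" and c: "0 \<le> c" "c < t"
  shows "has_constant_part c \<nu> \<longleftrightarrow> meet_measure t \<nu> = scale_measure (ennreal c) lborel"
proof
  assume "has_constant_part c \<nu>"
  then obtain N where N: "N \<in> null_sets lborel"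
    "\<And>E. E \<in> sets borel \<Longrightarrow> emeasure \<nu> E = emeasure \<nu> (E \<inter> N) + ennreal c * emeasure lborel E"
    by (auto simp: has_constant_part_def)
  show "meet_measure t \<nu> = scale_measure (ennreal c) lborel"
  proof (rule measure_eqI)
    fix E assume "E \<in> sets (meet_measure t \<nu>)"
    then have E: "E \<in> sets borel" by simp
    have "meet_lebesgue t \<nu> E = (\<integral>\<^sup>+x. min (ennreal c) (ennreal t) * indicator E x \<partial>lborel)"
      by (rule meet_lebesgue_eq_integral[OF _ N(1) _ E]) (use N(2) in \<open>simp_all add: nn_integral_cmult_indicator\<close>)
    then show "emeasure (meet_measure t \<nu>) E = emeasure (scale_measure (ennreal c) lborel) E"
      using c E emeasure_meet_measure[OF \<nu> E] by (simp add: nn_integral_cmult_indicator min_absorb1 ennreal_leI)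
  qed simp
next
  assume meet_measure: "meet_measure t \<nu> = scale_measure (ennreal c) lborel"
  have f [measurable]: "ac_density \<nu> \<in> borel_measurable borel" by (rule ac_density(1)[OF \<nu>])
  have "density lborel (\<lambda>x. min (ac_density \<nu> x) (ennreal t)) = density lborel (\<lambda>_. ennreal c)"
    unfolding meet_measure_def[symmetric] meet_measure by (rule measure_eqI) (simp_all add: emeasure_density nn_integral_cmult_indicator)
  then have "AE x in lborel. min (ac_density \<nu> x) (ennreal t) = ennreal c"
    by (subst (asm) sigma_finite_measure.density_unique_iff[OF sigma_finite_lborel]) auto
  moreover have "ennreal c < ennreal t" using c by (simp add: ennreal_less_iff)
  ultimately have ae: "AE x in lborel. ac_density \<nu> x = ennreal c"
    by (elim eventually_mono) (metis min_def less_irrefl)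
  obtain N where N: "N \<in> null_sets lborel" "\<And>E. E \<in> sets borel \<Longrightarrow>
      emeasure \<nu> E = emeasure \<nu> (E \<inter> N) + (\<integral>\<^sup>+x. ac_density \<nu> x * indicator E x \<partial>lborel)"
    using ac_density(2)[OF \<nu>] by blast
  have "emeasure \<nu> E = emeasure \<nu> (E \<inter> N) + ennreal c * emeasure lborel E" if E: "E \<in> sets borel" for E
  proof -
    have "(\<integral>\<^sup>+x. ac_density \<nu> x * indicator E x \<partial>lborel) = (\<integral>\<^sup>+x. ennreal c * indicator E x \<partial>lborel)"
      using ae by (intro nn_integral_cong_AE) auto
    then show ?thesis using N(2)[OF E] E by (simp add: nn_integral_cmult_indicator)
  qed
  then show "has_constant_part c \<nu>"
    using \<nu> N(1) by (auto simp: has_constant_part_def)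
qed

lemma has_constant_part_unique:
  fixes \<nu> :: "(real ^ 'n) measure"
  assumes "has_constant_part a \<nu>" "has_constant_part b \<nu>" "0 \<le> a" "0 \<le> b"
  shows "a = b"
proof -
  have \<nu>: "\<nu> \<in> density_bounded_measures" using assms(1) by (simp add: has_constant_part_def)
  have "meet_measure (a + b + 1) \<nu> = scale_measure (ennreal a) lborel" "meet_measure (a + b + 1) \<nu> = scale_measure (ennreal b) lborel"
    using has_constant_part_iff_meet[OF \<nu>, of _ "a + b + 1"] assms by auto
  then have eq: "scale_measure (ennreal a) lborel = scale_measure (ennreal b) (lborel :: (real ^ 'n) measure)"
    by simp
  have "ennreal a = ennreal b"
    using arg_cong[OF eq, of "\<lambda>M. emeasure M unit_cube"] by (simp only: emeasure_scale_measure emeasure_unit_cube mult_1_right)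
  then show ?thesis using assms by simp
qed

text \<open>
  Equality of measures is thereby expressed through countably many real valued functions of \<open>\<nu>\<close>.
\<close>

lemma meet_measure_eq_scale_iff:
  fixes \<nu> :: "(real ^ 'n) measure"
  assumes \<nu>: "\<nu> \<in> density_bounded_measures" and a: "0 \<le> a"
  shows "meet_measure t \<nu> = scale_measure (ennreal a) lborel \<longleftrightarrow>
    (\<forall>c :: 'n \<Rightarrow> rat. (\<forall>k. c k \<noteq> 0) \<longrightarrow>
      measure (meet_measure t \<nu>) ((*v) (diagonal (\<lambda>k. of_rat (c k))) ` unit_cube) = (\<Prod>k\<in>UNIV. \<bar>of_rat (c k)\<bar>) * a)"
proof (intro iffI allI impI)
  fix c :: "'n \<Rightarrow> rat" assume eq: "meet_measure t \<nu> = scale_measure (ennreal a) lborel" and c: "\<forall>k. c k \<noteq> 0"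
  have "measure lborel ((*v) (diagonal (\<lambda>k. of_rat (c k))) ` unit_cube :: (real ^ 'n) set) = (\<Prod>k\<in>UNIV. \<bar>of_rat (c k)\<bar>)"
    using c by (subst measure_matrix_image) (auto simp: bounded_unit_cube det_diagonal_prod measure_unit_cube abs_prod)
  then show "measure (meet_measure t \<nu>) ((*v) (diagonal (\<lambda>k. of_rat (c k))) ` unit_cube) = (\<Prod>k\<in>UNIV. \<bar>of_rat (c k)\<bar>) * a"
    using a by (simp add: eq measure_scale_measure)
next
  assume *: "\<forall>c :: 'n \<Rightarrow> rat. (\<forall>k. c k \<noteq> 0) \<longrightarrow>
      measure (meet_measure t \<nu>) ((*v) (diagonal (\<lambda>k. of_rat (c k))) ` unit_cube) = (\<Prod>k\<in>UNIV. \<bar>of_rat (c k)\<bar>) * a"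
  show "meet_measure t \<nu> = scale_measure (ennreal a) lborel"
    using * a emeasure_meet_measure[OF \<nu>] meet_lebesgue_le
    by (intro measure_eq_scale_lborel[where t = t]) auto
qed

lemma measurable_meet_measure:
  fixes E :: "(real ^ 'n) set"
  assumes "E \<in> sets borel" "bounded E"
  shows "(\<lambda>\<nu>. measure (meet_measure t \<nu>) E) \<in> borel_measurable weak_star_borel"
proof -
  have "(\<lambda>\<nu>. enn2real (meet_lebesgue t \<nu> E)) \<in> borel_measurable weak_star_borel"
    using measurable_meet_lebesgue[OF assms] by measurable
  then show ?thesis
    by (subst measurable_cong[where g = "\<lambda>\<nu>. enn2real (meet_lebesgue t \<nu> E)"])
       (use assms in \<open>auto simp: measure_def emeasure_meet_measure\<close>)
qed

text \<open>
  The constant is recovered from \<open>\<nu>\<close> as the mass that the minimum with \<open>(q + 1) m\<close> gives to the unit cube.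
\<close>

lemma sets_constant_part_le:
  assumes q: "0 \<le> q"
  shows "{\<nu>. \<exists>a. 0 \<le> a \<and> a \<le> q \<and> has_constant_part a \<nu>} \<in> sets (weak_star_borel :: (real ^ 'n) measure measure)"
proof -
  let ?P = "\<lambda>\<nu> (c :: 'n \<Rightarrow> rat). (\<forall>k. c k \<noteq> 0) \<longrightarrow>
      measure (meet_measure (q + 1) \<nu>) ((*v) (diagonal (\<lambda>k. of_rat (c k))) ` unit_cube) =
        (\<Prod>k\<in>UNIV. \<bar>of_rat (c k)\<bar>) * measure (meet_measure (q + 1) \<nu>) (unit_cube :: (real ^ 'n) set)"
  have "{\<nu>. \<exists>a. 0 \<le> a \<and> a \<le> q \<and> has_constant_part a \<nu>} =
      {\<nu> \<in> space weak_star_borel. (\<forall>c. ?P \<nu> c) \<and> measure (meet_measure (q + 1) \<nu>) (unit_cube :: (real ^ 'n) set) \<le> q}" (is "?L = ?R")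
  proof (intro set_eqI iffI)
    fix \<nu> :: "(real ^ 'n) measure" assume "\<nu> \<in> ?L"
    then obtain a where a: "0 \<le> a" "a \<le> q" "has_constant_part a \<nu>" by auto
    then have \<nu>: "\<nu> \<in> density_bounded_measures" by (simp add: has_constant_part_def)
    have eq: "meet_measure (q + 1) \<nu> = scale_measure (ennreal a) lborel"
      using a has_constant_part_iff_meet[OF \<nu>, of a "q + 1"] by simp
    then have m: "measure (meet_measure (q + 1) \<nu>) unit_cube = a"
      using a(1) by (simp add: measure_scale_measure measure_unit_cube)
    show "\<nu> \<in> ?R" using a(2) \<nu> iffD1[OF meet_measure_eq_scale_iff[OF \<nu> a(1)] eq] unfolding m[symmetric] by simp
  next
    fix \<nu> :: "(real ^ 'n) measure" assume R: "\<nu> \<in> ?R"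
    then have \<nu>: "\<nu> \<in> density_bounded_measures" by simp
    let ?a = "measure (meet_measure (q + 1) \<nu>) unit_cube"
    have "meet_measure (q + 1) \<nu> = scale_measure (ennreal ?a) lborel"
      by (rule iffD2[OF meet_measure_eq_scale_iff[OF \<nu> measure_nonneg]]) (use R in blast)
    moreover have q: "?a \<le> q" using R by blast
    ultimately have "has_constant_part ?a \<nu>"
      by (intro iffD2[OF has_constant_part_iff_meet[OF \<nu>, of _ "q + 1"]]) auto
    then show "\<nu> \<in> ?L" using q measure_nonneg by blast
  qed
  also have "\<dots> \<in> sets weak_star_borel"
  proof -
    have [measurable]: "(\<lambda>\<nu>. measure (meet_measure (q + 1) \<nu>) ((*v) (diagonal (\<lambda>k. of_rat (c k))) ` unit_cube)) \<in> borel_measurable weak_star_borel"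
      if "\<forall>k. c k \<noteq> 0" for c :: "'n \<Rightarrow> rat"
      using that by (intro measurable_meet_measure borel_matrix_image bounded_matrix_image bounded_unit_cube) (auto simp: det_diagonal_prod)
    have [measurable]: "(\<lambda>\<nu>. measure (meet_measure (q + 1) \<nu>) (unit_cube :: (real ^ 'n) set)) \<in> borel_measurable weak_star_borel"
      by (intro measurable_meet_measure bounded_unit_cube) simp
    have [measurable]: "Measurable.pred weak_star_borel (\<lambda>\<nu>. ?P \<nu> c)" for c
      by (cases "\<forall>k. c k \<noteq> 0") simp_all
    show ?thesis by measurable
  qed
  finally show ?thesis .
qed

lemma sets_constant_part:
  assumes c: "0 \<le> c"
  shows "{\<nu>. has_constant_part c \<nu>} \<in> sets (weak_star_borel :: (real ^ 'n) measure measure)"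
proof -
  let ?S = "\<lambda>q. {\<nu> :: (real ^ 'n) measure. \<exists>a. 0 \<le> a \<and> a \<le> q \<and> has_constant_part a \<nu>}"
  have "{\<nu>. has_constant_part c \<nu>} = ?S c - (\<Union>q\<in>{q\<in>\<rat>. 0 \<le> q \<and> q < c}. ?S q)"
  proof (intro set_eqI iffI)
    fix \<nu> :: "(real ^ 'n) measure" assume "\<nu> \<in> {\<nu>. has_constant_part c \<nu>}"
    then have \<nu>: "has_constant_part c \<nu>" by simp
    have "\<nu> \<notin> ?S q" if q: "q < c" for q
    proof
      assume "\<nu> \<in> ?S q"
      then obtain a where "0 \<le> a" "a \<le> q" "has_constant_part a \<nu>" by blast
      then show False using has_constant_part_unique[OF \<nu> _ c, of a] q by simp
    qed
    then show "\<nu> \<in> ?S c - (\<Union>q\<in>{q\<in>\<rat>. 0 \<le> q \<and> q < c}. ?S q)"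
      using c \<nu> by auto
  next
    fix \<nu> assume \<nu>: "\<nu> \<in> ?S c - (\<Union>q\<in>{q\<in>\<rat>. 0 \<le> q \<and> q < c}. ?S q)"
    then obtain a where a: "0 \<le> a" "a \<le> c" "has_constant_part a \<nu>" by auto
    have "\<not> a < c"
    proof
      assume "a < c"
      then obtain q where "q \<in> \<rat>" "a < q" "q < c" using Rats_dense_in_real by blast
      moreover from this have "0 \<le> q" "\<nu> \<in> ?S q" using a by auto
      ultimately show False using \<nu> by blast
    qed
    then show "\<nu> \<in> {\<nu>. has_constant_part c \<nu>}" using a by simp
  qed
  moreover have "?S c - (\<Union>q\<in>{q\<in>\<rat>. 0 \<le> q \<and> q < c}. ?S q) \<in> sets weak_star_borel"
    using c by (intro sets.Diff sets.countable_UN'' sets_constant_part_le) (auto intro: countable_subset[OF _ countable_rat])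
  ultimately show ?thesis by simp
qed

lemma has_constant_part_act:
  fixes g :: "real ^ 'n ^ 'n"
  assumes g: "g \<in> SL" and \<nu>: "has_constant_part c \<nu>"
  shows "has_constant_part c (act g \<nu>)"
proof -
  obtain g' where g': "g' \<in> SL" "\<And>x. g' *v (g *v x) = x" "\<And>x. g *v (g' *v x) = x"
    using SL_inverse[OF g] by metis
  obtain N where N: "N \<in> null_sets lborel"
    "\<And>E. E \<in> sets borel \<Longrightarrow> emeasure \<nu> E = emeasure \<nu> (E \<inter> N) + ennreal c * emeasure lborel E"
    using \<nu> by (auto simp: has_constant_part_def)
  have M: "\<nu> \<in> density_bounded_measures" using \<nu> by (simp add: has_constant_part_def)
  then have s: "sets \<nu> = sets borel" by (simp add: density_bounded_measures_iff)
  have d: "det g \<noteq> 0" "det g' \<noteq> 0" using g g'(1) by (auto simp: SL_def)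
  have inj: "inj ((*v) g)" by (rule injI) (metis g'(2))
  have "emeasure (act g \<nu>) E = emeasure (act g \<nu>) (E \<inter> (*v) g ` N) + ennreal c * emeasure lborel E"
    if E: "E \<in> sets borel" for E
  proof -
    define F where "F = (*v) g' ` E"
    have F: "F \<in> sets borel" unfolding F_def using d(2) E by (rule borel_matrix_image)
    have EF: "E = (*v) g ` F" by (simp add: F_def image_image g'(3))
    have FN: "F \<inter> N \<in> sets borel" using F N(1) by auto
    show ?thesis
      unfolding EF image_Int[OF inj, symmetric] emeasure_act_image[OF g s F] emeasure_act_image[OF g s FN]
        emeasure_lborel_image[OF g F] by (rule N(2)[OF F])
  qed
  moreover have "(*v) g ` N \<in> null_sets lborel" by (rule null_matrix_image[OF d(1) N(1)])
  ultimately show ?thesis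
    using act_in_density_bounded_measures[OF g M] by (auto simp: has_constant_part_def)
qed

lemma invariant_setI:
  fixes A :: "(real ^ 'n) measure set"
  assumes "A \<subseteq> density_bounded_measures" "\<And>g \<nu>. g \<in> SL \<Longrightarrow> \<nu> \<in> A \<Longrightarrow> act g \<nu> \<in> A"
  shows "\<forall>g\<in>SL. act g ` A = A"
proof (intro ballI equalityI subsetI)
  fix g \<nu> assume g: "g \<in> (SL :: (real ^ 'n ^ 'n) set)" and \<nu>: "\<nu> \<in> A"
  obtain g' where g': "g' \<in> SL" "\<And>x. g *v (g' *v x) = x" using SL_inverse[OF g] by metis
  have "sets \<nu> = sets borel" using \<nu> assms(1) by (auto simp: density_bounded_measures_iff)
  then have "\<nu> = act g (act g' \<nu>)" using act_inverse[OF g'(2)] by simp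
  moreover have "act g' \<nu> \<in> A" using assms(2) g'(1) \<nu> by blast
  ultimately show "\<nu> \<in> act g ` A" by blast
qed (use assms(2) in blast)

section \<open>Siegel measures\<close>

text \<open>
  Invariance of \<open>\<mu>\<close> allows \<open>\<nu>\<close> to be replaced by its image under \<open>g\<close> in the second moment; equivariance
  of the minimum does the rest.
\<close>

lemma siegel_moment_invariant:
  fixes \<mu> :: "(real ^ 'n) measure measure"
  assumes \<mu>: "siegel_measure \<mu>" and t: "0 \<le> t"
  shows "moment_invariant \<mu> (meet_measure t) t"
proof -
  have sets: "sets \<mu> = sets weak_star_borel" and inv: "\<And>g. g \<in> SL \<Longrightarrow> distr \<mu> weak_star_borel (act g) = \<mu>"
    and "prob_space \<mu>"
    using \<mu> by (auto simp: siegel_measure_def)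
  then interpret prob_space \<mu> by simp
  have sp: "space \<mu> = density_bounded_measures" using sets_eq_imp_space_eq[OF sets] by simp
  show ?thesis
  proof
    fix g :: "real ^ 'n ^ 'n" and E :: "(real ^ 'n) set"
    assume g: "det g = 1" and E: "E \<in> sets borel" "bounded E"
    have gE: "(*v) g ` E \<in> sets borel" "bounded ((*v) g ` E)"
      using g E by (auto intro: borel_matrix_image bounded_matrix_image)
    have gS: "g \<in> SL" using g by (simp add: SL_def)
    have "(\<integral>\<nu>. (measure (meet_measure t \<nu>) ((*v) g ` E))\<^sup>2 \<partial>\<mu>) =
        (\<integral>\<nu>. (measure (meet_measure t \<nu>) ((*v) g ` E))\<^sup>2 \<partial>distr \<mu> weak_star_borel (act g))"
      by (simp add: inv[OF gS])
    also have "\<dots> = (\<integral>\<nu>. (measure (meet_measure t (act g \<nu>)) ((*v) g ` E))\<^sup>2 \<partial>\<mu>)"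
      using measurable_act[OF gS] measurable_meet_measure[OF gE]
      by (intro integral_distr borel_measurable_power) (auto simp: measurable_cong_sets[OF sets refl])
    also have "\<dots> = (\<integral>\<nu>. (measure (meet_measure t \<nu>) E)\<^sup>2 \<partial>\<mu>)"
    proof (rule Bochner_Integration.integral_cong[OF refl])
      fix \<nu> assume "\<nu> \<in> space \<mu>"
      then have \<nu>: "\<nu> \<in> density_bounded_measures" by (simp add: sp)
      then have "sets \<nu> = sets borel" by (simp add: density_bounded_measures_iff)
      then show "(measure (meet_measure t (act g \<nu>)) ((*v) g ` E))\<^sup>2 = (measure (meet_measure t \<nu>) E)\<^sup>2"
        using emeasure_meet_measure[OF \<nu> E(1)] emeasure_meet_measure[OF act_in_density_bounded_measures[OF gS \<nu>] gE(1)]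
          meet_lebesgue_act[OF gS _ E(1)] by (simp add: measure_def)
    qed
    finally show "(\<integral>\<nu>. (measure (meet_measure t \<nu>) ((*v) g ` E))\<^sup>2 \<partial>\<mu>) = (\<integral>\<nu>. (measure (meet_measure t \<nu>) E)\<^sup>2 \<partial>\<mu>)" .
  qed (use t sp measurable_meet_measure in
      \<open>auto simp: measurable_cong_sets[OF sets refl] emeasure_meet_measure intro: meet_lebesgue_le\<close>)
qed

text \<open>
  Rigidity gives a constant \<open>a\<^sub>t\<close> for every \<open>t\<close>. It is at most the \<open>\<nu>\<close> mass of the unit cube, so \<open>a\<^sub>t < t\<close> for large \<open>t\<close>, and
  then \<open>a\<^sub>t\<close> is the value of the density itself.
\<close>

lemma AE_has_constant_part:
  fixes \<mu> :: "(real ^ 'n) measure measure"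
  assumes card: "CARD('n) > 1" and \<mu>: "siegel_measure \<mu>"
  shows "AE \<nu> in \<mu>. \<exists>a\<ge>0. has_constant_part a \<nu>"
proof -
  have sets: "sets \<mu> = sets weak_star_borel" using \<mu> by (simp add: siegel_measure_def)
  have sp: "space \<mu> = density_bounded_measures" using sets_eq_imp_space_eq[OF sets] by simp
  have "AE \<nu> in \<mu>. \<forall>t :: nat. meet_measure (real t) \<nu> = scale_measure (ennreal (measure (meet_measure (real t) \<nu>) unit_cube)) lborel"
    unfolding AE_all_countable
    using moment_invariant.AE_scale_lborel[OF siegel_moment_invariant[OF \<mu>] card] by simp
  with AE_space show ?thesis
  proof eventually_elim
    case (elim \<nu>)
    then have \<nu>: "\<nu> \<in> density_bounded_measures" by (simp add: sp)
    have fin: "emeasure \<nu> unit_cube < \<infinity>"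
      by (rule emeasure_bounded_density_bounded[OF \<nu> bounded_unit_cube])
    obtain t :: nat where t: "measure \<nu> unit_cube < real t" using reals_Archimedean2 by blast
    let ?a = "measure (meet_measure (real t) \<nu>) unit_cube"
    have "meet_lebesgue (real t) \<nu> unit_cube \<le> emeasure \<nu> unit_cube"
      unfolding meet_lebesgue_def by (rule INF_lower2[of UNIV]) auto
    then have "?a \<le> measure \<nu> unit_cube"
      using fin emeasure_meet_measure[OF \<nu> unit_cube_borel, of "real t"] by (simp add: measure_def enn2real_mono)
    with t have "?a < real t" by simp
    then have "has_constant_part ?a \<nu>"
      using elim(2) by (subst has_constant_part_iff_meet[OF \<nu>, of _ "real t"]) auto
    then show ?case by (intro exI[of _ ?a]) simp
  qed
qed

text \<open>
  The sets \<open>S q\<close> where the constant is at most \<open>q\<close> increase with \<open>q\<close> and are strictly invariant, so each of them is null or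
  conull. The constant is almost everywhere the threshold between the two cases.
\<close>

lemma siegel_constant_part:
  fixes \<mu> :: "(real ^ 'n) measure measure"
  assumes card: "CARD('n) > 1" and \<mu>: "siegel_measure \<mu>"
  obtains c where "0 \<le> c" "AE \<nu> in \<mu>. has_constant_part c \<nu>"
proof -
  have sets: "sets \<mu> = sets weak_star_borel" and erg: "ergodic_SL \<mu>" and "prob_space \<mu>"
    using \<mu> by (auto simp: siegel_measure_def)
  then interpret prob_space \<mu> by simp
  have sp: "space \<mu> = density_bounded_measures" using sets_eq_imp_space_eq[OF sets] by simp
  define S where "S q = {\<nu> :: (real ^ 'n) measure. \<exists>a. 0 \<le> a \<and> a \<le> q \<and> has_constant_part a \<nu>}" for q
  have S: "S q \<in> sets \<mu>" if "0 \<le> q" for q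
    using sets_constant_part_le[OF that] by (simp add: S_def sets)
  have mono: "S p \<subseteq> S q" if "p \<le> q" for p q using that by (force simp: S_def)
  have dich: "(AE \<nu> in \<mu>. \<nu> \<in> S q) \<or> (AE \<nu> in \<mu>. \<nu> \<notin> S q)" if q: "0 \<le> q" for q
  proof -
    have "\<forall>g\<in>SL. act g ` S q = S q"
      by (rule invariant_setI) (auto simp: S_def has_constant_part_act, auto simp: has_constant_part_def)
    then have "emeasure \<mu> (S q) = 0 \<or> emeasure \<mu> (S q) = 1"
      using erg S[OF q] by (auto simp: ergodic_SL_def)
    then show ?thesis
    proof
      assume "emeasure \<mu> (S q) = 0"
      then have "S q \<in> null_sets \<mu>" using S[OF q] by auto
      then show ?thesis by (intro disjI2 AE_not_in)
    next
      assume "emeasure \<mu> (S q) = 1"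
      then show ?thesis using S[OF q] by (intro disjI1 AE_prob_1) (simp add: measure_def)
    qed
  qed
  define Q where "Q = {q. 0 \<le> q \<and> (AE \<nu> in \<mu>. \<nu> \<in> S q)}"
  have "Q \<noteq> {}"
  proof
    assume "Q = {}"
    then have "\<forall>n :: nat. AE \<nu> in \<mu>. \<nu> \<notin> S (real n)" using dich by (auto simp: Q_def)
    then have "AE \<nu> in \<mu>. \<forall>n :: nat. \<nu> \<notin> S (real n)" by (simp add: AE_all_countable)
    with AE_has_constant_part[OF card \<mu>] have "AE \<nu> in \<mu>. False"
    proof eventually_elim
      case (elim \<nu>)
      then obtain a where a: "0 \<le> a" "has_constant_part a \<nu>" by auto
      obtain n :: nat where "a \<le> real n" using real_arch_simple by blast
      then show ?case using a elim(2) by (auto simp: S_def)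
    qed
    then show False by simp
  qed
  \<comment> \<open>The threshold between the null and the conull sets \<open>S q\<close>.\<close>
  define c where "c = Inf Q"
  have bdd: "bdd_below Q" by (auto simp: Q_def intro: bdd_belowI)
  have c0: "0 \<le> c" unfolding c_def using \<open>Q \<noteq> {}\<close> by (intro cInf_greatest) (auto simp: Q_def)
  have above: "AE \<nu> in \<mu>. \<nu> \<in> S q" if q: "c < q" for q
  proof -
    obtain p where p: "p \<in> Q" "p < q" using q cInf_less_iff[OF \<open>Q \<noteq> {}\<close> bdd] unfolding c_def by blast
    then have "AE \<nu> in \<mu>. \<nu> \<in> S p" by (simp add: Q_def)
    then show ?thesis by eventually_elim (use mono[of p q] p in auto)
  qed
  have below: "AE \<nu> in \<mu>. \<nu> \<notin> S q" if "0 \<le> q" "q < c" for q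
  proof -
    have "q \<notin> Q" using cInf_lower[OF _ bdd, of q] that by (auto simp: c_def)
    then show ?thesis using dich[OF that(1)] that(1) by (auto simp: Q_def)
  qed
  have "AE \<nu> in \<mu>. \<forall>r :: rat. (c < of_rat r \<longrightarrow> \<nu> \<in> S (of_rat r)) \<and> (0 \<le> r \<and> of_rat r < c \<longrightarrow> \<nu> \<notin> S (of_rat r))"
    unfolding AE_all_countable using above below by (auto simp: AE_conj_iff)
  with AE_has_constant_part[OF card \<mu>] have "AE \<nu> in \<mu>. has_constant_part c \<nu>"
  proof eventually_elim
    case (elim \<nu>)
    then obtain a where a: "0 \<le> a" "has_constant_part a \<nu>" by auto
    have uniq: "b = a" if "0 \<le> b" "has_constant_part b \<nu>" for b
      using has_constant_part_unique[OF that(2) a(2) that(1) a(1)] .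
    have "\<not> c < a"
    proof
      assume "c < a"
      then obtain r where r: "c < of_rat r" "of_rat r < a" using of_rat_dense by blast
      then have "\<nu> \<in> S (of_rat r)" using elim(2) by blast
      then show False using uniq r by (auto simp: S_def)
    qed
    moreover have "\<not> a < c"
    proof
      assume "a < c"
      then obtain r where r: "a < of_rat r" "of_rat r < c" using of_rat_dense by blast
      then have "0 \<le> r" using a(1) by (metis less_le_trans not_le of_rat_less_0_iff less_trans)
      then have "\<nu> \<notin> S (of_rat r)" using elim(2) r by blast
      then show False using a r by (auto simp: S_def)
    qed
    ultimately show ?case using a by simp
  qed
  then show ?thesis using that c0 by blast
qed

lemma measure_eqI_bounded:
  fixes \<sigma> \<tau> :: "(real ^ 'n) measure"
  assumes s: "sets \<sigma> = sets borel" "sets \<tau> = sets borel"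
    and eq: "\<And>E. E \<in> sets borel \<Longrightarrow> bounded E \<Longrightarrow> emeasure \<sigma> E = emeasure \<tau> E"
  shows "\<sigma> = \<tau>"
proof (rule measure_eqI)
  fix E assume "E \<in> sets \<sigma>"
  then have E: "E \<in> sets borel" using s by simp
  have "(\<lambda>n. emeasure \<nu> (E \<inter> ball 0 (real n))) \<longlonglongrightarrow> emeasure \<nu> E" if "sets \<nu> = sets borel" for \<nu> :: "(real ^ 'n) measure"
  proof -
    have "(\<Union>n. E \<inter> ball 0 (real n)) = E"
      using reals_Archimedean2 by (auto simp: dist_norm)
    moreover have "incseq (\<lambda>n. E \<inter> ball 0 (real n))"
      unfolding incseq_def by (intro allI impI Int_mono order_refl subset_ball) simp
    moreover have "range (\<lambda>n. E \<inter> ball 0 (real n)) \<subseteq> sets \<nu>"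
      unfolding that using E by (intro image_subsetI sets.Int) simp_all
    ultimately show ?thesis
      by (metis Lim_emeasure_incseq)
  qed
  note lim = this[OF s(1)] this[OF s(2)]
  have "emeasure \<sigma> (E \<inter> ball 0 (real n)) = emeasure \<tau> (E \<inter> ball 0 (real n))" for n
    using E by (intro eq bounded_subset[OF bounded_ball Int_lower2]) simp
  then show "emeasure \<sigma> E = emeasure \<tau> E"
    using LIMSEQ_unique[OF lim(1)] lim(2) by presburger
qed (use s in simp)

lemma inj_on_add_lebesgue: "inj_on (add_lebesgue c) (density_bounded_measures :: (real ^ 'n) measure set)"
proof (rule inj_onI)
  fix \<sigma> \<tau> :: "(real ^ 'n) measure"
  assume M: "\<sigma> \<in> density_bounded_measures" "\<tau> \<in> density_bounded_measures" and eq: "add_lebesgue c \<sigma> = add_lebesgue c \<tau>"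
  then have s: "sets \<sigma> = sets borel" "sets \<tau> = sets borel" by (auto simp: density_bounded_measures_iff)
  show "\<sigma> = \<tau>"
  proof (rule measure_eqI_bounded[OF s])
    fix E :: "(real ^ 'n) set" assume E: "E \<in> sets borel" "bounded E"
    have "emeasure \<sigma> E + ennreal c * emeasure lborel E = emeasure \<tau> E + ennreal c * emeasure lborel E"
      using arg_cong[OF eq, of "\<lambda>M. emeasure M E"]
      by (simp only: emeasure_add_lebesgue[OF s(1) E(1)] emeasure_add_lebesgue[OF s(2) E(1)])
    moreover have "ennreal c * emeasure lborel E \<noteq> \<infinity>"
      using emeasure_bounded_finite[OF E(2)] by (simp add: ennreal_mult_eq_top_iff less_top)
    ultimately show "emeasure \<sigma> E = emeasure \<tau> E"
      by (metis add.commute ennreal_add_left_cancel infinity_ennreal_def)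
  qed
qed

lemma act_add_lebesgue:
  assumes g: "g \<in> SL" and s: "sets \<sigma> = sets borel"
  shows "act g (add_lebesgue c \<sigma>) = add_lebesgue c (act g (\<sigma> :: (real ^ 'n) measure))"
proof (rule measure_eqI)
  obtain g' where g': "g' \<in> SL" "\<And>x. g *v (g' *v x) = x" using SL_inverse[OF g] by metis
  fix E assume "E \<in> sets (act g (add_lebesgue c \<sigma>))"
  then have E: "E \<in> sets borel" by simp
  define F where "F = (*v) g' ` E"
  have F: "F \<in> sets borel" unfolding F_def using g'(1) E by (intro borel_matrix_image) (auto simp: SL_def)
  have EF: "E = (*v) g ` F" by (simp add: F_def image_image g'(2))
  have E': "(*v) g ` F \<in> sets borel" using E EF by simp
  show "emeasure (act g (add_lebesgue c \<sigma>)) E = emeasure (add_lebesgue c (act g \<sigma>)) E"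
    unfolding EF emeasure_act_image[OF g sets_add_lebesgue F] emeasure_add_lebesgue[OF sets_act E']
      emeasure_add_lebesgue[OF s F] emeasure_act_image[OF g s F] emeasure_lborel_image[OF g F] ..
qed simp

lemma has_constant_part_remove:
  fixes \<nu> :: "(real ^ 'n) measure"
  assumes "has_constant_part c \<nu>"
  shows "\<exists>\<sigma>. has_constant_part 0 \<sigma> \<and> add_lebesgue c \<sigma> = \<nu>"
proof -
  have \<nu>: "\<nu> \<in> density_bounded_measures" using assms by (simp add: has_constant_part_def)
  then have s: "sets \<nu> = sets borel" by (simp add: density_bounded_measures_iff)
  obtain N where N: "N \<in> null_sets lborel"
    "\<And>E. E \<in> sets borel \<Longrightarrow> emeasure \<nu> E = emeasure \<nu> (E \<inter> N) + ennreal c * emeasure lborel E"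
    using assms by (auto simp: has_constant_part_def)
  have Nb: "N \<in> sets borel" using N(1) by auto
  let ?s = "density \<nu> (indicator N)"
  have e: "emeasure ?s E = emeasure \<nu> (E \<inter> N)" if "E \<in> sets borel" for E
  proof -
    have "emeasure ?s E = (\<integral>\<^sup>+x. indicator N x * indicator E x \<partial>\<nu>)"
      using that s Nb by (intro emeasure_density) (auto simp: measurable_cong_sets[OF s refl])
    also have "\<dots> = (\<integral>\<^sup>+x. indicator (E \<inter> N) x \<partial>\<nu>)"
      by (intro nn_integral_cong) (auto simp: indicator_def)
    finally show ?thesis using that s Nb by simp
  qed
  have ss: "sets ?s = sets borel" using s by simp
  have "emeasure ?s (ball 0 R) \<le> emeasure \<nu> (ball 0 R)" for R
    unfolding e[OF borel_open[OF open_ball]] using s by (intro emeasure_mono) auto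
  then have M: "?s \<in> density_bounded_measures"
    using \<nu> ss unfolding density_bounded_measures_iff by (meson order_trans)
  have "emeasure ?s E = emeasure ?s (E \<inter> N) + ennreal 0 * emeasure lborel E" if "E \<in> sets borel" for E
    using e[OF that] e[of "E \<inter> N"] that Nb by (simp add: Int_assoc)
  then have "has_constant_part 0 ?s" using M N(1) by (auto simp: has_constant_part_def)
  moreover have "add_lebesgue c ?s = \<nu>"
    by (rule measure_eqI) (use s N(2) e in \<open>simp_all add: emeasure_add_lebesgue[OF ss]\<close>)
  ultimately show ?thesis by blast
qed

text \<open>
  The inverse of \<open>add_lebesgue c\<close> on the measures with constant part \<open>c\<close>. The value elsewhere only has to lie in
  the space of density bounded measures; it concerns a null set of measures.
\<close>

definition remove_lebesgue :: "real \<Rightarrow> (real ^ 'n) measure \<Rightarrow> (real ^ 'n) measure" where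
  "remove_lebesgue c \<nu> = (if has_constant_part c \<nu> then (SOME \<sigma>. has_constant_part 0 \<sigma> \<and> add_lebesgue c \<sigma> = \<nu>)
     else null_measure borel)"

lemma remove_lebesgue:
  assumes "has_constant_part c \<nu>"
  shows "has_constant_part 0 (remove_lebesgue c \<nu>)" "add_lebesgue c (remove_lebesgue c \<nu>) = \<nu>"
    "remove_lebesgue c \<nu> \<in> density_bounded_measures"
  using someI_ex[OF has_constant_part_remove[OF assms]] assms
  by (auto simp: remove_lebesgue_def, auto simp: has_constant_part_def)

lemma remove_lebesgue_act:
  fixes \<nu> :: "(real ^ 'n) measure"
  assumes g: "g \<in> SL" and \<nu>: "has_constant_part c \<nu>"
  shows "remove_lebesgue c (act g \<nu>) = act g (remove_lebesgue c \<nu>)"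
proof -
  note r = remove_lebesgue[OF \<nu>] and r' = remove_lebesgue[OF has_constant_part_act[OF g \<nu>]]
  have "sets (remove_lebesgue c \<nu>) = sets borel" using r(3) by (simp add: density_bounded_measures_iff)
  then have "add_lebesgue c (act g (remove_lebesgue c \<nu>)) = act g \<nu>"
    using act_add_lebesgue[OF g, of "remove_lebesgue c \<nu>" c] r(2) by simp
  then have "add_lebesgue c (remove_lebesgue c (act g \<nu>)) = add_lebesgue c (act g (remove_lebesgue c \<nu>))"
    by (simp only: r'(2))
  then show ?thesis
    by (rule inj_onD[OF inj_on_add_lebesgue _ r'(3) act_in_density_bounded_measures[OF g r(3)]])
qed

lemma null_measure_density_bounded: "null_measure (borel :: (real ^ 'n) measure) \<in> density_bounded_measures"
  by (auto simp: density_bounded_measures_iff intro!: exI[of _ 0])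

text \<open>
  On the measures with constant part \<open>c\<close>, integrals of functions in \<open>Cc\<close> change by a fixed amount when the
  constant part is removed, so the removal is continuous there.
\<close>

lemma openin_remove_lebesgue:
  fixes U :: "(real ^ 'n) measure set"
  assumes c: "0 \<le> c" and U: "openin weak_star_topology U"
  shows "\<exists>V. openin weak_star_topology V \<and>
    remove_lebesgue c -` U \<inter> {\<nu>. has_constant_part c \<nu>} = V \<inter> {\<nu>. has_constant_part c \<nu>}"
proof -
  let ?R = "{\<nu> :: (real ^ 'n) measure. has_constant_part c \<nu>}"
  let ?T = "subtopology weak_star_topology ?R"
  have RM: "?R \<subseteq> density_bounded_measures" by (auto simp: has_constant_part_def)
  have top: "topspace ?T = ?R" using RM by auto
  let ?S = "{{\<nu> \<in> density_bounded_measures. integral\<^sup>L \<nu> f \<in> U} | f U. f \<in> Cc \<and> open U} :: (real ^ 'n) measure set set"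
  have "continuous_map ?T (topology_generated_by ?S) (remove_lebesgue c)"
  proof (rule continuous_on_generated_topo)
    fix W assume "W \<in> ?S"
    then obtain f and X :: "real set"
      where W: "W = {\<nu> \<in> density_bounded_measures. integral\<^sup>L \<nu> f \<in> X}" and f: "f \<in> Cc" and X: "open X" by blast
    let ?X = "(\<lambda>s. s - c * integral\<^sup>L lborel f) -` X"
    have "open ?X" using X by (intro continuous_open_vimage) (auto intro: continuous_intros)
    then have V: "openin weak_star_topology {\<nu> \<in> density_bounded_measures. integral\<^sup>L \<nu> f \<in> ?X}"
      unfolding weak_star_topology_def using f by (intro topology_generated_by_Basis) blast
    have int: "integral\<^sup>L (remove_lebesgue c \<nu>) f = integral\<^sup>L \<nu> f - c * integral\<^sup>L lborel f" if "has_constant_part c \<nu>" for \<nu>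
    proof -
      note r = remove_lebesgue[OF that]
      have "sets (remove_lebesgue c \<nu>) = sets borel" using r(3) by (simp add: density_bounded_measures_iff)
      from integral_add_lebesgue[OF this c integrable_Cc[OF r(3) f] lborel_Cc_integrable[OF f]]
      show ?thesis by (simp add: r(2))
    qed
    have "remove_lebesgue c -` W \<inter> topspace ?T = {\<nu> \<in> density_bounded_measures. integral\<^sup>L \<nu> f \<in> ?X} \<inter> ?R"
      unfolding top W using int remove_lebesgue(3) RM by auto
    then show "openin ?T (remove_lebesgue c -` W \<inter> topspace ?T)"
      using V by (auto simp: openin_subtopology)
  next
    have "\<Union>?S = density_bounded_measures"
      using topspace_weak_star[where 'a = 'n] unfolding weak_star_topology_def topology_generated_by_topspace .
    then show "remove_lebesgue c ` topspace ?T \<subseteq> \<Union>?S"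
      unfolding top using remove_lebesgue(3) by auto
  qed
  then have "continuous_map ?T weak_star_topology (remove_lebesgue c)"
    by (simp only: weak_star_topology_def)
  then have "openin ?T {\<nu> \<in> topspace ?T. remove_lebesgue c \<nu> \<in> U}"
    using U by (rule openin_continuous_map_preimage)
  moreover have "{\<nu> \<in> topspace ?T. remove_lebesgue c \<nu> \<in> U} = remove_lebesgue c -` U \<inter> ?R"
    unfolding top by auto
  ultimately show ?thesis by (auto simp: openin_subtopology)
qed

text \<open>
  By definition the Borel sets are generated by the open sets rather than by integrals of functions in \<open>Cc\<close>. Preimages of
  open sets are therefore computed directly, using continuity on the measurable set where the map is an inverse.
\<close>

lemma measurable_remove_lebesgue:
  assumes c: "0 \<le> c"
  shows "remove_lebesgue c \<in> measurable weak_star_borel (weak_star_borel :: (real ^ 'n) measure measure)"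
proof (rule measurable_sigma_sets[OF sets_weak_star_borel])
  let ?R = "{\<nu> :: (real ^ 'n) measure. has_constant_part c \<nu>}"
  have R: "?R \<in> sets weak_star_borel" by (rule sets_constant_part[OF c])
  show "remove_lebesgue c \<in> space (weak_star_borel :: (real ^ 'n) measure measure) \<rightarrow> density_bounded_measures"
  proof
    fix \<nu> :: "(real ^ 'n) measure"
    show "remove_lebesgue c \<nu> \<in> density_bounded_measures"
    proof (cases "has_constant_part c \<nu>")
      case True
      then show ?thesis by (rule remove_lebesgue(3))
    next
      case False
      then show ?thesis by (simp add: remove_lebesgue_def null_measure_density_bounded)
    qed
  qed
  fix U :: "(real ^ 'n) measure set" assume "U \<in> {U. openin weak_star_topology U}"
  then obtain V where V: "openin weak_star_topology V" "remove_lebesgue c -` U \<inter> ?R = V \<inter> ?R"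
    using openin_remove_lebesgue[OF c] by auto
  have "remove_lebesgue c -` U \<inter> space weak_star_borel =
      (V \<inter> ?R) \<union> (if null_measure borel \<in> U then space weak_star_borel - ?R else {})"
    using V(2) by (auto simp: remove_lebesgue_def has_constant_part_def split: if_splits)
  moreover have "V \<inter> ?R \<in> sets weak_star_borel"
    using V(1) R by (intro sets.Int) (auto simp: sets_weak_star_borel)
  moreover have "(if null_measure borel \<in> U then space weak_star_borel - ?R else {}) \<in> sets weak_star_borel"
    using sets.compl_sets[OF R] by simp
  ultimately show "remove_lebesgue c -` U \<inter> space weak_star_borel \<in> sets weak_star_borel"
    by (simp only: sets.Un)
qed (use openin_subset[of weak_star_topology] in auto)

text \<open>
  All properties are transported along the almost everywhere defined, equivariant inverse of \<open>add_lebesgue c\<close>.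
  Ergodicity demands strictly invariant sets: the preimage of such a set is intersected with the strictly invariant set of
  measures with constant part \<open>c\<close>, on which equivariance holds everywhere. Singularity is deduced from
  \<open>has_constant_part 0\<close>, which describes a measurable set.
\<close>

lemma singular_siegel_remove_lebesgue:
  fixes \<mu> :: "(real ^ 'n) measure measure"
  assumes \<mu>: "siegel_measure \<mu>" and c: "0 \<le> c" and ae: "AE \<nu> in \<mu>. has_constant_part c \<nu>"
  shows "singular_siegel_measure (distr \<mu> weak_star_borel (remove_lebesgue c))" (is "singular_siegel_measure ?\<sigma>")
    and "\<mu> = distr (distr \<mu> weak_star_borel (remove_lebesgue c)) weak_star_borel (add_lebesgue c)"
proof -
  let ?T = "remove_lebesgue c"
  let ?W = "weak_star_borel :: (real ^ 'n) measure measure"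
  let ?R = "{\<nu> :: (real ^ 'n) measure. has_constant_part c \<nu>}"
  have sets: "sets \<mu> = sets ?W" and inv: "\<And>g. g \<in> SL \<Longrightarrow> distr \<mu> ?W (act g) = \<mu>"
    and erg: "ergodic_SL \<mu>" and P: "prob_space \<mu>"
    using \<mu> by (auto simp: siegel_measure_def)
  interpret prob_space \<mu> by (rule P)
  have sp: "space \<mu> = density_bounded_measures" using sets_eq_imp_space_eq[OF sets] by simp
  have TW: "?T \<in> measurable ?W ?W" by (rule measurable_remove_lebesgue[OF c])
  have T: "?T \<in> measurable \<mu> ?W" using TW by (simp add: measurable_cong_sets[OF sets refl])
  have act: "act g \<in> measurable \<mu> ?W" if "g \<in> SL" for g :: "real ^ 'n ^ 'n"
    using measurable_act[OF that] by (simp add: measurable_cong_sets[OF sets refl])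
  have inv\<sigma>: "distr ?\<sigma> ?W (act g) = ?\<sigma>" if g: "g \<in> SL" for g
  proof -
    have "distr ?\<sigma> ?W (act g) = distr \<mu> ?W (act g \<circ> ?T)"
      by (rule distr_distr[OF measurable_act[OF g] T])
    also have "\<dots> = distr \<mu> ?W (?T \<circ> act g)"
    proof (rule distr_cong_AE[OF refl refl])
      show "AE \<nu> in \<mu>. (act g \<circ> ?T) \<nu> = (?T \<circ> act g) \<nu>"
        using ae by eventually_elim (simp add: remove_lebesgue_act[OF g])
    qed (use measurable_comp[OF T measurable_act[OF g]] measurable_comp[OF act[OF g] TW] in auto)
    also have "\<dots> = distr (distr \<mu> ?W (act g)) ?W ?T"
      by (rule distr_distr[OF TW act[OF g], symmetric])
    finally show ?thesis by (simp only: inv[OF g])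
  qed
  have erg\<sigma>: "emeasure ?\<sigma> A = 0 \<or> emeasure ?\<sigma> A = 1" if A: "A \<in> sets ?\<sigma>" "\<forall>g\<in>SL. act g ` A = A" for A
  proof -
    let ?A = "?T -` A \<inter> space \<mu> \<inter> ?R"
    have AW: "A \<in> sets ?W" using A(1) by simp
    have TA: "?T -` A \<inter> space \<mu> \<in> sets \<mu>" by (rule measurable_sets[OF T AW])
    have R: "?R \<in> sets \<mu>" using sets_constant_part[OF c] by (simp add: sets)
    have "\<forall>g\<in>SL. act g ` ?A = ?A"
    proof (rule invariant_setI)
      fix g :: "real ^ 'n ^ 'n" and \<nu> assume g: "g \<in> SL" and \<nu>: "\<nu> \<in> ?A"
      then have "act g (?T \<nu>) \<in> A" using A(2) by blast
      then show "act g \<nu> \<in> ?A"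
        using \<nu> g has_constant_part_act[OF g] act_in_density_bounded_measures[OF g]
        by (auto simp: sp remove_lebesgue_act)
    qed (auto simp: sp)
    then have "emeasure \<mu> ?A = 0 \<or> emeasure \<mu> ?A = 1"
      using erg TA R by (auto simp: ergodic_SL_def)
    moreover have "emeasure ?\<sigma> A = emeasure \<mu> (?T -` A \<inter> space \<mu>)"
      by (rule emeasure_distr[OF T AW])
    moreover have "emeasure \<mu> (?T -` A \<inter> space \<mu>) = emeasure \<mu> ?A"
    proof (rule emeasure_eq_AE)
      show "AE \<nu> in \<mu>. \<nu> \<in> ?T -` A \<inter> space \<mu> \<longleftrightarrow> \<nu> \<in> ?A"
        using ae by eventually_elim auto
    qed (use TA R in auto)
    ultimately show ?thesis by simp
  qed
  have "siegel_measure ?\<sigma>"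
    unfolding siegel_measure_def ergodic_SL_def
    using inv\<sigma> erg\<sigma> prob_space_distr[OF T] by simp
  moreover have "AE \<sigma> in ?\<sigma>. has_constant_part 0 \<sigma>"
  proof -
    have "{\<sigma> \<in> space ?W. has_constant_part 0 \<sigma>} = {\<sigma> :: (real ^ 'n) measure. has_constant_part 0 \<sigma>}"
      by (auto simp: has_constant_part_def)
    then have "{\<sigma> \<in> space ?W. has_constant_part 0 \<sigma>} \<in> sets ?W"
      using sets_constant_part[of 0, where 'n = 'n] by simp
    then show ?thesis
      using ae remove_lebesgue(1) by (subst AE_distr_iff[OF T]) (auto elim: eventually_mono)
  qed
  then have "AE \<sigma> in ?\<sigma>. mutually_singular \<sigma> lborel"
  proof eventually_elim
    case (elim \<sigma>)
    then obtain N where N: "N \<in> null_sets lborel" "\<And>E. E \<in> sets borel \<Longrightarrow> emeasure \<sigma> E = emeasure \<sigma> (E \<inter> N)"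
      and s: "sets \<sigma> = sets borel"
      by (auto simp: has_constant_part_def density_bounded_measures_iff)
    have "- N \<in> sets borel" using N(1) by (simp add: null_sets_def borel_comp)
    then have "emeasure \<sigma> (- N) = 0" using N(2)[of "- N"] by simp
    with N(1) s \<open>- N \<in> sets borel\<close> show ?case
      by (auto simp: mutually_singular_def intro!: bexI[of _ "- N"])
  qed
  ultimately show "singular_siegel_measure ?\<sigma>" by (simp add: singular_siegel_measure_def)
  have "distr ?\<sigma> ?W (add_lebesgue c) = distr \<mu> ?W (add_lebesgue c \<circ> ?T)"
    by (rule distr_distr[OF measurable_add_lebesgue[OF c] T])
  also have "\<dots> = distr \<mu> ?W (\<lambda>\<nu>. \<nu>)"
  proof (rule distr_cong_AE[OF refl refl])
    show "AE \<nu> in \<mu>. (add_lebesgue c \<circ> ?T) \<nu> = \<nu>"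
      using ae by eventually_elim (simp add: remove_lebesgue(2))
  qed (use measurable_comp[OF T measurable_add_lebesgue[OF c]] in \<open>auto simp: measurable_cong_sets[OF sets refl]\<close>)
  also have "\<dots> = \<mu>" using sets by (intro distr_id2) simp
  finally show "\<mu> = distr ?\<sigma> ?W (add_lebesgue c)" ..
qed

lemma absolutely_continuous_constant_part:
  fixes \<nu> :: "(real ^ 'n) measure"
  assumes "has_constant_part c \<nu>" "absolutely_continuous lborel \<nu>"
  shows "\<nu> = scale_measure (ennreal c) lborel"
proof -
  have s: "sets \<nu> = sets borel" using assms(1) by (simp add: has_constant_part_def density_bounded_measures_iff)
  obtain N where N: "N \<in> null_sets lborel"
    "\<And>E. E \<in> sets borel \<Longrightarrow> emeasure \<nu> E = emeasure \<nu> (E \<inter> N) + ennreal c * emeasure lborel E"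
    using assms(1) by (auto simp: has_constant_part_def)
  have "N \<in> null_sets \<nu>" using assms(2) N(1) by (auto simp: absolutely_continuous_def)
  then have "emeasure \<nu> (E \<inter> N) = 0" if "E \<in> sets borel" for E
    using null_sets_subset[of N \<nu> "E \<inter> N"] that N(1) s by auto
  then show ?thesis using N(2) s by (intro measure_eqI) auto
qed

theorem theorem0p20:
  fixes \<mu> :: "(real ^ 'n) measure measure"
  assumes "CARD('n) > 1"
    and "siegel_measure \<mu>"
  shows "(\<exists>c\<ge>0. \<exists>\<mu>s. singular_siegel_measure \<mu>s \<and> \<mu> = distr \<mu>s weak_star_borel (add_lebesgue c)) \<and>
    ((AE \<nu> in \<mu>. absolutely_continuous lborel \<nu>) \<longrightarrow>
      (\<exists>c\<ge>0. \<mu> = return weak_star_borel (scale_measure (ennreal c) lborel)))"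
proof -
  obtain c where c: "0 \<le> c" and ae: "AE \<nu> in \<mu>. has_constant_part c \<nu>"
    using siegel_constant_part[OF assms] by blast
  let ?p = "scale_measure (ennreal c) (lborel :: (real ^ 'n) measure)"
  have "\<mu> = return weak_star_borel ?p" if ac: "AE \<nu> in \<mu>. absolutely_continuous lborel \<nu>"
  proof -
    have sets: "sets \<mu> = sets weak_star_borel" and P: "prob_space \<mu>"
      using assms(2) by (auto simp: siegel_measure_def)
    interpret prob_space \<mu> by (rule P)
    have eq: "AE \<nu> in \<mu>. \<nu> = ?p"
      using ae ac by eventually_elim (rule absolutely_continuous_constant_part)
    have p: "?p \<in> space weak_star_borel"
    proof (rule ccontr)
      assume p: "?p \<notin> space weak_star_borel"
      from eq ae have "AE \<nu> in \<mu>. False"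
        by eventually_elim (use p in \<open>auto simp: has_constant_part_def\<close>)
      then show False by simp
    qed
    have "\<mu> = distr \<mu> weak_star_borel (\<lambda>\<nu>. \<nu>)" using sets by (intro distr_id2[symmetric]) simp
    also have "\<dots> = distr \<mu> weak_star_borel (\<lambda>_. ?p)"
      using eq p by (intro distr_cong_AE) (auto simp: measurable_cong_sets[OF sets refl])
    also have "\<dots> = return weak_star_borel ?p" using p by (rule distr_const)
    finally show ?thesis .
  qed
  then show ?thesis
    using c singular_siegel_remove_lebesgue[OF assms(2) c ae] by blast
qed

end
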